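(* Let $\alpha$ be a countable ordinal and $n\in\mathbb{N}$, and let $\omega^{\alpha}\cdot n+1$ be the corresponding compact, countable ordinal equipped with the order topology. Then the group $\operatorname{Homeo}(\omega^{\alpha}\cdot n+1)$ has the automatic continuity property.
   Context: The homeomorphism group carries the compact-open topology. A topological group $G$ has the automatic continuity property if every group homomorphism from $G$ to a separable topological group is continuous. *)

theory Defs
  imports "HOL-Analysis.Analysis" "HOL-Algebra.Bij"
begin

text \<open>
  Ordinals are represented by well-orders \<open>r :: 'a rel\<close> on their fields, as in the
  well-order theories of \<open>Main\<close>.  The operations below are the usual set-theoretic ones and follow
  \<open>HOL-Cardinals.Ordinal_Arithmetic\<close>.
\<close>

definition ord_sum :: "'a rel \<Rightarrow> 'b rel \<Rightarrow> ('a + 'b) rel" where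
  "ord_sum r s =
     {(Inl x, Inl y) | x y. (x, y) \<in> r} \<union> {(Inr x, Inr y) | x y. (x, y) \<in> s} \<union>
     {(Inl x, Inr y) | x y. x \<in> Field r \<and> y \<in> Field s}"

text \<open>The second component is the more significant one: the product is \<open>s\<close> many copies of \<open>r\<close>.\<close>

definition ord_prod :: "'a rel \<Rightarrow> 'b rel \<Rightarrow> ('a \<times> 'b) rel" where
  "ord_prod r s =
     {((x1, y1), (x2, y2)). x1 \<in> Field r \<and> x2 \<in> Field r \<and> y1 \<in> Field s \<and> y2 \<in> Field s \<and>
        ((y1, y2) \<in> s - Id \<or> y1 = y2 \<and> (x1, x2) \<in> r)}"

text \<open>
  The elements of \<open>\<omega>\<^sup>r\<close> are the finitely supported functions \<open>f\<close> from \<open>Field r\<close> to the natural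
  numbers, extended by 0; \<open>f\<close> stands for the Cantor normal form whose coefficient at the
  exponent \<open>x\<close> is \<open>f x\<close>.  Two such functions are compared at the largest argument where they differ.
\<close>

definition omega_power_carrier :: "'a rel \<Rightarrow> ('a \<Rightarrow> nat) set" where
  "omega_power_carrier r = {f. finite {x. f x \<noteq> 0} \<and> {x. f x \<noteq> 0} \<subseteq> Field r}"

definition omega_power :: "'a rel \<Rightarrow> ('a \<Rightarrow> nat) rel" where
  "omega_power r =
     {(f, g). f \<in> omega_power_carrier r \<and> g \<in> omega_power_carrier r \<and>
        (f = g \<or> (\<exists>x\<in>Field r. f x < g x \<and> (\<forall>y. (x, y) \<in> r - Id \<longrightarrow> f y = g y)))}"

text \<open>The whole field is among the generators so that a one-point order gets the right space.\<close>

definition order_topology_of :: "'a rel \<Rightarrow> 'a topology" where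
  "order_topology_of r = topology_generated_by
     ({Field r} \<union> {{x. (x, a) \<in> r - Id} | a. a \<in> Field r} \<union> {{x. (a, x) \<in> r - Id} | a. a \<in> Field r})"

definition Homeo :: "'a topology \<Rightarrow> ('a \<Rightarrow> 'a) monoid" where
  "Homeo X = (BijGroup (topspace X))
     \<lparr>carrier := {f \<in> Bij (topspace X). homeomorphic_map X X f}\<rparr>"

definition Homeo_topology :: "'a topology \<Rightarrow> ('a \<Rightarrow> 'a) topology" where
  "Homeo_topology X = topology_generated_by
     {{f \<in> carrier (Homeo X). f ` K \<subseteq> U} | K U. compactin X K \<and> openin X U}"

definition topological_group :: "('a, 'm) monoid_scheme \<Rightarrow> 'a topology \<Rightarrow> bool" where
  "topological_group G T \<longleftrightarrow>
     group G \<and> topspace T = carrier G \<and>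
     continuous_map (prod_topology T T) T (\<lambda>(x, y). x \<otimes>\<^bsub>G\<^esub> y) \<and>
     continuous_map T T (\<lambda>x. inv\<^bsub>G\<^esub> x)"

text \<open>
  A definition cannot quantify over types, so the type of the elements of the target group is a
  parameter; the property proper is obtained by leaving \<open>'h\<close> arbitrary.  Topological groups
  are not required to be Hausdorff.
\<close>

definition automatic_continuity ::
  "'h itself \<Rightarrow> ('a, 'm) monoid_scheme \<Rightarrow> 'a topology \<Rightarrow> bool" where
  "automatic_continuity (_ :: 'h itself) G T \<longleftrightarrow>
     topological_group G T \<and>
     (\<forall>(H :: 'h monoid) S \<phi>.
        topological_group H S \<and> separable_space S \<and> \<phi> \<in> hom G H \<longrightarrow> continuous_map T S \<phi>)"

end

theory Submission
  imports Defs "HOL-Library.Multiset"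
begin

text \<open>
  Let \<open>\<phi>\<close> be a homomorphism from \<open>Homeo X\<close> to a separable group \<open>H\<close>, and let \<open>N\<close> be a
  neighbourhood of the identity of \<open>H\<close>.  Countably many translates of \<open>N\<close> cover \<open>H\<close>, so the
  homeomorphisms of \<open>X\<close> can be coloured with natural numbers in such a way that the quotient of
  two homeomorphisms of the same colour is mapped into \<open>N\<close>.  Continuity of \<open>\<phi>\<close> follows once products
  of a fixed number of elements of \<open>W = \<phi>\<^sup>-\<^sup>1(N)\<close> fill a neighbourhood of the identity.

  The local step shows this near a point \<open>y\<close> that has a neighbourhood \<open>V 0\<close> in which every compact
  piece of \<open>V 0 - {y}\<close> reappears, as a clopen copy, arbitrarily close to \<open>y\<close>.  Call a set that
  contains all these copies rich.  By a Cantor-Bernstein argument any two rich sets are homeomorphic by a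
  map that extends continuously to \<open>y\<close> (\<open>rich_phomeo_E\<close>).  Rich sets therefore behave like the infinite
  subsets of a countable set, and the method by which one treats the group of all permutations of a
  countable set applies.  A diagonal argument over the colours (\<open>extend_prescribed_values\<close>), a
  commutator computation and an infinite swindle give a rich set \<open>Q\<close> such that all homeomorphisms
  supported in \<open>Q\<close> are products of four elements of \<open>W\<close> (\<open>words_contain_rich_support\<close>).  An
  uncountable almost disjoint family and the pigeonhole principle give \<open>g \<in> W\<close> for which \<open>Q\<close> and
  \<open>g Q\<close> overlap in a rich set and together contain a punctured neighbourhood \<open>V m - {y}\<close>
  (\<open>overlapping_translate\<close>).  A homeomorphism supported in \<open>V m - {y}\<close> then factors into
  homeomorphisms supported in \<open>Q\<close> or \<open>g Q\<close> (\<open>factor_over_overlapping_pieces\<close>).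

  For the global step, consider the points that have a clopen neighbourhood
  \<open>Z\<close> such that \<open>\<phi>\<close> is continuous at the identity on the homeomorphisms supported in \<open>Z\<close>.
  They form an open set that is invariant under \<open>Homeo X\<close>.  If its complement \<open>F\<close> were nonempty, it
  would have a least element \<open>y\<close>.  This \<open>y\<close> is isolated in \<open>F\<close>, hence fixed by every
  homeomorphism supported in a small neighbourhood of \<open>y\<close>, and the local step, combined with
  compactness away from \<open>y\<close>, shows that \<open>y\<close> does not belong to \<open>F\<close> (\<open>tame_topspace\<close>).

  What remains is ordinal arithmetic: a point \<open>y\<close> of \<open>\<omega>\<^sup>\<alpha> n + 1\<close> other than the first one has the
  form \<open>\<eta> + \<omega>\<^sup>\<beta>\<close>, and increasing the coefficient of a suitable \<open>\<omega>\<^sup>\<gamma>\<close> with \<open>\<gamma> < \<beta>\<close>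
  in Cantor normal form moves any piece \<open>(\<eta>, \<delta>]\<close> of the interval \<open>(\<eta>, y)\<close> beyond any given point of it
  (\<open>self_similar_if_block\<close>).
\<close>

section \<open>Homeomorphisms as permutations of the underlying type\<close>

text \<open>
  The notation \<open>inv\<close> is taken by the inverse in a group.
\<close>
abbreviation finv :: "('a \<Rightarrow> 'a) \<Rightarrow> 'a \<Rightarrow> 'a" where "finv \<equiv> inv_into UNIV"

text \<open>
  Homeomorphisms are extended to the whole type by the identity.  Composition and inverse are then
  those of functions, and homeomorphisms with different supports live in one group.
\<close>
definition homeos :: "'a topology \<Rightarrow> ('a \<Rightarrow> 'a) set" where
  "homeos X = {p. bij p \<and> (\<forall>z. z \<notin> topspace X \<longrightarrow> p z = z) \<and>
     continuous_map X X p \<and> continuous_map X X (finv p)}"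

definition homeos_on :: "'a topology \<Rightarrow> 'a set \<Rightarrow> ('a \<Rightarrow> 'a) set" where
  "homeos_on X M = {p \<in> homeos X. \<forall>z. z \<notin> M \<longrightarrow> p z = z}"

lemma homeos_bij: "p \<in> homeos X \<Longrightarrow> bij p"
  by (simp add: homeos_def)

lemma homeos_id: "id \<in> homeos X"
  by (auto simp: homeos_def inv_id)

lemma homeos_comp: "p \<in> homeos X \<Longrightarrow> q \<in> homeos X \<Longrightarrow> p \<circ> q \<in> homeos X"
  by (auto simp: homeos_def bij_comp o_inv_distrib intro: continuous_map_compose)

lemma homeos_inv: "p \<in> homeos X \<Longrightarrow> finv p \<in> homeos X"
  by (auto simp: homeos_def bij_imp_bij_inv inv_inv_eq)
     (metis bij_inv_eq_iff)

lemma homeos_on_subset: "homeos_on X M \<subseteq> homeos X"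
  by (auto simp: homeos_on_def)

lemma homeos_on_mono: "M \<subseteq> N \<Longrightarrow> homeos_on X M \<subseteq> homeos_on X N"
  by (auto simp: homeos_on_def)

lemma homeos_on_id: "id \<in> homeos_on X M"
  by (simp add: homeos_on_def homeos_id)

lemma homeos_on_comp:
  "p \<in> homeos_on X M \<Longrightarrow> q \<in> homeos_on X M \<Longrightarrow> p \<circ> q \<in> homeos_on X M"
  by (simp add: homeos_on_def homeos_comp)

lemma homeos_on_inv: "p \<in> homeos_on X M \<Longrightarrow> finv p \<in> homeos_on X M"
  by (auto simp: homeos_on_def homeos_inv) (metis bij_inv_eq_iff homeos_bij)

lemma homeos_on_image:
  assumes "p \<in> homeos_on X M" "M \<subseteq> N"
  shows "p ` N = N"
proof -
  have b: "bij p" using assms by (auto simp: homeos_on_def intro: homeos_bij)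
  have "q z \<in> N" if "q \<in> homeos_on X M" "z \<in> N" for q z
  proof (rule ccontr)
    assume n: "q z \<notin> N"
    hence "q (q z) = q z" using that assms(2) by (auto simp: homeos_on_def)
    hence "q z = z" using that(1) by (metis (mono_tags, lifting) bij_inv_eq_iff homeos_bij homeos_on_subset subsetD)
    thus False using n that by simp
  qed
  from this[OF assms(1)] this[OF homeos_on_inv[OF assms(1)]] show ?thesis
    by (metis b bij_inv_eq_iff image_eqI subsetI image_subsetI subset_antisym)
qed

lemma homeos_on_conjugate:
  assumes "p \<in> homeos_on X M" "q \<in> homeos X"
  shows "q \<circ> p \<circ> finv q \<in> homeos_on X (q ` M)"
proof -
  have b: "bij q" using assms by (simp add: homeos_bij)
  have "(q \<circ> p \<circ> finv q) z = z" if "z \<notin> q ` M" for z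
  proof -
    have "finv q z \<notin> M" using that b by (metis bij_inv_eq_iff image_eqI)
    thus ?thesis using assms(1) b by (simp add: homeos_on_def bij_is_surj surj_f_inv_f)
  qed
  thus ?thesis using assms by (simp add: homeos_on_def homeos_comp homeos_inv)
qed

lemma homeos_image_topspace: "p \<in> homeos X \<Longrightarrow> p ` topspace X = topspace X"
  by (rule homeos_on_image[of _ _ "topspace X"]) (auto simp: homeos_on_def homeos_def)

lemma homeos_openin_image:
  assumes "p \<in> homeos X" "openin X U" shows "openin X (p ` U)"
proof -
  have "p ` U = {z \<in> topspace X. finv p z \<in> U}"
  proof -
    have "bij p" using assms homeos_bij by blast
    moreover have "p ` U \<subseteq> topspace X"
      using homeos_image_topspace[OF assms(1)] openin_subset[OF assms(2)] by blast
    ultimately show ?thesis by (auto simp: bij_is_inj) (metis bij_inv_eq_iff image_eqI)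
  qed
  moreover have "continuous_map X X (finv p)" using assms by (simp add: homeos_def)
  ultimately show ?thesis using assms(2) openin_continuous_map_preimage by metis
qed

lemma homeos_closedin_image:
  assumes "p \<in> homeos X" "closedin X U" shows "closedin X (p ` U)"
proof -
  have "inj p" using assms(1) homeos_bij bij_is_inj by blast
  hence "topspace X - p ` U = p ` (topspace X - U)"
    by (simp add: image_set_diff homeos_image_topspace[OF assms(1)])
  moreover have "p ` U \<subseteq> topspace X"
    using homeos_image_topspace[OF assms(1)] closedin_subset[OF assms(2)] by blast
  ultimately show ?thesis using assms homeos_openin_image[OF assms(1), of "topspace X - U"]
    by (simp add: closedin_def)
qed

lemma homeos_finv_simps:
  assumes "p \<in> homeos X" shows "finv p (p z) = z" "p (finv p z) = z" "finv p \<circ> p = id" "p \<circ> finv p = id"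
  using homeos_bij[OF assms] by (auto simp: bij_is_inj bij_is_surj surj_f_inv_f fun_eq_iff)

lemma homeos_on_mem:
  assumes "p \<in> homeos_on X M" "M \<subseteq> N" shows "p z \<in> N \<longleftrightarrow> z \<in> N"
proof -
  have "inj p" using assms homeos_on_subset homeos_bij bij_is_inj by blast
  thus ?thesis using homeos_on_image[OF assms] by (metis image_eqI inj_image_mem_iff)
qed

lemma homeos_onD: "p \<in> homeos_on X M \<Longrightarrow> z \<notin> M \<Longrightarrow> p z = z"
  by (simp add: homeos_on_def)

lemma homeos_onI: "p \<in> homeos X \<Longrightarrow> (\<And>z. z \<notin> M \<Longrightarrow> p z = z) \<Longrightarrow> p \<in> homeos_on X M"
  by (simp add: homeos_on_def)

lemma commutator_eqI:
  assumes "w \<in> homeos X" "v \<in> homeos X" "\<And>z. w (v z) = f (v (w z))"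
  shows "f = w \<circ> v \<circ> finv w \<circ> finv v"
proof
  fix z
  have "w (v (finv w (finv v z))) = f (v (w (finv w (finv v z))))" by (rule assms(3))
  thus "f z = (w \<circ> v \<circ> finv w \<circ> finv v) z" using assms by (simp add: homeos_finv_simps)
qed

text \<open>
  The maps \<open>w\<close> and \<open>v\<close> are known on \<open>P\<close> and on \<open>M\<close> only, but \<open>v\<close> is trivial on \<open>M - P\<close> and
  \<open>w\<close> is trivial off \<open>M\<close>, so wherever one of them is unknown the other one is trivial.
\<close>
lemma commutator_of_partial_agreement:
  assumes w: "w \<in> homeos_on X M" and v: "v \<in> homeos X"
    and f: "f \<in> homeos_on X P" and g: "g \<in> homeos_on X P" and PM: "P \<subseteq> M"
    and wf: "\<And>z. z \<in> P \<Longrightarrow> w z = f z" and vg: "\<And>z. z \<in> M \<Longrightarrow> v z = g z"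
  shows "f \<circ> g \<circ> finv f \<circ> finv g = w \<circ> v \<circ> finv w \<circ> finv v"
proof (rule commutator_eqI)
  show "w \<in> homeos X" "v \<in> homeos X" using w v by (auto simp: homeos_on_def)
  have f': "f \<in> homeos X" and g': "g \<in> homeos X" and w': "w \<in> homeos X"
    using w f g by (auto simp: homeos_on_def)
  have C: "f \<circ> g \<circ> finv f \<circ> finv g \<in> homeos_on X P"
    using f g by (intro homeos_on_comp homeos_on_inv)
  fix z
  consider "z \<in> P" | "z \<in> M - P" | "z \<notin> M" by blast
  thus "w (v z) = (f \<circ> g \<circ> finv f \<circ> finv g) (v (w z))"
  proof cases
    case 1
    hence "g z \<in> P" "f z \<in> P" using homeos_on_mem[OF f order_refl] homeos_on_mem[OF g order_refl] by auto
    hence "w (v z) = f (g z)" "v (w z) = g (f z)" using 1 PM wf vg by auto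
    thus ?thesis using f' g' by (simp add: homeos_finv_simps)
  next
    case 2
    have "w ` P = P" using homeos_on_image[OF f order_refl] wf by (metis image_cong)
    hence "w z \<notin> P" using 2 homeos_bij[OF w'] by (metis DiffD2 bij_is_inj inj_image_mem_iff)
    moreover have "w z \<in> M" using 2 homeos_on_mem[OF w order_refl] by blast
    ultimately show ?thesis
      using 2 vg homeos_onD[OF g] homeos_onD[OF C] by simp
  next
    case 3
    have "v ` M = M" using homeos_on_image[OF g PM] vg by (metis image_cong)
    hence "v z \<notin> M" using 3 homeos_bij[OF v] by (metis bij_is_inj inj_image_mem_iff)
    hence "v z \<notin> P" using PM by blast
    thus ?thesis using 3 \<open>v z \<notin> M\<close> homeos_onD[OF w] homeos_onD[OF C] by simp
  qed
qed

section \<open>The homeomorphism group as a topological group\<close>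

abbreviation restr :: "'a topology \<Rightarrow> ('a \<Rightarrow> 'a) \<Rightarrow> 'a \<Rightarrow> 'a" where
  "restr X p \<equiv> restrict p (topspace X)"

lemma Homeo_carrier: "carrier (Homeo X) = {f \<in> Bij (topspace X). homeomorphic_map X X f}"
  by (simp add: Homeo_def)

lemma homeos_bij_betw: "p \<in> homeos X \<Longrightarrow> bij_betw p (topspace X) (topspace X)"
  using homeos_image_topspace[of p X] homeos_bij[of p X]
  by (auto simp: bij_betw_def intro: inj_on_subset dest: bij_is_inj)

lemma restr_Bij: "p \<in> homeos X \<Longrightarrow> restr X p \<in> Bij (topspace X)"
  using homeos_bij_betw[of p X] by (simp add: Bij_def)

lemma restr_in_Homeo:
  assumes "p \<in> homeos X" shows "restr X p \<in> carrier (Homeo X)"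
proof -
  have "homeomorphic_maps X X p (finv p)"
    using assms homeos_bij[OF assms]
    by (auto simp: homeomorphic_maps_def homeos_def bij_is_inj bij_is_surj surj_f_inv_f)
  hence "homeomorphic_map X X p" by (auto simp: homeomorphic_map_maps)
  hence "homeomorphic_map X X (restr X p)" by (rule homeomorphic_map_eq) simp
  thus ?thesis using restr_Bij[OF assms] by (simp add: Homeo_carrier)
qed

lemma Homeo_carrier_restr:
  assumes "f \<in> carrier (Homeo X)" obtains p where "p \<in> homeos X" "f = restr X p"
proof -
  let ?S = "topspace X"
  have f: "f \<in> extensional ?S" "bij_betw f ?S ?S" "homeomorphic_map X X f"
    using assms by (auto simp: Homeo_carrier Bij_def)
  obtain g where g: "homeomorphic_maps X X f g" using f(3) by (auto simp: homeomorphic_map_maps)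
  define p where "p z = (if z \<in> ?S then f z else z)" for z
  define q where "q z = (if z \<in> ?S then g z else z)" for z
  have fg: "continuous_map X X f" "continuous_map X X g" "\<And>z. z \<in> ?S \<Longrightarrow> g (f z) = z" "\<And>z. z \<in> ?S \<Longrightarrow> f (g z) = z"
    using g by (auto simp: homeomorphic_maps_def)
  have fgS: "f z \<in> ?S" "g z \<in> ?S" if "z \<in> ?S" for z
    using fg(1,2) that by (auto simp: continuous_map_def)
  have qp: "q \<circ> p = id" "p \<circ> q = id" using fg fgS by (auto simp: p_def q_def fun_eq_iff)
  hence "bij p" using o_bij by blast
  moreover have "finv p = q" using qp by (intro inv_unique_comp)
  moreover have "continuous_map X X p" by (rule continuous_map_eq[OF fg(1)]) (simp add: p_def)
  moreover have "continuous_map X X q" by (rule continuous_map_eq[OF fg(2)]) (simp add: q_def)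
  ultimately have "p \<in> homeos X" by (simp add: homeos_def p_def)
  moreover have "f = restr X p"
    using f(1) by (intro extensionalityI[of _ ?S]) (simp_all add: p_def)
  ultimately show ?thesis using that by blast
qed

lemma Homeo_mult:
  assumes "p \<in> homeos X" "q \<in> homeos X"
  shows "restr X p \<otimes>\<^bsub>Homeo X\<^esub> restr X q = restr X (p \<circ> q)"
proof -
  have "q z \<in> topspace X" if "z \<in> topspace X" for z
    using homeos_image_topspace[OF assms(2)] that by blast
  hence "compose (topspace X) (restr X p) (restr X q) = restr X (p \<circ> q)"
    by (auto simp: compose_def fun_eq_iff)
  thus ?thesis using restr_Bij[OF assms(1)] restr_Bij[OF assms(2)]
    by (simp add: Homeo_def BijGroup_def)
qed

lemma Homeo_one: "\<one>\<^bsub>Homeo X\<^esub> = restr X id"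
  by (simp add: Homeo_def BijGroup_def id_def)

lemma group_Homeo: "group (Homeo X)"
proof (rule groupI)
  fix f g h assume "f \<in> carrier (Homeo X)" "g \<in> carrier (Homeo X)" "h \<in> carrier (Homeo X)"
  then obtain p q r where pqr: "p \<in> homeos X" "q \<in> homeos X" "r \<in> homeos X"
    "f = restr X p" "g = restr X q" "h = restr X r"
    using Homeo_carrier_restr by metis
  show "f \<otimes>\<^bsub>Homeo X\<^esub> g \<otimes>\<^bsub>Homeo X\<^esub> h = f \<otimes>\<^bsub>Homeo X\<^esub> (g \<otimes>\<^bsub>Homeo X\<^esub> h)"
    using pqr by (simp add: Homeo_mult homeos_comp comp_assoc del: restrict_apply')
next
  fix f g assume "f \<in> carrier (Homeo X)" "g \<in> carrier (Homeo X)"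
  then obtain p q where "p \<in> homeos X" "q \<in> homeos X" "f = restr X p" "g = restr X q"
    using Homeo_carrier_restr by metis
  thus "f \<otimes>\<^bsub>Homeo X\<^esub> g \<in> carrier (Homeo X)"
    using Homeo_mult restr_in_Homeo homeos_comp by metis
next
  show "\<one>\<^bsub>Homeo X\<^esub> \<in> carrier (Homeo X)" unfolding Homeo_one using restr_in_Homeo homeos_id by blast
next
  fix f assume "f \<in> carrier (Homeo X)"
  then obtain p where p: "p \<in> homeos X" "f = restr X p" using Homeo_carrier_restr by metis
  show "\<one>\<^bsub>Homeo X\<^esub> \<otimes>\<^bsub>Homeo X\<^esub> f = f"
    unfolding Homeo_one p(2) Homeo_mult[OF homeos_id p(1)] by simp
  have "restr X (finv p) \<otimes>\<^bsub>Homeo X\<^esub> f = \<one>\<^bsub>Homeo X\<^esub>"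
    unfolding Homeo_one p(2) Homeo_mult[OF homeos_inv[OF p(1)] p(1)] homeos_finv_simps(3)[OF p(1)] ..
  thus "\<exists>g\<in>carrier (Homeo X). g \<otimes>\<^bsub>Homeo X\<^esub> f = \<one>\<^bsub>Homeo X\<^esub>"
    using restr_in_Homeo homeos_inv p by blast
qed

lemma Homeo_inv:
  assumes "p \<in> homeos X" shows "inv\<^bsub>Homeo X\<^esub> (restr X p) = restr X (finv p)"
proof (rule group.inv_equality[OF group_Homeo])
  show "restr X (finv p) \<otimes>\<^bsub>Homeo X\<^esub> restr X p = \<one>\<^bsub>Homeo X\<^esub>"
    unfolding Homeo_one Homeo_mult[OF homeos_inv[OF assms] assms] homeos_finv_simps(3)[OF assms] ..
qed (use assms restr_in_Homeo homeos_inv in blast)+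

lemma restr_image: "K \<subseteq> topspace X \<Longrightarrow> restr X p ` K = p ` K"
  by (auto simp: image_iff subset_iff)

lemma topspace_Homeo_topology: "topspace (Homeo_topology X) = carrier (Homeo X)"
proof -
  have "carrier (Homeo X) \<in> {{f \<in> carrier (Homeo X). f ` K \<subseteq> U} | K U. compactin X K \<and> openin X U}"
    by (rule CollectI, rule exI[of _ "{}"], rule exI[of _ "{}"]) simp
  hence "carrier (Homeo X) \<subseteq> \<Union> {{f \<in> carrier (Homeo X). f ` K \<subseteq> U} | K U. compactin X K \<and> openin X U}"
    by (rule Union_upper)
  thus ?thesis unfolding Homeo_topology_def topology_generated_by_topspace by (intro equalityI) blast+
qed

lemma openin_Homeo_topology:
  assumes "compactin X K" "openin X U"
  shows "openin (Homeo_topology X) {f \<in> carrier (Homeo X). f ` K \<subseteq> U}"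
  unfolding Homeo_topology_def by (rule topology_generated_by_Basis) (use assms in blast)

lemma continuous_map_into_Homeo_topology:
  assumes "f \<in> topspace T \<rightarrow> carrier (Homeo X)"
    and "\<And>K U. \<lbrakk>compactin X K; openin X U\<rbrakk> \<Longrightarrow> openin T {x \<in> topspace T. f x ` K \<subseteq> U}"
  shows "continuous_map T (Homeo_topology X) f"
  unfolding Homeo_topology_def
proof (rule continuous_on_generated_topo)
  fix N assume "N \<in> {{f \<in> carrier (Homeo X). f ` K \<subseteq> U} | K U. compactin X K \<and> openin X U}"
  then obtain K U where KU: "compactin X K" "openin X U" "N = {f \<in> carrier (Homeo X). f ` K \<subseteq> U}" by blast
  have "f -` N \<inter> topspace T = {x \<in> topspace T. f x ` K \<subseteq> U}" using assms(1) KU(3) by auto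
  thus "openin T (f -` N \<inter> topspace T)" using assms(2) KU by simp
next
  show "f ` topspace T \<subseteq> \<Union> {{f \<in> carrier (Homeo X). f ` K \<subseteq> U} | K U. compactin X K \<and> openin X U}"
    using assms(1) topspace_Homeo_topology[of X] unfolding Homeo_topology_def topology_generated_by_topspace by auto
qed

lemma compact_Hausdorff_sandwich:
  assumes "compact_space X" "Hausdorff_space X" "closedin X C" "openin X P" "C \<subseteq> P"
  obtains V D where "openin X V" "closedin X D" "C \<subseteq> V" "V \<subseteq> D" "D \<subseteq> P"
proof -
  have "normal_space X" using assms(1,2) compact_Hausdorff_or_regular_imp_normal_space by blast
  moreover have "closedin X (topspace X - P)" using assms(4) by (simp add: closedin_diff)
  moreover have "disjnt C (topspace X - P)" using assms(5) by (auto simp: disjnt_def)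
  ultimately obtain V V' where V: "openin X V" "openin X V'" "C \<subseteq> V" "topspace X - P \<subseteq> V'" "disjnt V V'"
    using assms(3) unfolding normal_space_def by metis
  show ?thesis
  proof (rule that[of V "topspace X - V'"])
    show "closedin X (topspace X - V')" using V(2) by (simp add: closedin_diff)
    show "V \<subseteq> topspace X - V'" using V(5) openin_subset[OF V(1)] by (auto simp: disjnt_def)
    show "topspace X - V' \<subseteq> P" using V(4) by blast
  qed (use V in auto)
qed

text \<open>
  Composition is continuous because the compact set \<open>g K\<close> can be separated from the complement of the
  preimage of \<open>U\<close> under \<open>f\<close> by a closed, hence compact, set.  Inversion is continuous because \<open>f\<^sup>-\<^sup>1\<close> maps \<open>K\<close>
  into \<open>U\<close> iff \<open>f\<close> maps the compact complement of \<open>U\<close> into the open complement of \<open>K\<close>.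
\<close>
theorem topological_group_Homeo:
  assumes c: "compact_space X" and h: "Hausdorff_space X"
  shows "topological_group (Homeo X) (Homeo_topology X)"
  unfolding topological_group_def
proof (intro conjI)
  let ?G = "Homeo X" and ?T = "Homeo_topology X"
  show "group ?G" by (rule group_Homeo)
  show "topspace ?T = carrier ?G" by (rule topspace_Homeo_topology)
  have Hcont: "continuous_map X X f" if "f \<in> carrier ?G" for f
    using that homeomorphic_imp_continuous_map by (auto simp: Homeo_carrier)
  show "continuous_map (prod_topology ?T ?T) ?T (\<lambda>(x, y). x \<otimes>\<^bsub>?G\<^esub> y)"
  proof (rule continuous_map_into_Homeo_topology)
    show "(\<lambda>(x, y). x \<otimes>\<^bsub>?G\<^esub> y) \<in> topspace (prod_topology ?T ?T) \<rightarrow> carrier ?G"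
      using group.is_monoid[OF group_Homeo] monoid.m_closed by (fastforce simp: topspace_Homeo_topology)
    fix K U assume K: "compactin X K" and U: "openin X U"
    have KS: "K \<subseteq> topspace X" using K compactin_subset_topspace by blast
    have im: "(f \<otimes>\<^bsub>?G\<^esub> g) ` K = f ` g ` K" if car: "f \<in> carrier ?G" "g \<in> carrier ?G" for f g
    proof -
      obtain p where p: "p \<in> homeos X" "f = restr X p" using Homeo_carrier_restr[OF car(1)] .
      obtain q where q: "q \<in> homeos X" "g = restr X q" using Homeo_carrier_restr[OF car(2)] .
      note pq = p(1) q(1) p(2) q(2)
      have qK: "q ` K \<subseteq> topspace X" using homeos_image_topspace[OF pq(2)] KS by blast
      show ?thesis
        unfolding pq(3,4) Homeo_mult[OF pq(1,2)] restr_image[OF KS] restr_image[OF qK] image_comp[symmetric] ..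
    qed
    show "openin (prod_topology ?T ?T) {x \<in> topspace (prod_topology ?T ?T). (case x of (x, y) \<Rightarrow> x \<otimes>\<^bsub>?G\<^esub> y) ` K \<subseteq> U}"
      unfolding openin_prod_topology_alt
    proof (intro allI impI)
      fix f g assume fg: "(f, g) \<in> {x \<in> topspace (prod_topology ?T ?T). (case x of (x, y) \<Rightarrow> x \<otimes>\<^bsub>?G\<^esub> y) ` K \<subseteq> U}"
      hence f: "f \<in> carrier ?G" and g: "g \<in> carrier ?G" and sub: "f ` g ` K \<subseteq> U"
        using im by (auto simp: topspace_Homeo_topology)
      have gK: "compactin X (g ` K)" using image_compactin[OF K Hcont[OF g]] .
      let ?P = "{z \<in> topspace X. f z \<in> U}"
      have P: "openin X ?P" using openin_continuous_map_preimage[OF Hcont[OF f] U] .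
      have gP: "g ` K \<subseteq> ?P" using sub compactin_subset_topspace[OF gK] by blast
      obtain V D where V: "openin X V" "closedin X D" "g ` K \<subseteq> V" "V \<subseteq> D" "D \<subseteq> ?P"
        by (rule compact_Hausdorff_sandwich[OF c h compactin_imp_closedin[OF h gK] P gP])
      have cl: "compactin X D" using c V(2) closedin_compact_space by blast
      let ?A = "{f \<in> carrier ?G. f ` D \<subseteq> U}" and ?B = "{g \<in> carrier ?G. g ` K \<subseteq> V}"
      have op: "openin ?T ?A" "openin ?T ?B"
        using openin_Homeo_topology[OF cl U] openin_Homeo_topology[OF K V(1)] .
      moreover have "f \<in> ?A" "g \<in> ?B" using f g V by auto
      moreover have "?A \<times> ?B \<subseteq> {x \<in> topspace (prod_topology ?T ?T). (case x of (x, y) \<Rightarrow> x \<otimes>\<^bsub>?G\<^esub> y) ` K \<subseteq> U}"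
      proof
        fix x assume "x \<in> ?A \<times> ?B"
        then obtain a b where x: "x = (a, b)" "a \<in> ?A" "b \<in> ?B" by blast
        have "a ` b ` K \<subseteq> U" using x V(4) by blast
        thus "x \<in> {x \<in> topspace (prod_topology ?T ?T). (case x of (x, y) \<Rightarrow> x \<otimes>\<^bsub>?G\<^esub> y) ` K \<subseteq> U}"
          using x im[of a b] by (simp add: topspace_Homeo_topology)
      qed
      ultimately show "\<exists>A B. openin ?T A \<and> openin ?T B \<and> f \<in> A \<and> g \<in> B \<and>
        A \<times> B \<subseteq> {x \<in> topspace (prod_topology ?T ?T). (case x of (x, y) \<Rightarrow> x \<otimes>\<^bsub>?G\<^esub> y) ` K \<subseteq> U}"
        using op by (intro exI[of _ ?A] exI[of _ ?B] conjI)
    qed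
  qed
  show "continuous_map ?T ?T (\<lambda>x. inv\<^bsub>?G\<^esub> x)"
  proof (rule continuous_map_into_Homeo_topology)
    show "(\<lambda>x. inv\<^bsub>?G\<^esub> x) \<in> topspace ?T \<rightarrow> carrier ?G"
      using group.inv_closed[OF group_Homeo] by (auto simp: topspace_Homeo_topology)
    fix K U assume K: "compactin X K" and U: "openin X U"
    have KS: "K \<subseteq> topspace X" using K compactin_subset_topspace by blast
    have "compactin X (topspace X - U)" using c U by (simp add: closedin_compact_space closedin_diff)
    moreover have "openin X (topspace X - K)" using compactin_imp_closedin[OF h K] by blast
    ultimately have "openin ?T {f \<in> carrier ?G. f ` (topspace X - U) \<subseteq> topspace X - K}"
      by (rule openin_Homeo_topology)
    moreover have "{f \<in> carrier ?G. f ` (topspace X - U) \<subseteq> topspace X - K} = {x \<in> topspace ?T. (inv\<^bsub>?G\<^esub> x) ` K \<subseteq> U}"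
    proof -
      have "f ` (topspace X - U) \<subseteq> topspace X - K \<longleftrightarrow> (inv\<^bsub>?G\<^esub> f) ` K \<subseteq> U" if car: "f \<in> carrier ?G" for f
      proof -
        obtain p where p: "p \<in> homeos X" "f = restr X p" using Homeo_carrier_restr[OF car] .
        have b: "bij p" using homeos_bij p by blast
        have q: "(inv\<^bsub>?G\<^esub> f) ` K = finv p ` K" unfolding p(2) Homeo_inv[OF p(1)] by (rule restr_image[OF KS])
        have r: "f ` (topspace X - U) = p ` (topspace X - U)" unfolding p(2) by (rule restr_image) blast
        have S: "p z \<in> topspace X \<longleftrightarrow> z \<in> topspace X" for z
          using homeos_image_topspace[OF p(1)] b by (metis bij_is_inj image_eqI inj_image_mem_iff)
        have "p ` (topspace X - U) \<subseteq> topspace X - K \<longleftrightarrow> (\<forall>z. p z \<in> K \<longrightarrow> z \<in> U)"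
          using S KS by blast
        also have "\<dots> \<longleftrightarrow> finv p ` K \<subseteq> U" using b by (metis bij_inv_eq_iff image_subset_iff)
        finally show ?thesis unfolding q r .
      qed
      thus ?thesis unfolding topspace_Homeo_topology by (intro Collect_cong conj_cong refl)
    qed
    ultimately show "openin ?T {x \<in> topspace ?T. (inv\<^bsub>?G\<^esub> x) ` K \<subseteq> U}" by simp
  qed
qed

section \<open>Punctured clopen neighbourhoods of a point\<close>

locale clopen_base =
  fixes X :: "'a topology" and y :: 'a and V :: "nat \<Rightarrow> 'a set"
  assumes compact: "compact_space X" and hausdorff: "Hausdorff_space X"
    and openin_V: "openin X (V n)" and closedin_V: "closedin X (V n)"
    and point_in_V: "y \<in> V n" and V_Suc: "V (Suc n) \<subseteq> V n"
    and V_base: "\<lbrakk>openin X U; y \<in> U\<rbrakk> \<Longrightarrow> \<exists>n. V n \<subseteq> U"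
begin

definition E :: "'a set" where "E = V 0 - {y}"

text \<open>
  Clopen subsets of the punctured neighbourhood \<open>E\<close>: the point \<open>y\<close> is the only point of the space
  that may be a limit of \<open>M\<close> without belonging to it.
\<close>
definition pclopen :: "'a set \<Rightarrow> bool" where
  "pclopen M \<longleftrightarrow> M \<subseteq> E \<and> openin X M \<and> closedin X (insert y M)"

text \<open>
  Homeomorphisms from \<open>insert y M\<close> to \<open>insert y N\<close> that send \<open>y\<close> to itself, described without
  mentioning the value at \<open>y\<close>: the last condition is continuity at \<open>y\<close>.  Continuity of the inverse is automatic
  by compactness, see \<open>phomeo_inv\<close>.
\<close>
definition phomeo :: "('a \<Rightarrow> 'a) \<Rightarrow> 'a set \<Rightarrow> 'a set \<Rightarrow> bool" where
  "phomeo h M N \<longleftrightarrow> bij_betw h M N \<and> (\<forall>U. openin X U \<longrightarrow> openin X {z \<in> M. h z \<in> U}) \<and>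
     (\<forall>n. \<exists>m. h ` (M \<inter> V m) \<subseteq> V n)"

lemma V_antimono: "m \<le> n \<Longrightarrow> V n \<subseteq> V m"
  using V_Suc by (simp add: lift_Suc_antimono_le)

lemma V_topspace: "V n \<subseteq> topspace X"
  by (simp add: openin_V openin_subset)

lemma point_topspace: "y \<in> topspace X"
  using point_in_V V_topspace by blast

lemma closedin_point: "closedin X {y}"
  using hausdorff point_topspace by (simp add: closedin_Hausdorff_singleton)

lemma openin_E: "openin X E"
  unfolding E_def using openin_V closedin_point by blast

lemma leaves_V:
  assumes "z \<in> topspace X" "z \<noteq> y" shows "\<exists>n. z \<notin> V n"
proof -
  have "openin X (topspace X - {z})" "y \<in> topspace X - {z}"
    using hausdorff assms point_topspace by (auto simp: closedin_Hausdorff_singleton openin_diff)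
  from V_base[OF this] show ?thesis by blast
qed

lemma pclopen_subset: "pclopen M \<Longrightarrow> M \<subseteq> E" by (simp add: pclopen_def)
lemma pclopen_open: "pclopen M \<Longrightarrow> openin X M" by (simp add: pclopen_def)
lemma pclopen_not_point: "pclopen M \<Longrightarrow> y \<notin> M" by (auto simp: pclopen_def E_def)

lemma pclopen_iff: "pclopen M \<longleftrightarrow> M \<subseteq> E \<and> openin X M \<and> openin X (E - M)"
proof (cases "M \<subseteq> E \<and> openin X M")
  case True
  have 1: "E - M = V 0 \<inter> (topspace X - insert y M)"
    using V_topspace by (auto simp: E_def)
  have 2: "topspace X - insert y M = (topspace X - V 0) \<union> (E - M)"
    using True V_topspace point_in_V by (auto simp: E_def)
  have 3: "insert y M \<subseteq> topspace X" using True point_topspace openin_subset by blast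
  have "openin X (E - M)" if "closedin X (insert y M)"
    unfolding 1 using that openin_V by (meson closedin_def openin_Int)
  moreover have "closedin X (insert y M)" if "openin X (E - M)"
    unfolding closedin_def 2 using that closedin_V 3 by (auto intro: openin_Un)
  ultimately show ?thesis using True by (auto simp: pclopen_def)
qed (auto simp: pclopen_def)

lemma pclopen_E: "pclopen E" by (simp add: pclopen_iff openin_E)

lemma pclopen_empty: "pclopen {}" by (simp add: pclopen_iff openin_E)

lemma pclopen_Diff: assumes "pclopen M" "pclopen N" shows "pclopen (M - N)"
proof -
  have "M - N = M \<inter> (E - N)" "E - (M - N) = (E - M) \<union> N" using assms by (auto simp: pclopen_iff)
  thus ?thesis using assms by (auto simp: pclopen_iff openin_Int openin_Un simp del: Diff_Diff_Int)
qed

lemma pclopen_Int: assumes "pclopen M" "pclopen N" shows "pclopen (M \<inter> N)"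
proof -
  have "E - (M \<inter> N) = (E - M) \<union> (E - N)" by auto
  thus ?thesis using assms by (auto simp: pclopen_iff openin_Int openin_Un)
qed

lemma pclopen_Un: assumes "pclopen M" "pclopen N" shows "pclopen (M \<union> N)"
proof -
  have "E - (M \<union> N) = (E - M) \<inter> (E - N)" by auto
  thus ?thesis using assms by (auto simp: pclopen_iff openin_Int openin_Un)
qed

lemma pclopen_V: "pclopen (V n - {y})"
proof -
  have "V n - {y} \<subseteq> E" using V_antimono[of 0 n] by (auto simp: E_def)
  moreover have "insert y (V n - {y}) = V n" using point_in_V by blast
  ultimately show ?thesis unfolding pclopen_def using openin_V closedin_V closedin_point by auto
qed

lemma pclopen_V0_V: "pclopen (V 0 - V n)"
proof -
  have "V 0 - V n = E - (V n - {y})" using point_in_V by (auto simp: E_def)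
  thus ?thesis using pclopen_E pclopen_V pclopen_Diff by metis
qed

definition locally_finite :: "'i set \<Rightarrow> ('i \<Rightarrow> 'a set) \<Rightarrow> bool" where
  "locally_finite I M \<longleftrightarrow> (\<forall>n. finite {i \<in> I. \<not> M i \<subseteq> V n})"

lemma locally_finite_nat:
  assumes "\<And>i::nat. M i \<subseteq> V i" shows "locally_finite I M"
  unfolding locally_finite_def
proof
  fix n
  have "{i \<in> I. \<not> M i \<subseteq> V n} \<subseteq> {..<n}"
  proof
    fix i assume i: "i \<in> {i \<in> I. \<not> M i \<subseteq> V n}"
    have "i < n" 
    proof (rule ccontr)
      assume "\<not> i < n"
      hence "V i \<subseteq> V n" using V_antimono by simp
      thus False using i assms by blast
    qed
    thus "i \<in> {..<n}" by simp
  qed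
  thus "finite {i \<in> I. \<not> M i \<subseteq> V n}" using finite_subset by blast
qed

lemma locally_finite_finite: "finite I \<Longrightarrow> locally_finite I M"
  by (simp add: locally_finite_def)

text \<open>
  Outside of \<open>V n\<close> only finitely many members of the family are visible, so their union is closed
  there; the sets \<open>V n\<close> shrink to \<open>y\<close>.
\<close>
lemma pclopen_UN:
  assumes "\<And>i. i \<in> I \<Longrightarrow> pclopen (M i)" "locally_finite I M"
  shows "pclopen (\<Union>i\<in>I. M i)"
  unfolding pclopen_def
proof (intro conjI)
  show "(\<Union>i\<in>I. M i) \<subseteq> E" "openin X (\<Union>i\<in>I. M i)"
    using assms(1) by (auto simp: pclopen_def)
  let ?F = "\<lambda>n. {i \<in> I. \<not> M i \<subseteq> V n}"
  let ?C = "\<lambda>n. topspace X - V n - (\<Union>i\<in>?F n. insert y (M i))"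
  have op: "openin X (?C n)" for n
  proof -
    have "closedin X (\<Union>i\<in>?F n. insert y (M i))"
      using assms by (intro closedin_Union) (auto simp: pclopen_def locally_finite_def)
    thus ?thesis using openin_V closedin_V by blast
  qed
  have "topspace X - insert y (\<Union>i\<in>I. M i) = (\<Union>n. ?C n)"
  proof (intro equalityI subsetI)
    fix z assume z: "z \<in> topspace X - insert y (\<Union>i\<in>I. M i)"
    then obtain n where "z \<notin> V n" using leaves_V by blast
    thus "z \<in> (\<Union>n. ?C n)" using z by auto
  next
    fix z assume "z \<in> (\<Union>n. ?C n)"
    then obtain n where n: "z \<in> ?C n" by blast
    hence "z \<noteq> y" using point_in_V by blast
    moreover have "z \<notin> M i" if "i \<in> I" for i using n that by (cases "M i \<subseteq> V n") blast+
    ultimately show "z \<in> topspace X - insert y (\<Union>i\<in>I. M i)" using n by blast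
  qed
  hence "openin X (topspace X - insert y (\<Union>i\<in>I. M i))" using op by auto
  moreover have "insert y (\<Union>i\<in>I. M i) \<subseteq> topspace X"
    using assms(1) point_topspace by (auto simp: pclopen_def dest: openin_subset)
  ultimately show "closedin X (insert y (\<Union>i\<in>I. M i))" by (simp add: closedin_def)
qed

lemma phomeo_bij: "phomeo h M N \<Longrightarrow> bij_betw h M N" by (simp add: phomeo_def)
lemma phomeo_image: "phomeo h M N \<Longrightarrow> h ` M = N" by (simp add: phomeo_def bij_betw_def)

lemma phomeo_id: assumes "openin X M" shows "phomeo id M M"
proof -
  have "{z \<in> M. id z \<in> U} = M \<inter> U" for U by auto
  thus ?thesis using assms by (auto simp: phomeo_def openin_Int)
qed

lemma phomeo_comp:
  assumes "phomeo h L M" "phomeo k M N" shows "phomeo (k \<circ> h) L N"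
  unfolding phomeo_def
proof (intro conjI allI impI)
  show "bij_betw (k \<circ> h) L N" using assms phomeo_bij bij_betw_trans by blast
  fix U assume "openin X U"
  hence "openin X {z \<in> M. k z \<in> U}" using assms by (simp add: phomeo_def)
  hence "openin X {z \<in> L. h z \<in> {z \<in> M. k z \<in> U}}" using assms(1) unfolding phomeo_def by blast
  moreover have "{z \<in> L. h z \<in> {z \<in> M. k z \<in> U}} = {z \<in> L. (k \<circ> h) z \<in> U}"
    using phomeo_image[OF assms(1)] by auto
  ultimately show "openin X {z \<in> L. (k \<circ> h) z \<in> U}" by simp
next
  fix n
  obtain m where m: "k ` (M \<inter> V m) \<subseteq> V n" using assms(2) unfolding phomeo_def by blast
  obtain l where l: "h ` (L \<inter> V l) \<subseteq> V m" using assms(1) unfolding phomeo_def by blast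
  show "\<exists>l. (k \<circ> h) ` (L \<inter> V l) \<subseteq> V n"
    using m l phomeo_image[OF assms(1)] by (intro exI[of _ l]) fastforce
qed

text \<open>
  The extension of \<open>h\<close> by \<open>y \<mapsto> y\<close> is continuous on the compact set \<open>insert y M\<close>, so it is a closed
  map.  The second set of the union is the image of \<open>y\<close>.
\<close>
lemma phomeo_closed_image:
  assumes M: "pclopen M" and N: "pclopen N" and h: "phomeo h M N" and C: "closedin X C"
  shows "closedin X (h ` (M \<inter> C) \<union> (C \<inter> {y}))"
proof -
  define k where "k = h(y := y)"
  have yM: "y \<notin> M" using M pclopen_not_point by blast
  have Ms: "insert y M \<subseteq> topspace X" using M closedin_subset unfolding pclopen_def by blast
  have ts: "topspace (subtopology X (insert y M)) = insert y M" using Ms by auto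
  have "continuous_map (subtopology X (insert y M)) X k"
    unfolding continuous_map_def ts
  proof (intro conjI allI impI)
    have "N \<subseteq> topspace X" using N openin_subset pclopen_open by blast
    thus "k \<in> insert y M \<rightarrow> topspace X"
      using point_topspace phomeo_image[OF h] by (auto simp: k_def)
    fix U assume U: "openin X U"
    let ?P = "{z \<in> M. h z \<in> U}"
    have P: "openin X ?P" using h U by (auto simp: phomeo_def)
    show "openin (subtopology X (insert y M)) {z \<in> insert y M. k z \<in> U}"
    proof (cases "y \<in> U")
      case True
      then obtain n where n: "V n \<subseteq> U" using V_base U by blast
      obtain m where m: "h ` (M \<inter> V m) \<subseteq> V n" using h unfolding phomeo_def by blast
      have "{z \<in> insert y M. k z \<in> U} = (?P \<union> V m) \<inter> insert y M"
        using True n m yM point_in_V by (auto simp: k_def)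
      thus ?thesis using P openin_V[of m] by (metis openin_subtopology openin_Un)
    next
      case False
      hence "{z \<in> insert y M. k z \<in> U} = ?P \<inter> insert y M" using yM by (auto simp: k_def)
      thus ?thesis using P by (metis openin_subtopology)
    qed
  qed
  moreover have "compactin (subtopology X (insert y M)) (C \<inter> insert y M)"
    using M C compact Ms unfolding compactin_subtopology
    by (auto simp: pclopen_def intro!: closedin_compact_space closedin_Int)
  ultimately have "compactin X (k ` (C \<inter> insert y M))" using image_compactin by blast
  hence "closedin X (k ` (C \<inter> insert y M))" using hausdorff compactin_imp_closedin by blast
  moreover have "k ` (C \<inter> insert y M) = h ` (M \<inter> C) \<union> (C \<inter> {y})"
    using yM by (auto simp: k_def image_iff)
  ultimately show ?thesis by simp
qed

lemma phomeo_inv: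
  assumes M: "pclopen M" and N: "pclopen N" and h: "phomeo h M N"
  shows "phomeo (inv_into M h) N M"
  unfolding phomeo_def
proof (intro conjI allI impI)
  have b: "bij_betw h M N" using h phomeo_bij by blast
  show "bij_betw (inv_into M h) N M" using b by (rule bij_betw_inv_into)
  have inv: "inv_into M h w \<in> M" "h (inv_into M h w) = w" if "w \<in> N" for w
    using that b by (auto simp: bij_betw_def inv_into_into f_inv_into_f)
  have inv2: "inv_into M h (h z) = z" if "z \<in> M" for z using that b by (simp add: bij_betw_def)
  have yN: "y \<notin> N" and yM: "y \<notin> M" using M N pclopen_not_point by auto
  {
    fix U assume U: "openin X U"
    let ?C = "topspace X - U"
    have "closedin X ?C" using U by (simp add: closedin_diff)
    from phomeo_closed_image[OF M N h this]
    have "closedin X (h ` (M \<inter> ?C) \<union> (?C \<inter> {y}))" .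
    hence "openin X (N - (h ` (M \<inter> ?C) \<union> (?C \<inter> {y})))" using pclopen_open[OF N] by (rule openin_diff[rotated])
    moreover have "N - (h ` (M \<inter> ?C) \<union> (?C \<inter> {y})) = {w \<in> N. inv_into M h w \<in> U}"
    proof (intro equalityI subsetI)
      fix w assume w: "w \<in> N - (h ` (M \<inter> ?C) \<union> (?C \<inter> {y}))"
      hence "inv_into M h w \<in> topspace X" using inv M openin_subset pclopen_open by blast
      thus "w \<in> {w \<in> N. inv_into M h w \<in> U}" using w inv by (metis (mono_tags, lifting) DiffE DiffI IntI UnCI image_eqI mem_Collect_eq)
    next
      fix w assume "w \<in> {w \<in> N. inv_into M h w \<in> U}"
      thus "w \<in> N - (h ` (M \<inter> ?C) \<union> (?C \<inter> {y}))" using inv2 yN by auto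
    qed
    ultimately show "openin X {w \<in> N. inv_into M h w \<in> U}" by simp
  }
  fix n
  let ?C = "topspace X - V n"
  have "closedin X ?C" using openin_V by (simp add: closedin_diff)
  from phomeo_closed_image[OF M N h this]
  have c: "closedin X (h ` (M \<inter> ?C))" using point_in_V by simp
  moreover have "y \<notin> h ` (M \<inter> ?C)" using phomeo_image[OF h] yN by blast
  ultimately obtain m where m: "V m \<subseteq> topspace X - h ` (M \<inter> ?C)"
    using V_base[of "topspace X - h ` (M \<inter> ?C)"] point_topspace by blast
  have "inv_into M h w \<in> V n" if w: "w \<in> N" "w \<in> V m" for w
  proof (rule ccontr)
    assume "inv_into M h w \<notin> V n"
    hence "inv_into M h w \<in> M \<inter> ?C" using inv[OF w(1)] M openin_subset pclopen_open by blast
    hence "w \<in> h ` (M \<inter> ?C)" using inv[OF w(1)] by (metis image_eqI)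
    thus False using m w by blast
  qed
  thus "\<exists>m. inv_into M h ` (N \<inter> V m) \<subseteq> V n" by blast
qed

lemma phomeo_restrict:
  assumes M: "pclopen M" and N: "pclopen N" and h: "phomeo h M N" and L: "pclopen L" "L \<subseteq> M"
  shows "pclopen (h ` L)" "phomeo h L (h ` L)"
proof -
  have b: "bij_betw h M N" using h phomeo_bij by blast
  have "phomeo (inv_into M h) N M" using phomeo_inv[OF M N h] .
  hence 1: "openin X {w \<in> N. inv_into M h w \<in> U}" if "openin X U" for U
    using that by (simp add: phomeo_def)
  have 2: "{w \<in> N. inv_into M h w \<in> L'} = h ` L'" if "L' \<subseteq> M" for L'
    using that b by (auto simp: bij_betw_def)
  have 3: "openin X (h ` L')" if "L' \<subseteq> M" "openin X L'" for L' using 1[OF that(2)] 2[OF that(1)] by simp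
  have "E - h ` L = (E - N) \<union> h ` (M - L)"
    using b L N by (auto simp: bij_betw_def pclopen_def inj_on_def)
  moreover have "openin X (h ` (M - L))"
    using 3 L M pclopen_Diff pclopen_open by blast
  ultimately have "openin X (E - h ` L)" using N by (auto simp: pclopen_iff)
  moreover have "openin X (h ` L)" using 3 L pclopen_open by blast
  moreover have "h ` L \<subseteq> E" using L b pclopen_subset[OF N] by (auto simp: bij_betw_def)
  ultimately show "pclopen (h ` L)" by (simp add: pclopen_iff)
  show "phomeo h L (h ` L)"
    unfolding phomeo_def
  proof (intro conjI allI impI)
    show "bij_betw h L (h ` L)" using b L by (meson bij_betw_subset)
    fix U assume "openin X U"
    hence "openin X {z \<in> M. h z \<in> U}" using h by (simp add: phomeo_def)
    hence "openin X ({z \<in> M. h z \<in> U} \<inter> L)" using L pclopen_open by blast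
    moreover have "{z \<in> M. h z \<in> U} \<inter> L = {z \<in> L. h z \<in> U}" using L by auto
    ultimately show "openin X {z \<in> L. h z \<in> U}" by simp
  next
    fix n
    obtain m where "h ` (M \<inter> V m) \<subseteq> V n" using h unfolding phomeo_def by blast
    thus "\<exists>m. h ` (L \<inter> V m) \<subseteq> V n" using L by blast
  qed
qed

text \<open>
  Near \<open>y\<close> all but finitely many of the maps take values in a given \<open>V n\<close>, because their images
  \<open>N i\<close> shrink to \<open>y\<close>; the others are continuous at \<open>y\<close> one by one.
\<close>
lemma phomeo_glue:
  assumes M: "\<And>i. i \<in> I \<Longrightarrow> pclopen (M i)"
    and h: "\<And>i. i \<in> I \<Longrightarrow> phomeo (h i) (M i) (N i)"
    and dM: "disjoint_family_on M I" and dN: "disjoint_family_on N I"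
    and lN: "locally_finite I N"
  obtains H where "phomeo H (\<Union>i\<in>I. M i) (\<Union>i\<in>I. N i)" "\<And>i z. i \<in> I \<Longrightarrow> z \<in> M i \<Longrightarrow> H z = h i z"
proof -
  define H where "H z = h (THE i. i \<in> I \<and> z \<in> M i) z" for z
  have H: "H z = h i z" if "i \<in> I" "z \<in> M i" for i z
  proof -
    have "(THE i. i \<in> I \<and> z \<in> M i) = i" using that dM by (auto simp: disjoint_family_on_def)
    thus ?thesis by (simp add: H_def)
  qed
  have im: "h i ` M i = N i" if "i \<in> I" for i using h that phomeo_image by blast
  have "phomeo H (\<Union>i\<in>I. M i) (\<Union>i\<in>I. N i)"
    unfolding phomeo_def
  proof (intro conjI allI impI)
    have "bij_betw H (M i) (N i)" if "i \<in> I" for i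
      using phomeo_bij[OF h[OF that]] bij_betw_cong[of "M i" H "h i"] H that by auto
    thus "bij_betw H (\<Union>i\<in>I. M i) (\<Union>i\<in>I. N i)"
      using dN by (rule bij_betw_UNION_disjoint[rotated])
    fix U assume U: "openin X U"
    have "{z \<in> (\<Union>i\<in>I. M i). H z \<in> U} = (\<Union>i\<in>I. {z \<in> M i. h i z \<in> U})"
      using H by auto
    thus "openin X {z \<in> (\<Union>i\<in>I. M i). H z \<in> U}" using h U by (auto simp: phomeo_def)
  next
    fix n
    let ?F = "{i \<in> I. \<not> N i \<subseteq> V n}"
    have fin: "finite ?F" using lN by (simp add: locally_finite_def)
    have "\<forall>i\<in>?F. \<exists>m. h i ` (M i \<inter> V m) \<subseteq> V n" using h by (simp add: phomeo_def)
    then obtain m where m: "\<And>i. i \<in> ?F \<Longrightarrow> h i ` (M i \<inter> V (m i)) \<subseteq> V n" by metis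
    define m' where "m' = Max (insert 0 (m ` ?F))"
    have m': "m i \<le> m'" if "i \<in> ?F" for i using fin that unfolding m'_def by (intro Max_ge) auto
    have "H z \<in> V n" if z: "z \<in> (\<Union>i\<in>I. M i)" "z \<in> V m'" for z
    proof -
      obtain i where i: "i \<in> I" "z \<in> M i" using z by blast
      show ?thesis
      proof (cases "N i \<subseteq> V n")
        case True thus ?thesis using i H im by blast
      next
        case False
        hence "i \<in> ?F" using i by blast
        hence "z \<in> V (m i)" using V_antimono[OF m'] z by blast
        thus ?thesis using m[OF \<open>i \<in> ?F\<close>] i H by auto
      qed
    qed
    thus "\<exists>m. H ` ((\<Union>i\<in>I. M i) \<inter> V m) \<subseteq> V n" by blast
  qed
  thus ?thesis using H that by blast
qed

lemma phomeo_glue2: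
  assumes "pclopen M" "pclopen M'" "phomeo h M N" "phomeo k M' N'" "M \<inter> M' = {}" "N \<inter> N' = {}"
  obtains H where "phomeo H (M \<union> M') (N \<union> N')" "\<And>z. z \<in> M \<Longrightarrow> H z = h z" "\<And>z. z \<in> M' \<Longrightarrow> H z = k z"
proof -
  let ?M = "\<lambda>b. if b then M else M'" and ?N = "\<lambda>b. if b then N else N'" and ?h = "\<lambda>b. if b then h else k"
  obtain H where H: "phomeo H (\<Union>b\<in>UNIV. ?M b) (\<Union>b\<in>UNIV. ?N b)"
    "\<And>b z. b \<in> UNIV \<Longrightarrow> z \<in> ?M b \<Longrightarrow> H z = ?h b z"
    by (rule phomeo_glue[of UNIV ?M ?h ?N])
       (use assms in \<open>auto simp: disjoint_family_on_def locally_finite_finite\<close>)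
  show ?thesis
    by (rule that[of H]) (use H(1) H(2)[of True] H(2)[of False] in \<open>auto simp: UNIV_bool Un_commute\<close>)
qed

lemma pclopen_locally_finite_UN_nat:
  assumes "\<And>s::nat. pclopen (K s)" "\<And>s. K s \<subseteq> V s"
  shows "pclopen (\<Union>s\<in>S. K s)"
  by (rule pclopen_UN[OF assms(1) locally_finite_nat[OF assms(2)]])

lemma phomeo_homeos_on:
  assumes p: "p \<in> homeos_on X E" and M: "pclopen M"
  shows "pclopen (p ` M)" "phomeo p M (p ` M)"
proof -
  have p': "p \<in> homeos X" and b: "bij p" using p by (auto simp: homeos_on_def intro: homeos_bij)
  have py: "p y = y" using p by (simp add: homeos_on_def E_def)
  have "p ` M \<subseteq> E" using homeos_on_image[OF p] M pclopen_subset by blast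
  moreover have "openin X (p ` M)" using homeos_openin_image[OF p'] M pclopen_open by blast
  moreover have "closedin X (insert y (p ` M))"
    using homeos_closedin_image[OF p', of "insert y M"] M py by (simp add: pclopen_def)
  ultimately show "pclopen (p ` M)" by (simp add: pclopen_def)
  have c: "continuous_map X X p" using p' by (simp add: homeos_def)
  show "phomeo p M (p ` M)"
    unfolding phomeo_def
  proof (intro conjI allI impI)
    show "bij_betw p M (p ` M)" using b bij_betw_subset by blast
    fix U assume "openin X U"
    hence "openin X ({z \<in> topspace X. p z \<in> U} \<inter> M)"
      using c openin_continuous_map_preimage M pclopen_open by blast
    moreover have "{z \<in> topspace X. p z \<in> U} \<inter> M = {z \<in> M. p z \<in> U}"
      using M openin_subset pclopen_open by blast
    ultimately show "openin X {z \<in> M. p z \<in> U}" by simp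
  next
    fix n
    have "openin X {z \<in> topspace X. p z \<in> V n}"
      using c openin_continuous_map_preimage openin_V by blast
    moreover have "y \<in> {z \<in> topspace X. p z \<in> V n}" using py point_in_V point_topspace by simp
    ultimately obtain m where "V m \<subseteq> {z \<in> topspace X. p z \<in> V n}" using V_base by blast
    thus "\<exists>m. p ` (M \<inter> V m) \<subseteq> V n" by blast
  qed
qed

lemma extension_continuous:
  assumes M: "pclopen M" and h: "phomeo h M M"
  shows "continuous_map X X (\<lambda>z. if z \<in> M then h z else z)"
  unfolding continuous_map_def
proof (intro conjI allI impI)
  let ?k = "\<lambda>z. if z \<in> M then h z else z"
  have Ms: "M \<subseteq> topspace X" using M openin_subset pclopen_open by blast
  show "?k \<in> topspace X \<rightarrow> topspace X" using phomeo_image[OF h] Ms by fastforce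
  fix U assume U: "openin X U"
  have 1: "openin X {z \<in> M. h z \<in> U}" using h U by (simp add: phomeo_def)
  have 2: "openin X (U - insert y M)" using U M by (simp add: pclopen_def openin_diff)
  have Us: "U \<subseteq> topspace X" using U openin_subset by blast
  show "openin X {z \<in> topspace X. ?k z \<in> U}"
  proof (cases "y \<in> U")
    case True
    then obtain n where n: "V n \<subseteq> U" using V_base U by blast
    obtain m where m: "h ` (M \<inter> V m) \<subseteq> V n" using h unfolding phomeo_def by blast
    \<comment> \<open>around \<open>y\<close>, points of \<open>M\<close> in \<open>V m\<close> are mapped into \<open>V n\<close>, and the others stay where they are\<close>
    have "{z \<in> topspace X. ?k z \<in> U} = {z \<in> M. h z \<in> U} \<union> (U - insert y M) \<union> V (max m n)" (is "?L = ?R")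
    proof (intro equalityI subsetI)
      fix z assume "z \<in> ?L" thus "z \<in> ?R" using point_in_V by (cases "z \<in> M") auto
    next
      fix z assume z: "z \<in> ?R"
      have "z \<in> ?L" if "z \<in> V (max m n)"
      proof -
        have "z \<in> V m" "z \<in> V n" using that V_antimono[of m "max m n"] V_antimono[of n "max m n"] by auto
        thus ?thesis using m n V_topspace[of n] by auto
      qed
      thus "z \<in> ?L" using z Ms Us by (auto split: if_splits)
    qed
    thus ?thesis using 1 2 openin_V by (simp add: openin_Un)
  next
    case False
    hence "{z \<in> topspace X. ?k z \<in> U} = {z \<in> M. h z \<in> U} \<union> (U - insert y M)"
      using Ms Us pclopen_not_point[OF M] by auto
    thus ?thesis using 1 2 by (simp add: openin_Un)
  qed
qed

lemma extension_homeos_on: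
  assumes M: "pclopen M" and h: "phomeo h M M"
  shows "(\<lambda>z. if z \<in> M then h z else z) \<in> homeos_on X M" (is "?k \<in> _")
proof -
  let ?l = "\<lambda>z. if z \<in> M then inv_into M h z else z"
  have b: "bij_betw h M M" using h phomeo_bij by blast
  have 1: "?l \<circ> ?k = id" "?k \<circ> ?l = id"
    using b by (auto simp: fun_eq_iff bij_betw_def inv_into_into f_inv_into_f)
  hence bk: "bij ?k" using o_bij by blast
  have "finv ?k = ?l" using 1 by (intro inv_unique_comp)
  moreover have "continuous_map X X ?l" using extension_continuous[OF M phomeo_inv[OF M M h]] .
  moreover have "M \<subseteq> topspace X" using M openin_subset pclopen_open by blast
  ultimately show ?thesis using bk extension_continuous[OF M h]
    unfolding homeos_on_def homeos_def by auto
qed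

section \<open>Rich sets\<close>
text \<open>
  Every compact piece of the punctured neighbourhood has clopen copies in \<open>D\<close> arbitrarily close to
  \<open>y\<close>.  If \<open>y\<close> is isolated and \<open>V 0 = {y}\<close>, the empty set is rich.
\<close>
definition rich :: "'a set \<Rightarrow> bool" where
  "rich D \<longleftrightarrow> pclopen D \<and>
     (\<forall>n m. \<exists>K h. pclopen K \<and> K \<subseteq> D \<inter> V m \<and> phomeo h (V 0 - V n) K)"

lemma rich_pclopen: "rich D \<Longrightarrow> pclopen D" by (simp add: rich_def)

lemma rich_mono: "rich D \<Longrightarrow> D \<subseteq> D' \<Longrightarrow> pclopen D' \<Longrightarrow> rich D'"
  unfolding rich_def by (meson Int_mono order_refl order_trans)

lemma image_avoids_V:
  assumes "pclopen K" "phomeo h (V 0 - V n) K" shows "\<exists>m. K \<inter> V m = {}"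
proof -
  have h': "phomeo (inv_into (V 0 - V n) h) K (V 0 - V n)"
    using phomeo_inv[OF pclopen_V0_V assms] .
  then obtain m where "inv_into (V 0 - V n) h ` (K \<inter> V m) \<subseteq> V n" unfolding phomeo_def by blast
  moreover have "inv_into (V 0 - V n) h ` (K \<inter> V m) \<subseteq> V 0 - V n" using phomeo_image[OF h'] by blast
  ultimately show ?thesis by blast
qed

text \<open>
  The copies are chosen one after the other.  Each of them is compact and therefore avoids some
  \<open>V b\<close>, in which the next one is taken.
\<close>
lemma rich_pieces:
  assumes D: "rich D"
  obtains K where "\<And>s. pclopen (K s)" "\<And>s. K s \<subseteq> D" "\<And>s. K s \<subseteq> V s" "disjoint_family K"
    "\<And>s. \<exists>h. phomeo h (V 0 - V s) (K s)" "\<And>s. \<exists>m. K s \<inter> V m = {}"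
proof -
  have "\<forall>n m. \<exists>K. pclopen K \<and> K \<subseteq> D \<inter> V m \<and> (\<exists>h. phomeo h (V 0 - V n) K)"
    using D unfolding rich_def by blast
  then obtain K where K: "\<And>n m. pclopen (K n m)" "\<And>n m. K n m \<subseteq> D \<inter> V m"
    "\<And>n m. \<exists>h. phomeo h (V 0 - V n) (K n m)" by metis
  have "\<exists>b>m. K n m \<inter> V b = {}" for n m
  proof -
    obtain h where "phomeo h (V 0 - V n) (K n m)" using K(3) by blast
    from image_avoids_V[OF K(1) this] obtain b where "K n m \<inter> V b = {}" by blast
    hence "K n m \<inter> V (max b (Suc m)) = {}" using V_antimono[of b "max b (Suc m)"] by auto
    thus ?thesis by (intro exI[of _ "max b (Suc m)"]) auto
  qed
  hence "\<forall>n m. \<exists>b>m. K n m \<inter> V b = {}" by blast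
  then obtain b where "\<forall>n m. b n m > m \<and> K n m \<inter> V (b n m) = {}" by metis
  hence b: "\<And>n m. b n m > m" "\<And>n m. K n m \<inter> V (b n m) = {}" by auto
  \<comment> \<open>the \<open>s\<close>-th copy lies between the levels \<open>\<mu> s\<close> and \<open>\<mu> (Suc s)\<close>\<close>
  define \<mu> where "\<mu> = rec_nat 0 b"
  have \<mu>_Suc: "\<mu> (Suc s) = b s (\<mu> s)" for s by (simp add: \<mu>_def)
  have sm: "strict_mono \<mu>" by (rule strict_monoI_Suc) (simp add: \<mu>_Suc b)
  define L where "L s = K s (\<mu> s)" for s
  have LV: "L s \<subseteq> V (\<mu> s)" "L s \<inter> V (\<mu> (Suc s)) = {}" for s
    using K b by (auto simp: L_def \<mu>_Suc)
  have disj: "L s \<inter> L t = {}" if "s < t" for s t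
    using LV[of s] LV[of t] V_antimono[of "\<mu> (Suc s)" "\<mu> t"] sm that
    by (auto simp: strict_mono_less_eq)
  show ?thesis
  proof (rule that[of L])
    show "L s \<subseteq> V s" for s
      using LV(1)[of s] V_antimono[OF strict_mono_imp_increasing[OF sm, of s]] by blast
    show "disjoint_family L"
      unfolding disjoint_family_on_def using disj by (metis Int_commute linorder_neqE_nat)
    show "\<exists>m. L s \<inter> V m = {}" for s using LV by blast
  qed (use K in \<open>auto simp: L_def\<close>)
qed

text \<open>
  The \<open>s\<close>-th piece contains a copy of \<open>V 0 - V n\<close> for every \<open>n \<le> s\<close>, so infinitely many pieces suffice.
\<close>
lemma rich_UN_pieces:
  assumes "\<And>s. pclopen (K s)" "\<And>s. K s \<subseteq> V s" "\<And>s. \<exists>h. phomeo h (V 0 - V s) (K s)" "infinite S"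
  shows "rich (\<Union>s\<in>S. K s)"
  unfolding rich_def
proof (intro conjI allI)
  show "pclopen (\<Union>s\<in>S. K s)" using assms pclopen_locally_finite_UN_nat by blast
  fix n m
  obtain s where s: "s \<in> S" "max n m < s" using assms(4) infinite_nat_iff_unbounded by blast
  obtain h where h: "phomeo h (V 0 - V s) (K s)" using assms by blast
  have sub: "V 0 - V n \<subseteq> V 0 - V s" using V_antimono[of n s] s by auto
  note r = phomeo_restrict[OF pclopen_V0_V assms(1) h pclopen_V0_V sub]
  have "h ` (V 0 - V n) \<subseteq> K s" using phomeo_image[OF h] sub by blast
  moreover have "K s \<subseteq> V m" using assms(2)[of s] V_antimono[of m s] s by auto
  ultimately show "\<exists>K' h. pclopen K' \<and> K' \<subseteq> (\<Union>s\<in>S. K s) \<inter> V m \<and> phomeo h (V 0 - V n) K'"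
    using r s(1) by (intro exI[of _ "h ` (V 0 - V n)"] exI[of _ h]) auto
qed

text \<open>
  An embedding into \<open>D\<close> that moves every point at least one level closer to \<open>y\<close>: the annulus
  between \<open>V i\<close> and \<open>V (Suc i)\<close> is sent into the copy of \<open>V 0 - V (Suc i)\<close> inside \<open>V (Suc i)\<close>.
\<close>
lemma rich_shift:
  assumes D: "rich D"
  obtains e R where "phomeo e E R" "pclopen R" "R \<subseteq> D" "\<And>i. e ` (E \<inter> V i) \<subseteq> V (Suc i)"
proof -
  obtain K where K: "\<And>s. pclopen (K s)" "\<And>s. K s \<subseteq> D" "\<And>s. K s \<subseteq> V s" "disjoint_family K"
    "\<And>s. \<exists>h. phomeo h (V 0 - V s) (K s)" using rich_pieces[OF D] by metis
  then obtain h where h: "\<And>s. phomeo (h s) (V 0 - V s) (K s)" by metis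
  define Y where "Y i = V i - V (Suc i)" for i
  have Y: "pclopen (Y i)" for i
  proof -
    have "Y i = (V i - {y}) - (V (Suc i) - {y})" using point_in_V by (auto simp: Y_def)
    thus ?thesis using pclopen_Diff pclopen_V by metis
  qed
  have Ysub: "Y i \<subseteq> V 0 - V (Suc i)" for i using V_antimono[of 0 i] by (auto simp: Y_def)
  define N where "N i = h (Suc i) ` Y i" for i
  have N: "pclopen (N i)" "phomeo (h (Suc i)) (Y i) (N i)" for i
    using phomeo_restrict[OF pclopen_V0_V K(1) h Y Ysub] by (auto simp: N_def)
  have NK: "N i \<subseteq> K (Suc i)" for i using phomeo_image[OF h] Ysub unfolding N_def by blast
  have NV: "N i \<subseteq> V (Suc i)" for i using NK K(3)[of "Suc i"] by blast
  have dN: "disjoint_family N" using K(4) NK unfolding disjoint_family_on_def by (metis (no_types, lifting) Int_mono UNIV_I nat.inject subset_empty)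
  have dY: "disjoint_family Y"
  proof -
    have "Y i \<inter> Y j = {}" if "i < j" for i j using V_antimono[of "Suc i" j] that by (auto simp: Y_def)
    thus ?thesis unfolding disjoint_family_on_def by (metis Int_commute linorder_neqE_nat)
  qed
  have lN: "locally_finite UNIV N" by (rule locally_finite_nat) (use NV V_Suc in blast)
  obtain e where e: "phomeo e (\<Union>i. Y i) (\<Union>i. N i)" "\<And>i z. z \<in> Y i \<Longrightarrow> e z = h (Suc i) z"
    using phomeo_glue[of UNIV Y "\<lambda>i. h (Suc i)" N] Y N dY dN lN by auto
  have level: "\<exists>j\<ge>i. z \<in> Y j" if z: "z \<in> E" "z \<in> V i" for z i
  proof -
    have "\<exists>n. z \<notin> V n" using leaves_V z V_topspace by (auto simp: E_def)
    then obtain n where n: "z \<notin> V n" and least: "\<forall>k<n. z \<in> V k"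
      using exists_least_iff[of "\<lambda>n. z \<notin> V n"] by auto
    have "z \<in> V 0" using z by (auto simp: E_def)
    then obtain j where j: "n = Suc j" using n by (metis not0_implies_Suc)
    have "z \<in> V j" using least j by simp
    moreover have "i \<le> j" using n z(2) j V_antimono[of n i] by (metis not_less_eq_eq subsetD)
    ultimately show ?thesis using n j by (auto simp: Y_def)
  qed
  have UY: "(\<Union>i. Y i) = E"
    using level[of _ 0] Y pclopen_subset by (fastforce simp: E_def)
  show ?thesis
  proof (rule that[of e "\<Union>i. N i"])
    show "phomeo e E (\<Union>i. N i)" using e(1) UY by simp
    show "pclopen (\<Union>i. N i)" using pclopen_UN[OF _ lN] N by blast
    show "(\<Union>i. N i) \<subseteq> D" using NK K(2) by blast
    show "e ` (E \<inter> V i) \<subseteq> V (Suc i)" for i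
    proof
      fix w assume "w \<in> e ` (E \<inter> V i)"
      then obtain z where z: "z \<in> E" "z \<in> V i" "w = e z" by blast
      then obtain j where j: "j \<ge> i" "z \<in> Y j" using level by blast
      hence "w \<in> N j" using e(2) z by (simp add: N_def)
      thus "w \<in> V (Suc i)" using NV[of j] V_antimono[of "Suc i" "Suc j"] j by auto
    qed
  qed
qed

text \<open>
  This is the Cantor-Bernstein argument.  The bijection is \<open>e\<close> on the union \<open>S\<close> of the forward images of
  \<open>E - D\<close>, and the identity elsewhere.  In general it would not be continuous, since these images may
  accumulate anywhere; here the \<open>n\<close>-th image lies in \<open>V n\<close>, so they accumulate at \<open>y\<close> only.
\<close>
lemma rich_phomeo_E:
  assumes D: "rich D"
  obtains h where "phomeo h E D"
proof -
  obtain e R where e: "phomeo e E R" and R: "pclopen R" "R \<subseteq> D" and shift: "\<And>i. e ` (E \<inter> V i) \<subseteq> V (Suc i)"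
    using rich_shift[OF D] by metis
  have DE: "D \<subseteq> E" "pclopen D" using D rich_pclopen pclopen_subset by auto
  define Q where "Q n = (e ^^ n) ` (E - D)" for n
  have Q_Suc: "Q (Suc n) = e ` Q n" for n by (simp add: Q_def image_comp)
  have Q: "pclopen (Q n) \<and> Q n \<subseteq> V n \<inter> E" for n
  proof (induction n)
    case 0
    show ?case using pclopen_Diff[OF pclopen_E DE(2)] by (auto simp: Q_def E_def)
  next
    case (Suc n)
    hence "Q n \<subseteq> E" by blast
    hence "pclopen (Q (Suc n))" using phomeo_restrict(1)[OF pclopen_E R(1) e, of "Q n"] Suc by (simp add: Q_Suc)
    moreover have "Q (Suc n) \<subseteq> V (Suc n)" using Suc shift[of n] unfolding Q_Suc by blast
    ultimately show ?case using pclopen_subset by blast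
  qed
  define S where "S = (\<Union>n. Q n)"
  have S: "pclopen S" unfolding S_def by (rule pclopen_locally_finite_UN_nat) (use Q in auto)
  have SE: "S \<subseteq> E" using S pclopen_subset by blast
  have QD: "Q (Suc n) \<subseteq> D" for n
    using Q[of n] phomeo_image[OF e] R(2) unfolding Q_Suc by blast
  have Q0: "Q 0 = E - D" by (simp add: Q_def)
  have eS: "e ` S = S \<inter> D"
  proof
    show "e ` S \<subseteq> S \<inter> D" using QD Q_Suc unfolding S_def by fastforce
    show "S \<inter> D \<subseteq> e ` S"
    proof
      fix z assume z: "z \<in> S \<inter> D"
      then obtain n where n: "z \<in> Q n" by (auto simp: S_def)
      then obtain m where "n = Suc m" using z Q0 by (cases n) auto
      thus "z \<in> e ` S" using n Q_Suc S_def by auto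
    qed
  qed
  have rest: "pclopen (E - S)" using pclopen_Diff[OF pclopen_E S] .
  have "phomeo e S (S \<inter> D)" using phomeo_restrict(2)[OF pclopen_E R(1) e S SE] eS by simp
  moreover have "phomeo id (E - S) (E - S)" using phomeo_id rest pclopen_open by blast
  ultimately obtain H where "phomeo H (S \<union> (E - S)) (S \<inter> D \<union> (E - S))"
    by (rule phomeo_glue2[OF S rest]) auto
  moreover have "S \<union> (E - S) = E" using SE by blast
  moreover have "S \<inter> D \<union> (E - S) = D" using Q0 DE unfolding S_def by blast
  ultimately show ?thesis using that by metis
qed

lemma rich_phomeo:
  assumes "rich D" "rich D'" obtains h where "phomeo h D D'"
proof -
  obtain h where h: "phomeo h E D" using rich_phomeo_E assms by blast
  obtain k where k: "phomeo k E D'" using rich_phomeo_E assms by blast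
  show ?thesis
    using that phomeo_comp[OF phomeo_inv[OF pclopen_E rich_pclopen[OF assms(1)] h] k] by blast
qed

lemma rich_phomeo_image:
  assumes D: "rich D" and D': "pclopen D'" and h: "phomeo h D D'"
  shows "rich D'"
  unfolding rich_def
proof (intro conjI allI)
  show "pclopen D'" by fact
  fix n m
  obtain l where l: "h ` (D \<inter> V l) \<subseteq> V m" using h unfolding phomeo_def by blast
  obtain K k where K: "pclopen K" "K \<subseteq> D \<inter> V l" "phomeo k (V 0 - V n) K" using D unfolding rich_def by blast
  have KD: "K \<subseteq> D" using K by blast
  note r = phomeo_restrict[OF rich_pclopen[OF D] D' h K(1) KD]
  have "h ` K \<subseteq> D' \<inter> V m" using phomeo_image[OF h] K l by blast
  thus "\<exists>K h. pclopen K \<and> K \<subseteq> D' \<inter> V m \<and> phomeo h (V 0 - V n) K"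
    using r phomeo_comp[OF K(3) r(2)] by blast
qed

text \<open>
  As rich sets are all alike, a partial homeomorphism extends as soon as both complements are rich.
\<close>
lemma extend_phomeo:
  assumes M: "pclopen M" and D: "pclopen D" "D \<subseteq> M" and D': "pclopen D'" "D' \<subseteq> M"
    and h: "phomeo h D D'" and r: "rich (M - D)" "rich (M - D')"
  obtains p where "p \<in> homeos_on X M" "\<And>z. z \<in> D \<Longrightarrow> p z = h z" "p ` D = D'" "p ` (M - D) = M - D'"
proof -
  obtain k where k: "phomeo k (M - D) (M - D')" using rich_phomeo r by blast
  obtain H where H: "phomeo H (D \<union> (M - D)) (D' \<union> (M - D'))"
    "\<And>z. z \<in> D \<Longrightarrow> H z = h z" "\<And>z. z \<in> M - D \<Longrightarrow> H z = k z"
    by (rule phomeo_glue2[OF D(1) rich_pclopen[OF r(1)] h k]) auto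
  have "D \<union> (M - D) = M" "D' \<union> (M - D') = M" using D D' by auto
  hence "phomeo H M M" using H by simp
  note e = extension_homeos_on[OF M this]
  show ?thesis
  proof (rule that[OF e])
    show "(if z \<in> M then H z else z) = h z" if "z \<in> D" for z using that D H by auto
    have "(\<lambda>z. if z \<in> M then H z else z) ` D = h ` D"
      using D H(2) by (intro image_cong) auto
    thus "(\<lambda>z. if z \<in> M then H z else z) ` D = D'" using phomeo_image[OF h] by simp
    have "(\<lambda>z. if z \<in> M then H z else z) ` (M - D) = k ` (M - D)"
      using H(3) by (intro image_cong) auto
    thus "(\<lambda>z. if z \<in> M then H z else z) ` (M - D) = M - D'" using phomeo_image[OF k] by simp
  qed
qed

text \<open>
  The \<open>j\<close>-th part consists of the pieces whose index codes a pair \<open>(j, t)\<close>; as the code of such a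
  pair is at least \<open>j\<close>, these pieces lie in \<open>V j\<close>.
\<close>
lemma rich_split:
  assumes D: "rich D"
  obtains S where "\<And>j. rich (S j)" "\<And>j. S j \<subseteq> D" "\<And>j::nat. S j \<subseteq> V j" "disjoint_family S"
proof -
  obtain K where K: "\<And>s. pclopen (K s)" "\<And>s. K s \<subseteq> D" "\<And>s. K s \<subseteq> V s" "disjoint_family K"
    "\<And>s. \<exists>h. phomeo h (V 0 - V s) (K s)" using rich_pieces[OF D] by metis
  define I where "I j = range (\<lambda>t. prod_encode (j, t))" for j :: nat
  have inf: "infinite (I j)" for j unfolding I_def by (rule range_inj_infinite) (simp add: inj_on_def)
  have ge: "j \<le> s" if "s \<in> I j" for s j using that le_prod_encode_1 by (auto simp: I_def)
  have disj: "I i \<inter> I j = {}" if "i \<noteq> j" for i j using that by (auto simp: I_def)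
  show ?thesis
  proof (rule that[of "\<lambda>j. \<Union>s\<in>I j. K s"])
    show "rich (\<Union>s\<in>I j. K s)" for j using rich_UN_pieces[OF K(1,3,5) inf] .
    show "(\<Union>s\<in>I j. K s) \<subseteq> D" for j using K(2) by blast
    show "(\<Union>s\<in>I j. K s) \<subseteq> V j" for j using K(3) ge V_antimono by blast
    show "disjoint_family (\<lambda>j. \<Union>s\<in>I j. K s)"
      unfolding disjoint_family_on_def
    proof (intro ballI impI)
      fix i j :: nat assume "i \<noteq> j"
      hence "K s \<inter> K t = {}" if "s \<in> I i" "t \<in> I j" for s t
      proof -
        have "s \<noteq> t" using that disj[OF \<open>i \<noteq> j\<close>] by blast
        thus ?thesis using K(4) by (simp add: disjoint_family_on_def)
      qed
      thus "(\<Union>s\<in>I i. K s) \<inter> (\<Union>s\<in>I j. K s) = {}" by blast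
    qed
  qed
qed

text \<open>
  Put copies \<open>D 0 = Q\<close>, \<open>D 1\<close>, \<open>D 2\<close>, \<dots> of \<open>Q\<close> in \<open>P\<close>, let \<open>s\<close> shift each of them to the next one, and let
  \<open>g\<close> act on each of them as \<open>f\<close> acts on \<open>Q\<close>.  In the commutator of \<open>g\<close> and \<open>s\<close> everything cancels
  except the action on \<open>D 0\<close>.  The map \<open>g\<close> is continuous because the copies shrink to \<open>y\<close>.
\<close>
lemma commutator_swindle:
  assumes P: "rich P"
  obtains Q where "rich Q" "Q \<subseteq> P" "rich (P - Q)"
    "\<And>f. f \<in> homeos_on X Q \<Longrightarrow> \<exists>g\<in>homeos_on X P. \<exists>s\<in>homeos_on X P. f = g \<circ> s \<circ> finv g \<circ> finv s"
proof -
  obtain S where S: "\<And>j. rich (S j)" "\<And>j. S j \<subseteq> P" "\<And>j::nat. S j \<subseteq> V j" "disjoint_family S"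
    using rich_split[OF P] by metis
  \<comment> \<open>\<open>S 0\<close> stays outside of all copies, which makes the complements of \<open>U1\<close> and \<open>U2\<close> rich and allows
    the shift to be extended to \<open>P\<close>\<close>
  define D where "D j = S (Suc j)" for j
  have D: "rich (D j)" "D j \<subseteq> P" "D j \<subseteq> V j" for j
    using S V_Suc[of j] unfolding D_def by blast+
  have dD: "disjoint_family D" using S(4) unfolding disjoint_family_on_def D_def by auto
  have dS: "D j \<inter> S 0 = {}" for j using S(4) unfolding disjoint_family_on_def D_def by auto
  have pD: "pclopen (D j)" for j using D rich_pclopen by blast
  have pP: "pclopen P" using P rich_pclopen by blast
  define U1 where "U1 = (\<Union>j. D j)"
  define U2 where "U2 = (\<Union>j. D (Suc j))"
  have lD: "locally_finite UNIV D" by (rule locally_finite_nat) (rule D)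
  have lD2: "locally_finite UNIV (\<lambda>j. D (Suc j))" by (rule locally_finite_nat) (use D V_Suc in blast)
  have dD2: "disjoint_family (\<lambda>j. D (Suc j))" using dD unfolding disjoint_family_on_def by auto
  have pU: "pclopen U1" "pclopen U2" 
    unfolding U1_def U2_def by (rule pclopen_UN[OF pD lD], rule pclopen_UN[OF pD lD2])
  have UP: "U1 \<subseteq> P" "U2 \<subseteq> P" using D(2) unfolding U1_def U2_def by blast+
  have rest: "rich (P - U1)" "rich (P - U2)"
  proof -
    have "S 0 \<subseteq> P - U1" "S 0 \<subseteq> P - U2" using S(2) dS unfolding U1_def U2_def by blast+
    thus "rich (P - U1)" "rich (P - U2)" using S(1) rich_mono pclopen_Diff pP pU by blast+
  qed
  have "\<exists>u. phomeo u (D 0) (D j) \<and> (j = 0 \<longrightarrow> u = id)" for j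
  proof (cases "j = 0")
    case True thus ?thesis using phomeo_id pD pclopen_open by blast
  next
    case False thus ?thesis using rich_phomeo[OF D(1) D(1)] by blast
  qed
  then obtain u where u: "\<And>j. phomeo (u j) (D 0) (D j)" and u0: "u 0 = id" by metis
  define u' where "u' j = inv_into (D 0) (u j)" for j
  have u': "phomeo (u' j) (D j) (D 0)" for j unfolding u'_def using phomeo_inv[OF pD pD u] .
  have u'u: "u' j (u j z) = z" if "z \<in> D 0" for z j
    using that phomeo_bij[OF u] by (simp add: u'_def bij_betw_def)
  have u_in: "u j z \<in> D j" if "z \<in> D 0" for z j using phomeo_image[OF u] that by blast
  have u'_in: "u' j z \<in> D 0" if "z \<in> D j" for z j using phomeo_image[OF u'] that by blast
  have u'0: "u' 0 z = z" if "z \<in> D 0" for z using u'u[OF that, of 0] u0 by simp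
  obtain T where T: "phomeo T (\<Union>j. D j) (\<Union>j. D (Suc j))" "\<And>j z. z \<in> D j \<Longrightarrow> T z = (u (Suc j) \<circ> u' j) z"
    using phomeo_glue[of UNIV D "\<lambda>j. u (Suc j) \<circ> u' j" "\<lambda>j. D (Suc j)"] pD dD dD2 lD lD2
      phomeo_comp[OF u' u] by auto
  obtain s where s: "s \<in> homeos_on X P" "\<And>z. z \<in> U1 \<Longrightarrow> s z = T z" "s ` (P - U1) = P - U2"
    using extend_phomeo[OF pP pU(1) UP(1) pU(2) UP(2) _ rest] T(1) unfolding U1_def U2_def by metis
  show ?thesis
  proof (rule that[of "D 0"])
    show "rich (D 0)" "D 0 \<subseteq> P" using D by auto
    have "S 0 \<subseteq> P - D 0" using S(2) dS by blast
    thus "rich (P - D 0)" using S(1) rich_mono pclopen_Diff pP pD by blast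
    fix f assume f: "f \<in> homeos_on X (D 0)"
    have f_in: "f z \<in> D 0" if "z \<in> D 0" for z using homeos_on_mem[OF f order_refl] that by blast
    have "D 0 \<subseteq> E" using pD pclopen_subset by blast
    hence fE: "f \<in> homeos_on X E" using f homeos_on_mono by blast
    have "phomeo f (D 0) (D 0)"
      using phomeo_homeos_on(2)[OF fE pD[of 0]] homeos_on_image[OF f order_refl] by simp
    hence "phomeo (u j \<circ> (f \<circ> u' j)) (D j) (D j)" for j using phomeo_comp u u' by blast
    then obtain F where F: "phomeo F (\<Union>j. D j) (\<Union>j. D j)" "\<And>j z. z \<in> D j \<Longrightarrow> F z = (u j \<circ> (f \<circ> u' j)) z"
      using phomeo_glue[of UNIV D "\<lambda>j. u j \<circ> (f \<circ> u' j)" D] pD dD lD by auto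
    define g where "g z = (if z \<in> U1 then F z else z)" for z
    have g: "g \<in> homeos_on X U1"
      unfolding g_def using extension_homeos_on[OF pU(1)] F(1) U1_def by blast
    have gD: "g z = u j (f (u' j z))" if "z \<in> D j" for z j
      using F(2)[OF that] that by (auto simp: g_def U1_def)
    have gP: "g \<in> homeos_on X P" using g homeos_on_mono UP by blast
    have "g (s z) = f (s (g z))" for z
    proof -
      consider j where "z \<in> D j" | "z \<in> P - U1" | "z \<notin> P" unfolding U1_def by blast
      thus ?thesis
      proof cases
        case 1
        have sD: "s w = u (Suc j) (u' j w)" if "w \<in> D j" for w
          using s(2)[of w] T(2)[OF that] that by (auto simp: U1_def)
        have a: "u' j z \<in> D 0" "f (u' j z) \<in> D 0" using u'_in f_in 1 by auto
        have "g z = u j (f (u' j z))" using gD 1 .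
        hence "s (g z) = u (Suc j) (f (u' j z))" using sD u_in u'u a by simp
        moreover have "u (Suc j) (f (u' j z)) \<notin> D 0"
          using u_in[OF a(2), of "Suc j"] dD unfolding disjoint_family_on_def by blast
        moreover have "g (s z) = u (Suc j) (f (u' j z))"
          using sD[OF 1] gD[OF u_in[OF a(1), of "Suc j"]] u'u a by simp
        ultimately show ?thesis using homeos_onD[OF f] by simp
      next
        case 2
        hence gz: "g z = z" by (simp add: g_def)
        have "s z \<in> P - U2" using 2 s(3) by blast
        show ?thesis
        proof (cases "s z \<in> D 0")
          case True
          thus ?thesis using gD[OF True] u0 u'0 gz by simp
        next
          case False
          have "s z \<notin> D j" for j
            using False \<open>s z \<in> P - U2\<close> by (cases j) (auto simp: U2_def)
          hence "s z \<notin> U1" by (simp add: U1_def)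
          thus ?thesis using gz False homeos_onD[OF f] by (simp add: g_def)
        qed
      next
        case 3
        hence "z \<notin> U1" "z \<notin> D 0" using UP D(2)[of 0] by auto
        thus ?thesis using 3 homeos_onD[OF s(1)] homeos_onD[OF f] by (simp add: g_def)
      qed
    qed
    hence "f = g \<circ> s \<circ> finv g \<circ> finv s"
      using commutator_eqI gP s(1) homeos_on_subset by blast
    thus "\<exists>g\<in>homeos_on X P. \<exists>s\<in>homeos_on X P. f = g \<circ> s \<circ> finv g \<circ> finv s"
      using gP s(1) by blast
  qed
qed

lemma bounded_image:
  assumes f: "f \<in> homeos_on X E" and K: "pclopen K" "K \<inter> V m = {}"
  shows "\<exists>n. f ` K \<inter> V n = {}"
proof -
  have b: "f \<in> homeos X" using f homeos_on_subset by blast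
  note p = phomeo_homeos_on[OF f K(1)]
  have "phomeo (finv f) (f ` K) (finv f ` f ` K)"
    using phomeo_homeos_on(2)[OF homeos_on_inv[OF f] p(1)] .
  then obtain n where n: "finv f ` (f ` K \<inter> V n) \<subseteq> V m" unfolding phomeo_def by blast
  have "f z \<notin> V n" if "z \<in> K" for z
  proof
    assume "f z \<in> V n"
    hence "finv f (f z) \<in> V m" using n that by blast
    thus False using that K(2) homeos_finv_simps(1)[OF b] by auto
  qed
  thus ?thesis by blast
qed

text \<open>
  Take pieces \<open>K s\<close> of \<open>A\<close> and \<open>L s\<close> of \<open>B\<close> that shrink to \<open>y\<close>.  The sets \<open>f (K s)\<close> and
  \<open>L s\<close> avoid a neighbourhood of \<open>y\<close> each, and they shrink to \<open>y\<close>, so along a sparse sequence of indices \<open>f (K i)\<close> is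
  disjoint from \<open>L j\<close> whenever \<open>i \<noteq> j\<close>.
\<close>
lemma rich_separate:
  assumes A: "rich A" and B: "rich B" and f: "f \<in> homeos_on X E"
  obtains D J where "rich D" "D \<subseteq> A" "rich J" "J \<subseteq> B" "f ` D \<inter> J = {}"
proof -
  obtain K where K: "\<And>s. pclopen (K s)" "\<And>s. K s \<subseteq> A" "\<And>s. K s \<subseteq> V s"
    "\<And>s. \<exists>h. phomeo h (V 0 - V s) (K s)" "\<And>s. \<exists>m. K s \<inter> V m = {}" using rich_pieces[OF A] by metis
  obtain L where L: "\<And>s. pclopen (L s)" "\<And>s. L s \<subseteq> B" "\<And>s. L s \<subseteq> V s"
    "\<And>s. \<exists>h. phomeo h (V 0 - V s) (L s)" "\<And>s. \<exists>m. L s \<inter> V m = {}" using rich_pieces[OF B] by metis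
  have "\<exists>m. f ` K s \<inter> V m = {} \<and> L s \<inter> V m = {}" for s
  proof -
    obtain m where m: "f ` K s \<inter> V m = {}" using bounded_image[OF f K(1)] K(5) by blast
    obtain m' where m': "L s \<inter> V m' = {}" using L(5) by blast
    show ?thesis using m m' V_antimono[of m "max m m'"] V_antimono[of m' "max m m'"]
      by (intro exI[of _ "max m m'"]) auto
  qed
  then obtain a where a: "\<And>s. f ` K s \<inter> V (a s) = {}" "\<And>s. L s \<inter> V (a s) = {}" by metis
  have "\<exists>b. f ` (E \<inter> V b) \<subseteq> V m" for m
    using phomeo_homeos_on(2)[OF f pclopen_E] unfolding phomeo_def by blast
  then obtain b where b: "\<And>m. f ` (E \<inter> V (b m)) \<subseteq> V m" by metis
  define step where "step x = max (Suc x) (max (a x) (b (a x)))" for x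
  define \<nu> where "\<nu> k = (step ^^ k) 0" for k
  have \<nu>_Suc: "\<nu> (Suc k) = step (\<nu> k)" for k by (simp add: \<nu>_def)
  have sm: "strict_mono \<nu>" by (rule strict_monoI_Suc) (simp add: \<nu>_Suc step_def less_max_iff_disj)
  have far: "f ` K (\<nu> l) \<subseteq> V (a (\<nu> k))" "L (\<nu> l) \<subseteq> V (a (\<nu> k))" if "k < l" for k l
  proof -
    have "\<nu> (Suc k) \<le> \<nu> l" using sm that by (simp add: strict_mono_less_eq)
    hence ge: "a (\<nu> k) \<le> \<nu> l" "b (a (\<nu> k)) \<le> \<nu> l" by (auto simp: \<nu>_Suc step_def)
    have "K (\<nu> l) \<subseteq> E \<inter> V (b (a (\<nu> k)))" using K(1,3)[of "\<nu> l"] V_antimono[OF ge(2)] pclopen_subset by blast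
    thus "f ` K (\<nu> l) \<subseteq> V (a (\<nu> k))" using b by blast
    show "L (\<nu> l) \<subseteq> V (a (\<nu> k))" using L(3)[of "\<nu> l"] V_antimono[OF ge(1)] by blast
  qed
  have disj: "f ` K (\<nu> i) \<inter> L (\<nu> j) = {}" if "i \<noteq> j" for i j
    using that far[of i j] far[of j i] a[of "\<nu> i"] a[of "\<nu> j"] by (cases "i < j") auto
  have inf: "infinite (\<nu> ` {k. even k})" "infinite (\<nu> ` {k. odd k})"
  proof -
    have "infinite (range (\<lambda>k::nat. 2 * k))" "infinite (range (\<lambda>k::nat. Suc (2 * k)))"
      by (auto intro!: range_inj_infinite simp: inj_on_def)
    moreover have "range (\<lambda>k::nat. 2 * k) \<subseteq> {k. even k}" "range (\<lambda>k::nat. Suc (2 * k)) \<subseteq> {k. odd k}" by auto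
    ultimately have "infinite {k::nat. even k}" "infinite {k::nat. odd k}" using infinite_super by blast+
    moreover have "inj_on \<nu> S" for S using sm strict_mono_imp_inj_on by blast
    ultimately show "infinite (\<nu> ` {k. even k})" "infinite (\<nu> ` {k. odd k})"
      by (auto simp: finite_image_iff)
  qed
  \<comment> \<open>even indices for one family and odd ones for the other, as nothing is known when the indices agree\<close>
  show ?thesis
  proof (rule that[of "\<Union>s\<in>\<nu> ` {k. even k}. K s" "\<Union>s\<in>\<nu> ` {k. odd k}. L s"])
    show "rich (\<Union>s\<in>\<nu> ` {k. even k}. K s)" using rich_UN_pieces[OF K(1,3,4) inf(1)] .
    show "rich (\<Union>s\<in>\<nu> ` {k. odd k}. L s)" using rich_UN_pieces[OF L(1,3,4) inf(2)] .
    show "f ` (\<Union>s\<in>\<nu> ` {k. even k}. K s) \<inter> (\<Union>s\<in>\<nu> ` {k. odd k}. L s) = {}"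
    proof -
      have "f ` K (\<nu> i) \<inter> L (\<nu> j) = {}" if "even i" "odd j" for i j using disj that by metis
      thus ?thesis by blast
    qed
  qed (use K L in blast)+
qed

text \<open>
  First \<open>f\<close> is modified so that it fixes a rich subset \<open>D\<close> of \<open>A\<close> pointwise: \<open>u\<close> moves the part
  of \<open>f D\<close> in \<open>B \<union> C\<close> into one half \<open>S 0\<close> of \<open>B\<close>, and then \<open>v\<close> carries everything back to \<open>D\<close> inside
  \<open>A \<union> B\<close>.  Conjugation by a map \<open>w\<close> supported in \<open>A \<union> B\<close> that sends \<open>D\<close> onto \<open>A\<close> turns
  the result into a homeomorphism \<open>k\<close> that fixes \<open>A\<close> pointwise, that is, one supported in \<open>B \<union> C\<close>.
\<close>
lemma factor_over_overlapping_pieces: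
  assumes A: "rich A" and B: "rich B" and C: "rich C"
    and disj: "A \<inter> B = {}" "A \<inter> C = {}" "B \<inter> C = {}"
    and f: "f \<in> homeos_on X (A \<union> B \<union> C)"
  obtains a b b' c where "a \<in> homeos_on X (B \<union> C)" "b \<in> homeos_on X (A \<union> B)" "b' \<in> homeos_on X (A \<union> B)"
    "c \<in> homeos_on X (B \<union> C)" "f = a \<circ> (b \<circ> (finv b' \<circ> (c \<circ> b')))"
proof -
  have pA: "pclopen A" and pB: "pclopen B" and pC: "pclopen C" using A B C rich_pclopen by auto
  note pAB = pclopen_Un[OF pA pB] and pBC = pclopen_Un[OF pB pC]
  have AE: "A \<subseteq> E" "B \<subseteq> E" "C \<subseteq> E" using pA pB pC pclopen_subset by auto
  have fE: "f \<in> homeos_on X E" using f homeos_on_mono[of "A \<union> B \<union> C" E] AE by blast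
  obtain D J where D: "rich D" "D \<subseteq> A" and J: "rich J" "J \<subseteq> B" and DJ: "f ` D \<inter> J = {}"
    using rich_separate[OF A B fE] by metis
  have pD: "pclopen D" using D rich_pclopen by blast
  obtain S where S: "\<And>j. rich (S j)" "\<And>j::nat. S j \<subseteq> B" "disjoint_family S" using rich_split[OF B] by metis
  have S01: "S 0 \<inter> S 1 = {}" using S(3) by (auto simp: disjoint_family_on_def)
  define F where "F = f ` D \<inter> (B \<union> C)"
  have pF: "pclopen F" unfolding F_def using phomeo_homeos_on(1)[OF fE pD] pBC pclopen_Int by blast
  obtain e where e: "phomeo e E (S 0)" using rich_phomeo_E[OF S(1)] by blast
  note eF = phomeo_restrict[OF pclopen_E rich_pclopen[OF S(1)] e pF pclopen_subset[OF pF]]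
  have eS: "e ` F \<subseteq> S 0" using phomeo_image[OF e] pclopen_subset[OF pF] by blast
  have r1: "rich (B \<union> C - F)"
    by (rule rich_mono[OF J(1)]) (use J DJ pclopen_Diff[OF pBC pF] in \<open>auto simp: F_def\<close>)
  have r2: "rich (B \<union> C - e ` F)"
    by (rule rich_mono[OF C]) (use eS S(2) disj pclopen_Diff[OF pBC eF(1)] in blast)+
  obtain u where u: "u \<in> homeos_on X (B \<union> C)" "\<And>z. z \<in> F \<Longrightarrow> u z = e z"
    by (rule extend_phomeo[OF pBC pF _ eF(1) _ eF(2) r1 r2]) (use eS S(2) F_def in blast)+
  have uE: "u \<in> homeos_on X E" using u homeos_on_mono[of "B \<union> C" E] AE by blast
  define \<phi> where "\<phi> = u \<circ> f"
  have \<phi>E: "\<phi> \<in> homeos_on X E" unfolding \<phi>_def using uE fE homeos_on_comp by blast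
  note p\<phi> = phomeo_homeos_on[OF \<phi>E pD]
  have \<phi>D: "\<phi> ` D \<subseteq> A \<union> S 0"
  proof
    fix w assume "w \<in> \<phi> ` D"
    then obtain z where z: "z \<in> D" "w = u (f z)" by (auto simp: \<phi>_def)
    show "w \<in> A \<union> S 0"
    proof (cases "f z \<in> F")
      case True thus ?thesis using u(2) eS z by auto
    next
      case False
      hence n: "f z \<notin> B \<union> C" using z by (auto simp: F_def)
      have "f z \<in> A \<union> B \<union> C" using homeos_on_mem[OF f order_refl] z D by blast
      thus ?thesis using n z homeos_onD[OF u(1) n] by auto
    qed
  qed
  have r3: "rich (A \<union> B - \<phi> ` D)"
    by (rule rich_mono[OF S(1)[of 1]]) (use \<phi>D S(2) S01 disj pclopen_Diff[OF pAB p\<phi>(1)] in blast)+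
  have r4: "rich (A \<union> B - D)"
    by (rule rich_mono[OF B]) (use D disj pclopen_Diff[OF pAB pD] in blast)+
  have \<phi>AB: "\<phi> ` D \<subseteq> A \<union> B" using \<phi>D S(2) by blast
  have DAB: "D \<subseteq> A \<union> B" using D by blast
  obtain v where v: "v \<in> homeos_on X (A \<union> B)" "\<And>z. z \<in> \<phi> ` D \<Longrightarrow> v z = inv_into D \<phi> z"
    using extend_phomeo[OF pAB p\<phi>(1) \<phi>AB pD DAB phomeo_inv[OF pD p\<phi>] r3 r4] by metis
  have v\<phi>: "v (\<phi> z) = z" if "z \<in> D" for z
    using v(2)[of "\<phi> z"] that phomeo_bij[OF p\<phi>(2)] by (simp add: bij_betw_def)
  obtain h where h: "phomeo h D A" using rich_phomeo[OF D(1) A] by blast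
  have r5: "rich (A \<union> B - A)" using B disj by (metis Diff_triv Int_commute Un_Diff Un_empty_left Diff_cancel)
  obtain w where w: "w \<in> homeos_on X (A \<union> B)" "w ` D = A"
    using extend_phomeo[OF pAB pD DAB pA Un_upper1 h r4 r5] by metis
  have H: "f \<in> homeos X" "u \<in> homeos X" "v \<in> homeos X" "w \<in> homeos X"
    using f u v w homeos_on_subset by blast+
  define k where "k = w \<circ> (v \<circ> \<phi>) \<circ> finv w"
  have kX: "k \<in> homeos X" unfolding k_def \<phi>_def using H by (intro homeos_comp homeos_inv)
  have k: "k \<in> homeos_on X (B \<union> C)"
  proof (rule homeos_onI[OF kX])
    fix z assume z: "z \<notin> B \<union> C"
    show "k z = z"
    proof (cases "z \<in> A")
      case True
      then obtain x where "x \<in> D" "z = w x" using w by blast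
      thus ?thesis using v\<phi> H by (simp add: k_def homeos_finv_simps)
    next
      case False
      hence "finv w z = z" "w z = z" "f z = z" "u z = z" "v z = z"
        using z homeos_onD[OF homeos_on_inv[OF w(1)]] homeos_onD[OF w(1)] homeos_onD[OF f]
          homeos_onD[OF u(1)] homeos_onD[OF v(1)] by auto
      thus ?thesis by (simp add: k_def \<phi>_def)
    qed
  qed
  show ?thesis
  proof (rule that[of "finv u" "finv v" w k])
    show "f = finv u \<circ> (finv v \<circ> (finv w \<circ> (k \<circ> w)))"
      using H by (auto simp: fun_eq_iff k_def \<phi>_def homeos_finv_simps)
  qed (use u v w k homeos_on_inv in blast)+
qed

end

section \<open>Words in a large set of homeomorphisms\<close>
text \<open>
  A set \<open>t\<close> is represented by the codes of its restrictions to \<open>{..<n}\<close>.  Two different sets share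
  only the codes of restrictions below the first place where they differ.
\<close>
lemma almost_disjoint_family:
  obtains A :: "nat set \<Rightarrow> nat set"
  where "\<And>t. infinite (A t)" "\<And>s t. s \<noteq> t \<Longrightarrow> finite (A s \<inter> A t)"
proof -
  define code :: "nat set \<Rightarrow> nat \<Rightarrow> nat" where "code t n = to_nat (map (\<lambda>i. i \<in> t) [0..<n])" for t n
  have code: "n = m \<and> (\<forall>i<n. i \<in> s \<longleftrightarrow> i \<in> t)" if "code s n = code t m" for s t n m
  proof -
    have e: "map (\<lambda>i. i \<in> s) [0..<n] = map (\<lambda>i. i \<in> t) [0..<m]" using that by (simp add: code_def)
    hence "n = m" by (metis length_map length_upt diff_zero)
    thus ?thesis using e by auto
  qed
  show ?thesis
  proof (rule that[of "\<lambda>t. range (code t)"])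
    show "infinite (range (code t))" for t
      by (rule range_inj_infinite) (use code in \<open>auto intro: injI\<close>)
    fix s t :: "nat set" assume "s \<noteq> t"
    then obtain k where k: "k \<in> s \<longleftrightarrow> k \<notin> t" by blast
    have "range (code s) \<inter> range (code t) \<subseteq> code s ` {..k}"
    proof
      fix x assume "x \<in> range (code s) \<inter> range (code t)"
      then obtain n m where n: "x = code s n" "x = code t m" by blast
      hence "\<forall>i<n. i \<in> s \<longleftrightarrow> i \<in> t" using code[of s n t m] by simp
      hence "n \<le> k" using k by (metis not_le)
      thus "x \<in> code s ` {..k}" using n by simp
    qed
    thus "finite (range (code s) \<inter> range (code t))" using finite_surj[of "{..k}"] by blast
  qed
qed

text \<open>
  In the application \<open>W\<close> is the preimage of a symmetric neighbourhood of the identity, and the colour of a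
  homeomorphism is the index of a translate of a smaller neighbourhood that contains its image.
\<close>
locale coloured_homeos = clopen_base X y V
  for X :: "'a topology" and y :: 'a and V :: "nat \<Rightarrow> 'a set" +
  fixes colour :: "('a \<Rightarrow> 'a) \<Rightarrow> nat" and W :: "('a \<Rightarrow> 'a) set"
  assumes W_homeos: "W \<subseteq> homeos X"
    and W_inv: "w \<in> W \<Longrightarrow> finv w \<in> W"
    and same_colour: "\<lbrakk>p \<in> homeos X; q \<in> homeos X; colour p = colour q\<rbrakk> \<Longrightarrow> finv p \<circ> q \<in> W"
    and rich_E: "rich E"
begin

primrec words :: "nat \<Rightarrow> ('a \<Rightarrow> 'a) set" where
  "words 0 = {id}"
| "words (Suc k) = {a \<circ> b | a b. a \<in> W \<and> b \<in> words k}"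

lemma words_comp: "\<lbrakk>a \<in> words i; b \<in> words j\<rbrakk> \<Longrightarrow> a \<circ> b \<in> words (i + j)"
proof (induction i arbitrary: a)
  case (Suc i)
  then obtain w a' where a: "a = w \<circ> a'" "w \<in> W" "a' \<in> words i" by auto
  have "w \<circ> (a' \<circ> b) \<in> words (Suc (i + j))" 
    unfolding words.simps using Suc.IH[OF a(3) Suc.prems(2)] a(2) by blast
  thus ?case using a(1) by (simp only: comp_assoc add_Suc)
qed simp

lemma words_1: "w \<in> W \<Longrightarrow> w \<in> words 1"
  by auto

lemma words_homeos: "words k \<subseteq> homeos X"
  using W_homeos by (induction k) (auto intro: homeos_id homeos_comp)

lemma words_inv: "a \<in> words k \<Longrightarrow> finv a \<in> words k"
proof (induction k arbitrary: a)
  case 0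
  thus ?case by (auto simp: inv_id[unfolded id_def] id_def)
next
  case (Suc k)
  then obtain w b where a: "a = w \<circ> b" "w \<in> W" "b \<in> words k" by auto
  have "bij w" "bij b" using a W_homeos words_homeos homeos_bij by blast+
  hence "finv a = finv b \<circ> finv w" using a by (simp add: o_inv_distrib)
  moreover have "finv b \<circ> finv w \<in> words (k + 1)"
    using Suc.IH a words_1 W_inv words_comp by blast
  ultimately show ?case by (simp only: Suc_eq_plus1)
qed

text \<open>
  Let \<open>S j\<close> be disjoint rich subsets of \<open>D\<close> that shrink to \<open>y\<close>.  If for every \<open>j\<close> there were some \<open>f j\<close>
  on \<open>S j\<close> that no homeomorphism of colour \<open>j\<close> supported in \<open>D\<close> extends, the homeomorphism composed of all
  the \<open>f j\<close> could not have any colour.  So for some \<open>j\<close> both \<open>f\<close> and the identity of \<open>S j\<close> extend with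
  colour \<open>j\<close>, and the quotient of the extensions is in \<open>W\<close>.
\<close>
lemma extend_prescribed_values:
  assumes D: "rich D"
  obtains M where "rich M" "M \<subseteq> D"
    "\<And>f. f \<in> homeos_on X M \<Longrightarrow> \<exists>w\<in>W \<inter> homeos_on X D. \<forall>z\<in>M. w z = f z"
proof -
  obtain S where S: "\<And>j. rich (S j)" "\<And>j. S j \<subseteq> D" "\<And>j::nat. S j \<subseteq> V j" "disjoint_family S"
    using rich_split[OF D] by metis
  have pS: "pclopen (S j)" for j using S rich_pclopen by blast
  have lS: "locally_finite UNIV S" by (rule locally_finite_nat) (rule S)
  have "\<exists>j. \<forall>f\<in>homeos_on X (S j). \<exists>p\<in>homeos_on X D. colour p = j \<and> (\<forall>z\<in>S j. p z = f z)"
  proof (rule ccontr)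
    assume "\<not> ?thesis"
    hence "\<forall>j. \<exists>f\<in>homeos_on X (S j). \<forall>p\<in>homeos_on X D. colour p = j \<longrightarrow> (\<exists>z\<in>S j. p z \<noteq> f z)" by meson
    then obtain f where f: "\<And>j. f j \<in> homeos_on X (S j)"
      "\<And>j p. p \<in> homeos_on X D \<Longrightarrow> colour p = j \<Longrightarrow> \<exists>z\<in>S j. p z \<noteq> f j z" by metis
    have fS: "phomeo (f j) (S j) (S j)" for j
    proof -
      have "f j \<in> homeos_on X E" using f(1) homeos_on_mono[OF pclopen_subset[OF pS]] by blast
      thus ?thesis using phomeo_homeos_on(2)[OF _ pS, of "f j" j] homeos_on_image[OF f(1) order_refl] by metis
    qed
    obtain F where F: "phomeo F (\<Union>j. S j) (\<Union>j. S j)" "\<And>j z. z \<in> S j \<Longrightarrow> F z = f j z"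
      using phomeo_glue[of UNIV S f S] pS fS S(4) lS by auto
    define p where "p z = (if z \<in> (\<Union>j. S j) then F z else z)" for z
    have "p \<in> homeos_on X (\<Union>j. S j)"
      unfolding p_def using extension_homeos_on[OF pclopen_UN[OF pS lS] F(1)] .
    hence "p \<in> homeos_on X D" using homeos_on_mono[of "\<Union>j. S j" D] S(2) by blast
    moreover have "p z = f j z" if "z \<in> S j" for j z using F(2)[OF that] that by (auto simp: p_def)
    ultimately show False using f(2)[OF _ refl] by blast
  qed
  then obtain j where j: "\<And>f. f \<in> homeos_on X (S j) \<Longrightarrow> \<exists>p\<in>homeos_on X D. colour p = j \<and> (\<forall>z\<in>S j. p z = f z)"
    by blast
  obtain p where p: "p \<in> homeos_on X D" "colour p = j" "\<And>z. z \<in> S j \<Longrightarrow> p z = z"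
    using j[OF homeos_on_id] by auto
  show ?thesis
  proof (rule that[OF S(1,2)[of j]])
    fix f assume f: "f \<in> homeos_on X (S j)"
    then obtain q where q: "q \<in> homeos_on X D" "colour q = j" "\<And>z. z \<in> S j \<Longrightarrow> q z = f z" using j by blast
    have H: "p \<in> homeos X" "q \<in> homeos X" using p q homeos_on_subset by blast+
    have "finv p (q z) = f z" if z: "z \<in> S j" for z
    proof -
      have "f z \<in> S j" using homeos_on_mem[OF f order_refl] z by blast
      hence "p (f z) = f z" by (rule p(3))
      thus ?thesis using q(3)[OF z] homeos_finv_simps(1)[OF H(1)] by metis
    qed
    moreover have "finv p \<circ> q \<in> W" using same_colour H p q by simp
    moreover have "finv p \<circ> q \<in> homeos_on X D" using p q homeos_on_inv homeos_on_comp by blast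
    ultimately show "\<exists>w\<in>W \<inter> homeos_on X D. \<forall>z\<in>S j. w z = f z" by (metis IntI comp_apply)
  qed
qed

text \<open>
  The previous lemma is applied twice, first in \<open>E\<close> and then inside the set \<open>M\<close> obtained.  Elements
  of \<open>W\<close> from the first application are prescribed on \<open>M\<close>, those from the second are supported in \<open>M\<close>
  and prescribed on \<open>P\<close>, so their commutators are the commutators of homeomorphisms supported in \<open>P\<close>.
  By the swindle these make up all homeomorphisms supported in \<open>Q\<close>.
\<close>
lemma words_contain_rich_support:
  obtains Q where "rich Q" "rich (E - Q)" "homeos_on X Q \<subseteq> words 4"
proof -
  obtain M where M: "rich M" "M \<subseteq> E"
    "\<And>f. f \<in> homeos_on X M \<Longrightarrow> \<exists>w\<in>W \<inter> homeos_on X E. \<forall>z\<in>M. w z = f z"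
    using extend_prescribed_values[OF rich_E] by metis
  obtain P where P: "rich P" "P \<subseteq> M"
    "\<And>f. f \<in> homeos_on X P \<Longrightarrow> \<exists>w\<in>W \<inter> homeos_on X M. \<forall>z\<in>P. w z = f z"
    using extend_prescribed_values[OF M(1)] by metis
  have comm: "f \<circ> g \<circ> finv f \<circ> finv g \<in> words 4" if f: "f \<in> homeos_on X P" and g: "g \<in> homeos_on X P" for f g
  proof -
    obtain w where w: "w \<in> W" "w \<in> homeos_on X M" "\<And>z. z \<in> P \<Longrightarrow> w z = f z" using P(3)[OF f] by blast
    have "g \<in> homeos_on X M" using g homeos_on_mono P(2) by blast
    then obtain v where v: "v \<in> W" "\<And>z. z \<in> M \<Longrightarrow> v z = g z" using M(3) by blast
    have vX: "v \<in> homeos X" using v W_homeos by blast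
    have "f \<circ> g \<circ> finv f \<circ> finv g = w \<circ> v \<circ> finv w \<circ> finv v"
      by (rule commutator_of_partial_agreement[OF w(2) vX f g P(2) w(3) v(2)])
    also have "\<dots> \<in> words (1 + 1 + 1 + 1)"
      by (intro words_comp words_1 W_inv w v)
    finally show ?thesis by (simp only: numeral_plus_numeral one_plus_numeral one_add_one add_num_simps numeral_plus_one semiring_norm)
  qed
  obtain Q where Q: "rich Q" "Q \<subseteq> P" "rich (P - Q)"
    "\<And>f. f \<in> homeos_on X Q \<Longrightarrow> \<exists>g\<in>homeos_on X P. \<exists>s\<in>homeos_on X P. f = g \<circ> s \<circ> finv g \<circ> finv s"
    using commutator_swindle[OF P(1)] by metis
  show ?thesis
  proof (rule that[OF Q(1)])
    show "rich (E - Q)"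
      by (rule rich_mono[OF Q(3)])
        (use M P pclopen_Diff[OF pclopen_E rich_pclopen[OF Q(1)]] in blast)+
    show "homeos_on X Q \<subseteq> words 4" using Q(4) comm by blast
  qed
qed

text \<open>
  The sets \<open>U (B t)\<close> are uncountably many almost disjoint rich sets.  If \<open>g t\<close> maps \<open>Q\<close> onto the complement of
  \<open>U (B t)\<close>, two of the \<open>g t\<close> have the same colour, and \<open>r = (g s)\<^sup>-\<^sup>1 \<circ> g t\<close> is in \<open>W\<close>.  Up to the map
  \<open>(g s)\<^sup>-\<^sup>1\<close>, the sets \<open>Q\<close> and \<open>r Q\<close> are the complements of \<open>U (B s)\<close> and \<open>U (B t)\<close>, so
  their union misses only the finitely many pieces common to both.
\<close>
lemma overlapping_translate:
  assumes Q: "rich Q" "rich (E - Q)"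
  obtains g m where "g \<in> W" "rich (Q - g ` Q)" "rich (Q \<inter> g ` Q)" "rich (g ` Q - Q)"
    "V m - {y} \<subseteq> Q \<union> g ` Q"
proof -
  obtain K where K: "\<And>s. pclopen (K s)" "\<And>s. K s \<subseteq> E" "\<And>s. K s \<subseteq> V s" "disjoint_family K"
    "\<And>s. \<exists>h. phomeo h (V 0 - V s) (K s)" "\<And>s. \<exists>m. K s \<inter> V m = {}" using rich_pieces[OF rich_E] by metis
  obtain A :: "nat set \<Rightarrow> nat set" where A: "\<And>t. infinite (A t)" "\<And>s t. s \<noteq> t \<Longrightarrow> finite (A s \<inter> A t)"
    using almost_disjoint_family by metis
  define U where "U I = (\<Union>s\<in>I. K s)" for I
  define B where "B t = (\<lambda>s. 2 * s) ` A t" for t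
  have infB: "infinite (B t)" for t using A(1) by (simp add: B_def finite_image_iff inj_on_def)
  have finB: "finite (B s \<inter> B t)" if "s \<noteq> t" for s t
  proof -
    have "B s \<inter> B t = (\<lambda>s. 2 * s) ` (A s \<inter> A t)" by (auto simp: B_def)
    thus ?thesis using A(2)[OF that] by simp
  qed
  have pU: "pclopen (U I)" for I unfolding U_def by (rule pclopen_locally_finite_UN_nat[OF K(1,3)])
  have rU: "rich (U I)" if "infinite I" for I unfolding U_def by (rule rich_UN_pieces[OF K(1,3,5) that])
  have U_disj: "U I \<inter> U J = {}" if "I \<inter> J = {}" for I J
  proof -
    have "K i \<inter> K j = {}" if "i \<in> I" "j \<in> J" for i j
    proof -
      have "i \<noteq> j" using that \<open>I \<inter> J = {}\<close> by blast
      thus ?thesis using K(4) by (simp add: disjoint_family_on_def)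
    qed
    thus ?thesis unfolding U_def by blast
  qed
  have U_diff: "U I - U J = U (I - J)" for I J
  proof -
    have "U I = U (I - J) \<union> U (I \<inter> J)" "U (I \<inter> J) \<subseteq> U J" "U (I - J) \<inter> U J = {}"
      using U_disj[of "I - J" J] by (auto simp: U_def)
    thus ?thesis by blast
  qed
  have U_int: "U I \<inter> U J = U (I \<inter> J)" for I J
  proof -
    have "U I = U (I - J) \<union> U (I \<inter> J)" "U (I \<inter> J) \<subseteq> U J" "U (I - J) \<inter> U J = {}"
      using U_disj[of "I - J" J] by (auto simp: U_def)
    thus ?thesis by blast
  qed
  \<comment> \<open>the odd pieces belong to no \<open>U (B t)\<close>, which makes all complements rich\<close>
  define Od where "Od = range (\<lambda>s::nat. Suc (2 * s))"
  have "infinite Od" unfolding Od_def by (rule range_inj_infinite) (simp add: inj_on_def)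
  note rO = rU[OF this]
  have OB: "Od \<inter> B t = {}" for t unfolding Od_def B_def by (auto, presburger)
  have UE: "U I \<subseteq> E" for I using K(2) by (auto simp: U_def)
  have pQ: "pclopen Q" "Q \<subseteq> E" using Q rich_pclopen pclopen_subset by blast+
  have "\<exists>g. g \<in> homeos_on X E \<and> g ` Q = E - U (B t)" for t
  proof -
    have pc: "pclopen (E - U (B t))" using pclopen_Diff pclopen_E pU by blast
    have "rich (E - U (B t))"
      by (rule rich_mono[OF rO _ pc]) (use U_disj[OF OB] UE in blast)
    then obtain h where h: "phomeo h Q (E - U (B t))" using rich_phomeo Q by blast
    have "E - (E - U (B t)) = U (B t)" using UE by blast
    hence "rich (E - (E - U (B t)))" using rU[OF infB] by simp
    thus ?thesis using extend_phomeo[OF pclopen_E pQ pc Diff_subset h Q(2)] by metis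
  qed
  then obtain g where g: "\<And>t. g t \<in> homeos_on X E" "\<And>t. g t ` Q = E - U (B t)" by metis
  have "\<not> inj (\<lambda>t. colour (g t))"
  proof
    assume "inj (\<lambda>t. colour (g t))"
    hence "range (inv_into UNIV (\<lambda>t. colour (g t))) = Pow UNIV"
      using inj_imp_surj_inv by auto
    thus False using Cantors_theorem[of "UNIV :: nat set"] by blast
  qed
  then obtain s t where st: "s \<noteq> t" "colour (g s) = colour (g t)" by (auto simp: inj_def)
  define q where "q = finv (g s)"
  have gX: "g s \<in> homeos X" "g t \<in> homeos X" using g homeos_on_subset by blast+
  have q: "q \<in> homeos_on X E" unfolding q_def using g homeos_on_inv by blast
  have inj: "inj q" using q homeos_on_subset homeos_bij bij_is_inj by blast
  define r where "r = q \<circ> g t"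
  have rW: "r \<in> W" unfolding r_def q_def using same_colour gX st by blast
  have qE: "q ` E = E" using homeos_on_image[OF q order_refl] .
  have rQ: "r ` Q = q ` (E - U (B t))" 
    unfolding r_def image_comp[symmetric] g(2) ..
  have "q ` (g s ` Q) = Q" unfolding q_def using homeos_finv_simps[OF gX(1)] by (auto simp: image_iff)
  hence Qq: "Q = q ` (E - U (B s))" using g by simp
  have rich_q: "rich (q ` D)" if "rich D" for D
    using rich_phomeo_image[OF that] phomeo_homeos_on[OF q rich_pclopen[OF that]] by blast
  have inf_diff: "infinite (B a - B b)" if "a \<noteq> b" for a b
    using infB finB[OF that] by (metis Diff_Diff_Int Diff_infinite_finite)
  define R where "R = r ` Q"
  have RQ: "R = q ` (E - U (B t))" unfolding R_def rQ ..
  have "Q - R = q ` (U (B t - B s))"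
    unfolding RQ Qq image_set_diff[OF inj, symmetric] U_diff[symmetric] using UE by blast
  hence 1: "rich (Q - R)" using rich_q rU inf_diff st by metis
  have "R - Q = q ` (U (B s - B t))"
    unfolding RQ Qq image_set_diff[OF inj, symmetric] U_diff[symmetric] using UE by blast
  hence 2: "rich (R - Q)" using rich_q rU inf_diff st by metis
  have "rich (E - (U (B s) \<union> U (B t)))"
    by (rule rich_mono[OF rO]) (use U_disj[OF OB] UE pclopen_Diff[OF pclopen_E pclopen_Un[OF pU pU]] in blast)+
  hence "rich (q ` (E - (U (B s) \<union> U (B t))))" by (rule rich_q)
  moreover have "Q \<inter> R = q ` (E - (U (B s) \<union> U (B t)))"
    unfolding RQ Qq image_Int[OF inj, symmetric] by blast
  ultimately have 3: "rich (Q \<inter> R)" by simp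
  obtain m where m: "\<And>i. K i \<inter> V (m i) = {}" using K(6) by metis
  define m' where "m' = Max (insert 0 (m ` (B s \<inter> B t)))"
  have "m i \<le> m'" if "i \<in> B s \<inter> B t" for i
    unfolding m'_def using finB[OF st(1)] that by (intro Max_ge) auto
  hence "U (B s \<inter> B t) \<inter> V m' = {}" using m V_antimono unfolding U_def by blast
  then obtain n where n: "q ` U (B s \<inter> B t) \<inter> V n = {}" using bounded_image[OF q pU] by blast
  have "E - (Q \<union> R) = q ` U (B s \<inter> B t)"
  proof -
    have "Q \<union> R = q ` (E - U (B s \<inter> B t))" unfolding RQ Qq U_int[symmetric] by blast
    thus ?thesis using UE qE by (metis image_set_diff[OF inj] double_diff order_refl)
  qed
  moreover have "V n - {y} \<subseteq> E" using pclopen_V pclopen_subset by blast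
  ultimately have "V n - {y} \<subseteq> Q \<union> R" using n by blast
  thus ?thesis using that rW 1 2 3 unfolding R_def by blast
qed

text \<open>
  Elements supported in \<open>Q\<close> have length 4, those supported in \<open>g Q\<close> have length 6 as conjugates by \<open>g\<close>,
  and the factorisation uses three of the former and two of the latter.
\<close>
theorem words_contain_small_support:
  obtains m where "homeos_on X (V m - {y}) \<subseteq> words 24"
proof -
  obtain Q where Q: "rich Q" "rich (E - Q)" "homeos_on X Q \<subseteq> words 4"
    using words_contain_rich_support by metis
  obtain g m where g: "g \<in> W" "rich (Q - g ` Q)" "rich (Q \<inter> g ` Q)" "rich (g ` Q - Q)"
    "V m - {y} \<subseteq> Q \<union> g ` Q" using overlapping_translate[OF Q(1,2)] by metis
  have gX: "g \<in> homeos X" using g W_homeos by blast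
  have gQ: "homeos_on X (g ` Q) \<subseteq> words 6"
  proof
    fix p assume "p \<in> homeos_on X (g ` Q)"
    hence "finv g \<circ> p \<circ> finv (finv g) \<in> homeos_on X (finv g ` g ` Q)"
      using homeos_on_conjugate homeos_inv gX by blast
    moreover have "finv g ` g ` Q = Q" using homeos_finv_simps[OF gX] by (auto simp: image_iff)
    moreover have "finv (finv g) = g" using homeos_bij[OF gX] by (rule inv_inv_eq)
    ultimately have "finv g \<circ> p \<circ> g \<in> words 4" using Q(3) by auto
    hence "g \<circ> (finv g \<circ> p \<circ> g) \<circ> finv g \<in> words (1 + 4 + 1)"
      using g(1) words_1 W_inv words_comp by metis
    moreover have "g \<circ> (finv g \<circ> p \<circ> g) \<circ> finv g = p"
      using homeos_finv_simps[OF gX] by (simp add: fun_eq_iff)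
    ultimately show "p \<in> words 6" by (simp del: words.simps)
  qed
  define A B C where "A = Q - g ` Q" and "B = Q \<inter> g ` Q" and "C = g ` Q - Q"
  have AB: "A \<union> B = Q" and BC: "B \<union> C = g ` Q" and ABC: "V m - {y} \<subseteq> A \<union> B \<union> C"
    using g(5) by (auto simp: A_def B_def C_def)
  show ?thesis
  proof (rule that[of m], rule subsetI)
    fix f assume "f \<in> homeos_on X (V m - {y})"
    hence f: "f \<in> homeos_on X (A \<union> B \<union> C)" using homeos_on_mono[OF ABC] by blast
    have disj: "A \<inter> B = {}" "A \<inter> C = {}" "B \<inter> C = {}" by (auto simp: A_def B_def C_def)
    obtain a b b' c where abc: "a \<in> homeos_on X (B \<union> C)" "b \<in> homeos_on X (A \<union> B)" "b' \<in> homeos_on X (A \<union> B)"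
      "c \<in> homeos_on X (B \<union> C)" "f = a \<circ> (b \<circ> (finv b' \<circ> (c \<circ> b')))"
      using factor_over_overlapping_pieces[OF g(2)[folded A_def] g(3)[folded B_def] g(4)[folded C_def] disj f]
      by metis
    have "a \<in> words 6" "b \<in> words 4" "b' \<in> words 4" "c \<in> words 6"
      using abc AB BC gQ Q(3) by auto
    hence "f \<in> words (6 + (4 + (4 + (6 + 4))))"
      unfolding abc(5) by (intro words_comp words_inv)
    thus "f \<in> words 24" by (simp del: words.simps)
  qed
qed

end

section \<open>Continuity at the identity on small supports\<close>
abbreviation clopenin :: "'a topology \<Rightarrow> 'a set \<Rightarrow> bool" where
  "clopenin X C \<equiv> openin X C \<and> closedin X C"

lemma homeos_clopenin_image: "p \<in> homeos X \<Longrightarrow> clopenin X C \<Longrightarrow> clopenin X (p ` C)"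
  using homeos_openin_image homeos_closedin_image by blast

definition part_of :: "'a set \<Rightarrow> ('a \<Rightarrow> 'a) \<Rightarrow> 'a \<Rightarrow> 'a" where
  "part_of Z p z = (if z \<in> Z then p z else z)"

lemma homeos_on_part:
  assumes p: "p \<in> homeos X" and Z: "clopenin X Z" and pZ: "p ` Z = Z"
  shows "part_of Z p \<in> homeos_on X Z"
proof -
  have cont: "continuous_map X X (part_of Z q)" (is "continuous_map X X ?k")
    if q: "continuous_map X X q" "q ` Z = Z" for q
    unfolding continuous_map_def
  proof (intro conjI allI impI)
    have Zs: "Z \<subseteq> topspace X" using Z openin_subset by blast
    show "?k \<in> topspace X \<rightarrow> topspace X" using q(2) Zs by (fastforce simp: part_of_def)
    fix U assume U: "openin X U"
    have "{z \<in> topspace X. ?k z \<in> U} = ({z \<in> topspace X. q z \<in> U} \<inter> Z) \<union> (U - Z)"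
      using Zs openin_subset[OF U] by (auto simp: part_of_def)
    moreover have "openin X {z \<in> topspace X. q z \<in> U}" using openin_continuous_map_preimage[OF q(1) U] .
    ultimately show "openin X {z \<in> topspace X. ?k z \<in> U}"
      using Z U by (simp add: openin_Un openin_Int openin_diff)
  qed
  let ?k = "part_of Z p" and ?l = "part_of Z (finv p)"
  have b: "bij p" using p homeos_bij by blast
  have qZ: "finv p ` Z = Z" using pZ b by (metis bij_is_inj image_inv_f_f)
  have "?l \<circ> ?k = id" "?k \<circ> ?l = id"
    using pZ qZ homeos_finv_simps[OF p] by (auto simp: fun_eq_iff part_of_def)
  moreover from this have "bij ?k" using o_bij by blast
  moreover have "finv ?k = ?l" using calculation by (intro inv_unique_comp)
  moreover have "Z \<subseteq> topspace X" using Z openin_subset by blast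
  ultimately show ?thesis using p cont[OF _ pZ] cont[OF _ qZ]
    unfolding homeos_on_def homeos_def by (auto simp: part_of_def)
qed

locale Homeo_hom =
  fixes X :: "'a topology" and H :: "'h monoid" (structure) and S :: "'h topology" and \<phi>
  assumes compact_X: "compact_space X" and Hausdorff_X: "Hausdorff_space X"
    and top_H: "topological_group H S" and sep: "separable_space S" and hom: "\<phi> \<in> hom (Homeo X) H"
begin

sublocale H: group H using top_H by (simp add: topological_group_def)

lemma topspace_S: "topspace S = carrier H" using top_H by (simp add: topological_group_def)

lemma mult_preimage:
  assumes "openin S U" "a \<in> carrier H" "b \<in> carrier H" "a \<otimes> b \<in> U"
  obtains A B where "openin S A" "openin S B" "a \<in> A" "b \<in> B" "\<And>x y. x \<in> A \<Longrightarrow> y \<in> B \<Longrightarrow> x \<otimes> y \<in> U"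
proof -
  let ?m = "\<lambda>(x, y). x \<otimes> y" and ?P = "prod_topology S S"
  have "continuous_map ?P S ?m" using top_H by (simp add: topological_group_def)
  hence P: "openin ?P {z \<in> topspace ?P. ?m z \<in> U}" using assms(1) by (rule openin_continuous_map_preimage)
  have ab: "(a, b) \<in> {z \<in> topspace ?P. ?m z \<in> U}" using assms by (simp add: topspace_S)
  obtain A B where AB: "openin S A" "openin S B" "a \<in> A" "b \<in> B" "A \<times> B \<subseteq> {z \<in> topspace ?P. ?m z \<in> U}"
    using P[unfolded openin_prod_topology_alt, rule_format, OF ab] by (elim exE conjE)
  show ?thesis
  proof (rule that[OF AB(1-4)])
    fix x y assume "x \<in> A" "y \<in> B"
    hence "(x, y) \<in> {z \<in> topspace ?P. ?m z \<in> U}" using AB(5) by blast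
    thus "x \<otimes> y \<in> U" by simp
  qed
qed

lemma openin_translate:
  assumes "openin S U" "a \<in> carrier H" "b \<in> carrier H"
  shows "openin S {h \<in> carrier H. a \<otimes> h \<otimes> b \<in> U}"
proof -
  have "\<exists>A. openin S A \<and> h \<in> A \<and> A \<subseteq> {h \<in> carrier H. a \<otimes> h \<otimes> b \<in> U}" if h: "h \<in> carrier H" "a \<otimes> h \<otimes> b \<in> U" for h
  proof -
    obtain A B where AB: "openin S A" "a \<otimes> h \<in> A" "b \<in> B" "\<And>x y. x \<in> A \<Longrightarrow> y \<in> B \<Longrightarrow> x \<otimes> y \<in> U"
      using mult_preimage[OF assms(1) _ assms(3) h(2)] assms(2) h(1) by (metis H.m_closed)
    obtain C D where CD: "openin S D" "a \<in> C" "h \<in> D" "\<And>x y. x \<in> C \<Longrightarrow> y \<in> D \<Longrightarrow> x \<otimes> y \<in> A"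
      using mult_preimage[OF AB(1) assms(2) h(1) AB(2)] by metis
    have "D \<subseteq> carrier H" using openin_subset[OF CD(1)] topspace_S by simp
    thus ?thesis using AB CD by (intro exI[of _ D]) auto
  qed
  thus ?thesis by (subst openin_subopen) blast
qed

definition nbhd1 :: "'h set \<Rightarrow> bool" where "nbhd1 U \<longleftrightarrow> openin S U \<and> \<one> \<in> U"

lemma nbhd1_Int: "nbhd1 A \<Longrightarrow> nbhd1 B \<Longrightarrow> nbhd1 (A \<inter> B)"
  by (auto simp: nbhd1_def)

lemma nbhd1_mult:
  assumes "nbhd1 U" obtains N where "nbhd1 N" "\<And>x y. x \<in> N \<Longrightarrow> y \<in> N \<Longrightarrow> x \<otimes> y \<in> U"
proof -
  obtain A B where AB: "openin S A" "openin S B" "\<one> \<in> A" "\<one> \<in> B" "\<And>x y. x \<in> A \<Longrightarrow> y \<in> B \<Longrightarrow> x \<otimes> y \<in> U"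
    using mult_preimage[of U \<one> \<one>] assms by (auto simp: nbhd1_def)
  show ?thesis by (rule that[of "A \<inter> B"]) (use AB in \<open>auto simp: nbhd1_def\<close>)
qed

lemma nbhd1_symmetric:
  assumes "nbhd1 U" obtains N where "nbhd1 N" "N \<subseteq> U" "\<And>x. x \<in> N \<Longrightarrow> inv x \<in> N"
proof -
  let ?N = "U \<inter> {x \<in> carrier H. inv x \<in> U}"
  have "continuous_map S S (\<lambda>x. inv x)" using top_H by (simp add: topological_group_def)
  hence "openin S {x \<in> topspace S. inv x \<in> U}"
    using assms unfolding nbhd1_def by (intro openin_continuous_map_preimage) auto
  hence "nbhd1 ?N" using assms topspace_S by (auto simp: nbhd1_def)
  moreover have "inv x \<in> ?N" if "x \<in> ?N" for x using that by auto
  ultimately show ?thesis using that[of ?N] by blast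
qed

primrec powers :: "'h set \<Rightarrow> nat \<Rightarrow> 'h set" where
  "powers N 0 = {\<one>}"
| "powers N (Suc k) = {a \<otimes> b | a b. a \<in> N \<and> b \<in> powers N k}"

lemma powers_mono: "N \<subseteq> M \<Longrightarrow> powers N k \<subseteq> powers M k"
  by (induction k) auto

lemma nbhd1_powers: "nbhd1 U \<Longrightarrow> \<exists>N. nbhd1 N \<and> powers N k \<subseteq> U"
proof (induction k arbitrary: U)
  case 0
  thus ?case by (auto simp: nbhd1_def)
next
  case (Suc k)
  obtain M where M: "nbhd1 M" "\<And>x y. x \<in> M \<Longrightarrow> y \<in> M \<Longrightarrow> x \<otimes> y \<in> U" using nbhd1_mult[OF Suc.prems] by blast
  obtain N where N: "nbhd1 N" "powers N k \<subseteq> M" using Suc.IH[OF M(1)] by blast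
  have "powers (M \<inter> N) k \<subseteq> M" using powers_mono[of "M \<inter> N" N k] N by blast
  hence "powers (M \<inter> N) (Suc k) \<subseteq> U" using M(2) by auto
  thus ?case using nbhd1_Int M N by blast
qed

text \<open>
  The homomorphism \<open>\<phi>\<close>, transported to homeomorphisms in the form of permutations of the type.
\<close>
definition \<psi> :: "('a \<Rightarrow> 'a) \<Rightarrow> 'h" where "\<psi> p = \<phi> (restr X p)"

lemma \<psi>_carrier: "p \<in> homeos X \<Longrightarrow> \<psi> p \<in> carrier H"
  unfolding \<psi>_def by (rule hom_in_carrier[OF hom restr_in_Homeo])

lemma \<psi>_comp:
  assumes "p \<in> homeos X" "q \<in> homeos X" shows "\<psi> (p \<circ> q) = \<psi> p \<otimes> \<psi> q"
  using hom_mult[OF hom restr_in_Homeo[OF assms(1)] restr_in_Homeo[OF assms(2)]]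
  unfolding Homeo_mult[OF assms] \<psi>_def .

lemma \<psi>_id: "\<psi> id = \<one>"
proof -
  have "\<psi> id \<otimes> \<psi> id = \<psi> id" using \<psi>_comp[OF homeos_id homeos_id] by simp
  thus ?thesis using \<psi>_carrier[OF homeos_id] by simp
qed

lemma \<psi>_finv:
  assumes "p \<in> homeos X" shows "\<psi> (finv p) = inv \<psi> p"
proof -
  have "\<psi> (finv p) \<otimes> \<psi> p = \<one>"
    using \<psi>_comp[OF homeos_inv[OF assms] assms] homeos_finv_simps(3)[OF assms] \<psi>_id by simp
  thus ?thesis
    using H.inv_equality[OF _ \<psi>_carrier[OF assms] \<psi>_carrier[OF homeos_inv[OF assms]]] by simp
qed

text \<open>
  Continuity at the identity of \<open>\<psi>\<close> on the homeomorphisms supported in \<open>Z\<close>.  Preserving finitely many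
  clopen sets is an open condition in the compact-open topology.
\<close>
definition tame :: "'a set \<Rightarrow> bool" where
  "tame Z \<longleftrightarrow> (\<forall>U. nbhd1 U \<longrightarrow> (\<exists>\<C>. finite \<C> \<and> (\<forall>C\<in>\<C>. clopenin X C) \<and>
     (\<forall>p\<in>homeos_on X Z. (\<forall>C\<in>\<C>. p ` C = C) \<longrightarrow> \<psi> p \<in> U)))"

lemma tameE:
  assumes "tame Z" "nbhd1 U"
  obtains \<C> where "finite \<C>" "\<And>C. C \<in> \<C> \<Longrightarrow> clopenin X C"
    "\<And>p. \<lbrakk>p \<in> homeos_on X Z; \<And>C. C \<in> \<C> \<Longrightarrow> p ` C = C\<rbrakk> \<Longrightarrow> \<psi> p \<in> U"
proof -
  obtain \<C> where "finite \<C>" "\<forall>C\<in>\<C>. clopenin X C" "\<forall>p\<in>homeos_on X Z. (\<forall>C\<in>\<C>. p ` C = C) \<longrightarrow> \<psi> p \<in> U"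
    using assms(1)[unfolded tame_def, rule_format, OF assms(2)] by (elim exE conjE)
  thus ?thesis by (intro that[of \<C>]) simp_all
qed

lemma tame_mono: "tame Z \<Longrightarrow> Y \<subseteq> Z \<Longrightarrow> tame Y"
  unfolding tame_def
proof (intro allI impI)
  fix U assume Z: "\<forall>U. nbhd1 U \<longrightarrow> (\<exists>\<C>. finite \<C> \<and> (\<forall>C\<in>\<C>. clopenin X C) \<and>
    (\<forall>p\<in>homeos_on X Z. (\<forall>C\<in>\<C>. p ` C = C) \<longrightarrow> \<psi> p \<in> U))" and YZ: "Y \<subseteq> Z" and "nbhd1 U"
  then obtain \<C> where C: "finite \<C>" "\<forall>C\<in>\<C>. clopenin X C" "\<forall>p\<in>homeos_on X Z. (\<forall>C\<in>\<C>. p ` C = C) \<longrightarrow> \<psi> p \<in> U"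
    by (elim allE impE exE conjE)
  thus "\<exists>\<C>. finite \<C> \<and> (\<forall>C\<in>\<C>. clopenin X C) \<and> (\<forall>p\<in>homeos_on X Y. (\<forall>C\<in>\<C>. p ` C = C) \<longrightarrow> \<psi> p \<in> U)"
    using subsetD[OF homeos_on_mono[OF YZ]] by (intro exI[of _ \<C>]) simp
qed

lemma tame_empty: "tame {}"
  unfolding tame_def
proof (intro allI impI)
  fix U assume U: "nbhd1 U"
  have "p = id" if "p \<in> homeos_on X {}" for p using that by (auto simp: homeos_on_def)
  thus "\<exists>\<C>. finite \<C> \<and> (\<forall>C\<in>\<C>. clopenin X C) \<and> (\<forall>p\<in>homeos_on X {}. (\<forall>C\<in>\<C>. p ` C = C) \<longrightarrow> \<psi> p \<in> U)"
    using U \<psi>_id unfolding nbhd1_def by (intro exI[of _ "{}"]) (metis finite.emptyI empty_iff)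
qed

lemma part_preserves:
  assumes "p ` (C \<inter> Z) = C \<inter> Z" shows "part_of Z p ` C = C"
proof -
  have "part_of Z p ` C = p ` (C \<inter> Z) \<union> (C - Z)" by (auto simp: part_of_def)
  thus ?thesis using assms by blast
qed

lemma tame_Un_disjoint:
  assumes Y: "tame Y" "clopenin X Y" and Z: "tame Z" "clopenin X Z" and YZ: "Y \<inter> Z = {}"
  shows "tame (Y \<union> Z)"
  unfolding tame_def
proof (intro allI impI)
  fix U assume "nbhd1 U"
  then obtain N where N: "nbhd1 N" "\<And>x y. x \<in> N \<Longrightarrow> y \<in> N \<Longrightarrow> x \<otimes> y \<in> U" using nbhd1_mult by blast
  obtain \<A> where A: "finite \<A>" "\<And>C. C \<in> \<A> \<Longrightarrow> clopenin X C"
    "\<And>p. \<lbrakk>p \<in> homeos_on X Y; \<And>C. C \<in> \<A> \<Longrightarrow> p ` C = C\<rbrakk> \<Longrightarrow> \<psi> p \<in> N"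
    by (rule tameE[OF Y(1) N(1)]) blast
  obtain \<B> where B: "finite \<B>" "\<And>C. C \<in> \<B> \<Longrightarrow> clopenin X C"
    "\<And>p. \<lbrakk>p \<in> homeos_on X Z; \<And>C. C \<in> \<B> \<Longrightarrow> p ` C = C\<rbrakk> \<Longrightarrow> \<psi> p \<in> N"
    by (rule tameE[OF Z(1) N(1)]) blast
  define \<C> where "\<C> = {Y, Z} \<union> (\<lambda>C. C \<inter> Y) ` \<A> \<union> (\<lambda>C. C \<inter> Z) ` \<B>"
  have "finite \<C>" using A B by (simp add: \<C>_def)
  moreover have "\<forall>C\<in>\<C>. clopenin X C" using A B Y Z by (auto simp: \<C>_def openin_Int closedin_Int)
  moreover have "\<psi> p \<in> U" if p: "p \<in> homeos_on X (Y \<union> Z)" and C: "\<forall>C\<in>\<C>. p ` C = C" for p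
  proof -
    have pX: "p \<in> homeos X" using p homeos_on_subset by blast
    let ?q = "part_of Y p" and ?r = "part_of Z p"
    have pY: "p ` Y = Y" and pZ: "p ` Z = Z" using C by (auto simp: \<C>_def)
    have q: "?q \<in> homeos_on X Y" using homeos_on_part[OF pX Y(2) pY] .
    have r: "?r \<in> homeos_on X Z" using homeos_on_part[OF pX Z(2) pZ] .
    have "?q ` C = C" if "C \<in> \<A>" for C by (rule part_preserves) (use C that in \<open>auto simp: \<C>_def\<close>)
    hence 1: "\<psi> ?q \<in> N" using A(3)[OF q] by blast
    have "?r ` C = C" if "C \<in> \<B>" for C by (rule part_preserves) (use C that in \<open>auto simp: \<C>_def\<close>)
    hence 2: "\<psi> ?r \<in> N" using B(3)[OF r] by blast
    have "p = ?q \<circ> ?r"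
    proof
      fix z
      consider "z \<in> Y" | "z \<in> Z" | "z \<notin> Y" "z \<notin> Z" by blast
      thus "p z = (?q \<circ> ?r) z"
        using YZ pZ homeos_onD[OF p, of z] by cases (auto simp: part_of_def)
    qed
    moreover have "\<psi> (?q \<circ> ?r) = \<psi> ?q \<otimes> \<psi> ?r"
      by (rule \<psi>_comp) (use q r homeos_on_subset in blast)+
    ultimately show ?thesis using N(2)[OF 1 2] by simp
  qed
  ultimately show "\<exists>\<C>. finite \<C> \<and> (\<forall>C\<in>\<C>. clopenin X C) \<and>
    (\<forall>p\<in>homeos_on X (Y \<union> Z). (\<forall>C\<in>\<C>. p ` C = C) \<longrightarrow> \<psi> p \<in> U)"
    by (intro exI[of _ "\<C>"] conjI) simp_all
qed

lemma tame_Un: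
  assumes "tame Y" "clopenin X Y" "tame Z" "clopenin X Z" shows "tame (Y \<union> Z)"
proof -
  have "tame (Y \<union> (Z - Y))"
    using assms tame_mono[of Z "Z - Y"]
    by (intro tame_Un_disjoint) (simp_all add: openin_diff closedin_diff)
  thus ?thesis by simp
qed

lemma tame_Union:
  assumes "finite \<Z>" "\<And>Z. Z \<in> \<Z> \<Longrightarrow> tame Z \<and> clopenin X Z" shows "tame (\<Union>\<Z>) \<and> clopenin X (\<Union>\<Z>)"
  using assms
proof (induction \<Z> rule: finite_induct)
  case (insert Z \<Z>)
  have 1: "tame (\<Union>\<Z>) \<and> clopenin X (\<Union>\<Z>)" by (rule insert.IH) (rule insert.prems, simp)
  have 2: "tame Z \<and> clopenin X Z" by (rule insert.prems) simp
  have "tame (Z \<union> \<Union>\<Z>)" using tame_Un 1 2 by metis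
  thus ?case using 1 2 by (simp add: openin_Un closedin_Un)
qed (simp add: tame_empty)

lemma tame_compact:
  assumes K: "closedin X K" and cov: "\<And>z. z \<in> K \<Longrightarrow> \<exists>Z. z \<in> Z \<and> tame Z \<and> clopenin X Z"
  shows "tame K"
proof -
  let ?T = "{Z. tame Z \<and> clopenin X Z}"
  have KT: "K \<subseteq> \<Union>?T" using cov by auto
  have "\<exists>\<Z>. finite \<Z> \<and> \<Z> \<subseteq> ?T \<and> K \<subseteq> \<Union>\<Z>"
    by (rule compactinD[OF closedin_compact_space[OF compact_X K] _ KT]) simp
  then obtain \<Z> where Z: "finite \<Z>" "\<Z> \<subseteq> ?T" "K \<subseteq> \<Union>\<Z>" by (elim exE conjE)
  have "tame (\<Union>\<Z>) \<and> clopenin X (\<Union>\<Z>)" by (rule tame_Union[OF Z(1)]) (use Z(2) in auto)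
  thus ?thesis using tame_mono[of "\<Union>\<Z>" K] Z(3) by simp
qed

text \<open>
  Conjugation by \<open>q\<close> carries one group of supported homeomorphisms to the other, and conjugation by \<open>\<psi> q\<close> is
  continuous.
\<close>
lemma tame_image:
  assumes Z: "tame Z" and q: "q \<in> homeos X" shows "tame (q ` Z)"
  unfolding tame_def
proof (intro allI impI)
  fix U assume U: "nbhd1 U"
  have c: "\<psi> q \<in> carrier H" using q \<psi>_carrier by blast
  let ?N = "{h \<in> carrier H. \<psi> q \<otimes> h \<otimes> inv \<psi> q \<in> U}"
  have nN: "nbhd1 ?N" using openin_translate[of U "\<psi> q" "inv \<psi> q"] U c by (simp add: nbhd1_def)
  obtain \<A> where A: "finite \<A>" "\<And>C. C \<in> \<A> \<Longrightarrow> clopenin X C"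
    "\<And>p. \<lbrakk>p \<in> homeos_on X Z; \<And>C. C \<in> \<A> \<Longrightarrow> p ` C = C\<rbrakk> \<Longrightarrow> \<psi> p \<in> ?N"
    by (rule tameE[OF Z nN]) blast
  have "\<psi> p \<in> U" if p: "p \<in> homeos_on X (q ` Z)" and C: "\<forall>C\<in>\<A>. p ` q ` C = q ` C" for p
  proof -
    define r where "r = finv q \<circ> p \<circ> q"
    have b: "bij q" using q homeos_bij by blast
    have pX: "p \<in> homeos X" using p homeos_on_subset by blast
    have "finv q \<circ> p \<circ> finv (finv q) \<in> homeos_on X (finv q ` q ` Z)"
      using homeos_on_conjugate[OF p homeos_inv[OF q]] .
    hence r: "r \<in> homeos_on X Z" using b by (simp add: r_def inv_inv_eq bij_is_inj)
    have "r ` C = C" if "C \<in> \<A>" for C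
    proof -
      have "r ` C = finv q ` p ` q ` C" unfolding r_def image_comp comp_assoc ..
      also have "\<dots> = finv q ` q ` C" using C that by simp
      also have "\<dots> = C" using image_inv_f_f[OF bij_is_inj[OF b]] .
      finally show ?thesis .
    qed
    hence "\<psi> q \<otimes> \<psi> r \<otimes> inv \<psi> q \<in> U" using A(3)[OF r] by simp
    moreover have "q \<circ> r \<circ> finv q = p" using homeos_finv_simps[OF q] by (simp add: r_def fun_eq_iff)
    moreover have "\<psi> (q \<circ> r \<circ> finv q) = \<psi> q \<otimes> \<psi> r \<otimes> inv \<psi> q"
    proof -
      have rX: "r \<in> homeos X" using r homeos_on_subset by blast
      show ?thesis
        unfolding \<psi>_comp[OF homeos_comp[OF q rX] homeos_inv[OF q]] \<psi>_comp[OF q rX] \<psi>_finv[OF q] ..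
    qed
    ultimately show ?thesis by simp
  qed
  moreover have "\<forall>C\<in>(`) q ` \<A>. clopenin X C" using homeos_clopenin_image[OF q A(2)] by simp
  ultimately show "\<exists>\<C>. finite \<C> \<and> (\<forall>C\<in>\<C>. clopenin X C) \<and>
    (\<forall>p\<in>homeos_on X (q ` Z). (\<forall>C\<in>\<C>. p ` C = C) \<longrightarrow> \<psi> p \<in> U)"
    using A(1) by (intro exI[of _ "(`) q ` \<A>"] conjI) simp_all
qed

text \<open>
  Colour \<open>p\<close> by an element \<open>d\<close> of a countable dense set such that \<open>\<psi> p\<close> lies in the translate by
  \<open>d\<close> of a small neighbourhood of the identity.
\<close>
lemma colouring_exists:
  assumes "nbhd1 U"
  shows "\<exists>colour :: ('a \<Rightarrow> 'a) \<Rightarrow> nat. \<forall>p\<in>homeos X. \<forall>q\<in>homeos X.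
    colour p = colour q \<longrightarrow> \<psi> (finv p \<circ> q) \<in> U"
proof -
  obtain A where A: "nbhd1 A" "\<And>x y. x \<in> A \<Longrightarrow> y \<in> A \<Longrightarrow> x \<otimes> y \<in> U" using nbhd1_mult[OF assms] by blast
  obtain N where N: "nbhd1 N" "N \<subseteq> A" "\<And>x. x \<in> N \<Longrightarrow> inv x \<in> N" using nbhd1_symmetric[OF A(1)] by blast
  obtain D where D: "countable D" "D \<subseteq> topspace S" "\<And>B. openin S B \<Longrightarrow> B \<noteq> {} \<Longrightarrow> D \<inter> B \<noteq> {}"
    using sep unfolding separable_space_def dense_intersects_open by blast
  have "\<exists>d\<in>D. inv d \<otimes> \<psi> p \<in> N" if p: "p \<in> homeos X" for p
  proof -
    have c: "\<psi> p \<in> carrier H" using p \<psi>_carrier by blast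
    let ?B = "{h \<in> carrier H. inv \<psi> p \<otimes> h \<otimes> \<one> \<in> N}"
    have "openin S ?B" using openin_translate[of N "inv \<psi> p" \<one>] N c by (simp add: nbhd1_def)
    moreover have "\<psi> p \<in> ?B" using c N by (simp add: nbhd1_def)
    ultimately obtain d where d: "d \<in> D" "d \<in> ?B" using D(3)[of ?B] by blast
    hence dc: "d \<in> carrier H" and "inv \<psi> p \<otimes> d \<otimes> \<one> \<in> N" by auto
    hence "inv \<psi> p \<otimes> d \<in> N" using c by simp
    hence "inv (inv \<psi> p \<otimes> d) \<in> N" by (rule N(3))
    hence "inv d \<otimes> \<psi> p \<in> N" using dc c by (simp add: H.inv_mult_group)
    thus ?thesis using d(1) by blast
  qed
  then obtain d where d: "\<And>p. p \<in> homeos X \<Longrightarrow> d p \<in> D \<and> inv (d p) \<otimes> \<psi> p \<in> N" by metis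
  show ?thesis
  proof (intro exI[of _ "\<lambda>p. to_nat_on D (d p)"] ballI impI)
    fix p q assume pq: "p \<in> homeos X" "q \<in> homeos X" "to_nat_on D (d p) = to_nat_on D (d q)"
    hence eq: "d p = d q" using d D(1) by (metis to_nat_on_inj)
    have c: "\<psi> p \<in> carrier H" "\<psi> q \<in> carrier H" "d p \<in> carrier H"
      using pq \<psi>_carrier d D(2) topspace_S by auto
    have "inv (d p) \<otimes> \<psi> p \<in> N" "inv (d p) \<otimes> \<psi> q \<in> N"
      using d[OF pq(1)] d[OF pq(2)] eq by simp_all
    hence "inv (inv (d p) \<otimes> \<psi> p) \<in> A" "inv (d p) \<otimes> \<psi> q \<in> A" using N(2,3) by blast+
    hence "inv (inv (d p) \<otimes> \<psi> p) \<otimes> (inv (d p) \<otimes> \<psi> q) \<in> U" by (rule A(2))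
    moreover have "inv (inv (d p) \<otimes> \<psi> p) \<otimes> (inv (d p) \<otimes> \<psi> q) = inv \<psi> p \<otimes> \<psi> q"
    proof -
      have "inv (inv (d p) \<otimes> \<psi> p) \<otimes> (inv (d p) \<otimes> \<psi> q) = inv \<psi> p \<otimes> (d p \<otimes> (inv (d p) \<otimes> \<psi> q))"
        using c by (simp add: H.inv_mult_group H.m_assoc)
      also have "d p \<otimes> (inv (d p) \<otimes> \<psi> q) = \<psi> q" using c by (simp add: H.m_assoc[symmetric])
      finally show ?thesis .
    qed
    ultimately show "\<psi> (finv p \<circ> q) \<in> U" 
      unfolding \<psi>_comp[OF homeos_inv[OF pq(1)] pq(2)] \<psi>_finv[OF pq(1)] by (simp only:)
  qed
qed

text \<open>
  A homeomorphism that preserves a small neighbourhood \<open>V m\<close> splits into a part on \<open>V m\<close>, which is a word of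
  length 24 in \<open>W\<close>, and a part on the compact set \<open>V 0 - V m\<close>, which is covered by tame sets.
\<close>
lemma tame_at_rich_point:
  assumes base: "clopen_base X y V" and rich: "clopen_base.rich X y V (clopen_base.E y V)"
    and fix_y: "\<And>p. p \<in> homeos_on X (V 0) \<Longrightarrow> p y = y"
    and cov: "\<And>z. z \<in> V 0 - {y} \<Longrightarrow> \<exists>Z. z \<in> Z \<and> tame Z \<and> clopenin X Z"
  shows "tame (V 0)"
  unfolding tame_def
proof (intro allI impI)
  fix U assume U: "nbhd1 U"
  interpret clopen_base X y V by (rule base)
  obtain M where M: "nbhd1 M" "\<And>x y. x \<in> M \<Longrightarrow> y \<in> M \<Longrightarrow> x \<otimes> y \<in> U" using nbhd1_mult[OF U] by blast
  obtain N' where N': "nbhd1 N'" "powers N' 24 \<subseteq> M" using nbhd1_powers[OF M(1)] by blast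
  obtain N where N: "nbhd1 N" "N \<subseteq> N'" "\<And>x. x \<in> N \<Longrightarrow> inv x \<in> N" using nbhd1_symmetric[OF N'(1)] by blast
  have N24: "powers N 24 \<subseteq> M" using powers_mono[OF N(2), of 24] N'(2) by (rule subset_trans)
  obtain colour :: "('a \<Rightarrow> 'a) \<Rightarrow> nat" where
    "\<forall>p\<in>homeos X. \<forall>q\<in>homeos X. colour p = colour q \<longrightarrow> \<psi> (finv p \<circ> q) \<in> N"
    using colouring_exists[OF N(1)] by (elim exE)
  hence colour: "\<psi> (finv p \<circ> q) \<in> N" if "p \<in> homeos X" "q \<in> homeos X" "colour p = colour q" for p q
    using that by blast
  define W where "W = {p \<in> homeos X. \<psi> p \<in> N}"
  interpret coloured_homeos X y V colour W
  proof
    show "W \<subseteq> homeos X" by (auto simp: W_def)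
    show "finv w \<in> W" if w: "w \<in> W" for w
    proof -
      have "w \<in> homeos X" "\<psi> w \<in> N" using w by (auto simp: W_def)
      thus ?thesis using N(3) homeos_inv \<psi>_finv by (simp add: W_def)
    qed
    show "finv p \<circ> q \<in> W" if "p \<in> homeos X" "q \<in> homeos X" "colour p = colour q" for p q
      unfolding W_def using colour[OF that] homeos_comp[OF homeos_inv[OF that(1)] that(2)] by blast
    show "rich E" by (rule rich)
  qed
  have words_powers: "w \<in> words k \<Longrightarrow> \<psi> w \<in> powers N k" for w k
  proof (induction k arbitrary: w)
    case 0
    hence "w = id" unfolding words.simps by blast
    thus ?case unfolding powers.simps using \<psi>_id by blast
  next
    case (Suc k)
    then obtain a b where ab: "w = a \<circ> b" "a \<in> W" "b \<in> words k" unfolding words.simps by blast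
    hence "a \<in> homeos X" "b \<in> homeos X" using W_homeos words_homeos by blast+
    hence "\<psi> w = \<psi> a \<otimes> \<psi> b" unfolding ab(1) by (rule \<psi>_comp)
    moreover have "\<psi> a \<in> N" "\<psi> b \<in> powers N k" using ab Suc.IH by (auto simp: W_def)
    ultimately show ?case unfolding powers.simps by blast
  qed
  obtain m where m: "homeos_on X (V m - {y}) \<subseteq> words 24" using words_contain_small_support by blast
  have Vm: "clopenin X (V m)" using openin_V closedin_V by blast
  define Z where "Z = V 0 - V m"
  have Z: "clopenin X Z" unfolding Z_def using openin_V closedin_V by (simp add: openin_diff closedin_diff)
  have tZ: "tame Z" by (rule tame_compact) (use Z cov point_in_V Z_def in blast)+
  obtain \<A> where A: "finite \<A>" "\<And>C. C \<in> \<A> \<Longrightarrow> clopenin X C"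
    "\<And>p. \<lbrakk>p \<in> homeos_on X Z; \<And>C. C \<in> \<A> \<Longrightarrow> p ` C = C\<rbrakk> \<Longrightarrow> \<psi> p \<in> M"
    by (rule tameE[OF tZ M(1)]) blast
  define \<C> where "\<C> = {V m, Z} \<union> (\<lambda>C. C \<inter> Z) ` \<A>"
  have "finite \<C>" using A by (simp add: \<C>_def)
  moreover have "\<forall>C\<in>\<C>. clopenin X C" using A Vm Z by (auto simp: \<C>_def openin_Int closedin_Int)
  moreover have "\<psi> p \<in> U" if p: "p \<in> homeos_on X (V 0)" and C: "\<forall>C\<in>\<C>. p ` C = C" for p
  proof -
    have pX: "p \<in> homeos X" using p homeos_on_subset by blast
    let ?q = "part_of (V m) p" and ?r = "part_of Z p"
    have pV: "p ` V m = V m" and pZ: "p ` Z = Z" using C by (auto simp: \<C>_def)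
    have q: "?q \<in> homeos_on X (V m)" using homeos_on_part[OF pX Vm pV] .
    have r: "?r \<in> homeos_on X Z" using homeos_on_part[OF pX Z pZ] .
    have "?q \<in> homeos_on X (V m - {y})"
      using q fix_y[OF p] unfolding homeos_on_def by (auto simp: part_of_def)
    hence "?q \<in> words 24" using m by blast
    hence 1: "\<psi> ?q \<in> M" using words_powers N24 by blast
    have "?r ` C = C" if "C \<in> \<A>" for C by (rule part_preserves) (use C that in \<open>auto simp: \<C>_def\<close>)
    hence 2: "\<psi> ?r \<in> M" using A(3)[OF r] by blast
    have "p = ?q \<circ> ?r"
    proof
      fix z
      consider "z \<in> V m" | "z \<in> Z" | "z \<notin> V 0" using Z_def by blast
      thus "p z = (?q \<circ> ?r) z"
      proof cases
        case 3
        thus ?thesis using homeos_onD[OF p 3] by (auto simp: part_of_def)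
      next
        case 2
        hence "p z \<notin> V m" using pZ Z_def by blast
        thus ?thesis using 2 by (simp add: part_of_def)
      qed (auto simp: Z_def part_of_def)
    qed
    moreover have "\<psi> (?q \<circ> ?r) = \<psi> ?q \<otimes> \<psi> ?r"
      by (rule \<psi>_comp) (use q r homeos_on_subset in blast)+
    ultimately show ?thesis using M(2)[OF 1 2] by simp
  qed
  ultimately show "\<exists>\<C>. finite \<C> \<and> (\<forall>C\<in>\<C>. clopenin X C) \<and>
    (\<forall>p\<in>homeos_on X (V 0). (\<forall>C\<in>\<C>. p ` C = C) \<longrightarrow> \<psi> p \<in> U)"
    by (intro exI[of _ "\<C>"] conjI) simp_all
qed

text \<open>
  The set \<open>F\<close> of points without a tame clopen neighbourhood is invariant under homeomorphisms.  At a
  point \<open>y\<close> that is isolated in \<open>F\<close>, homeomorphisms supported close to \<open>y\<close> must therefore fix \<open>y\<close>.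
\<close>
lemma tame_topspace:
  assumes local: "\<And>F. \<lbrakk>closedin X F; F \<noteq> {}\<rbrakk> \<Longrightarrow> \<exists>y\<in>F. \<exists>V. clopen_base X y V \<and>
    clopen_base.rich X y V (clopen_base.E y V) \<and> V 0 \<inter> F = {y}"
  shows "tame (topspace X)"
proof (rule tame_compact)
  fix z assume z: "z \<in> topspace X"
  define F where "F = topspace X - \<Union>{Z. tame Z \<and> clopenin X Z}"
  have "F = {}"
  proof (rule ccontr)
    assume "F \<noteq> {}"
    moreover have "closedin X F" unfolding F_def by (intro closedin_diff openin_Union) auto
    ultimately obtain y V where y: "y \<in> F" "clopen_base X y V"
      "clopen_base.rich X y V (clopen_base.E y V)" "V 0 \<inter> F = {y}" using local by metis
    interpret clopen_base X y V by (rule y(2))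
    have "tame (V 0)"
    proof (rule tame_at_rich_point[OF y(2,3)])
      fix z assume "z \<in> V 0 - {y}"
      hence "z \<in> topspace X" "z \<notin> F" using V_topspace y(4) by auto
      thus "\<exists>Z. z \<in> Z \<and> tame Z \<and> clopenin X Z" unfolding F_def by blast
    next
      fix p assume p: "p \<in> homeos_on X (V 0)"
      have pX: "p \<in> homeos X" using p homeos_on_subset by blast
      have "p y \<in> V 0" using homeos_on_image[OF p order_refl] point_in_V by blast
      moreover have "p y \<in> F"
      proof (rule ccontr)
        assume "p y \<notin> F"
        moreover have "p y \<in> topspace X" using \<open>p y \<in> V 0\<close> V_topspace by blast
        ultimately obtain Z where Z: "p y \<in> Z" "tame Z" "clopenin X Z" unfolding F_def by blast
        have "y \<in> finv p ` Z" using Z(1) homeos_finv_simps(1)[OF pX, of y] by (metis image_eqI)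
        moreover have "tame (finv p ` Z)" "clopenin X (finv p ` Z)"
          using tame_image[OF Z(2)] homeos_clopenin_image Z(3) homeos_inv[OF pX] by blast+
        ultimately show False using y(1) unfolding F_def by blast
      qed
      ultimately show "p y = y" using y(4) by blast
    qed
    hence "y \<notin> F" unfolding F_def using openin_V closedin_V point_in_V by blast
    thus False using y(1) by blast
  qed
  thus "\<exists>Z. z \<in> Z \<and> tame Z \<and> clopenin X Z" using z unfolding F_def by blast
qed simp

text \<open>
  Near \<open>f = restr X p\<close> the maps \<open>g\<close> with \<open>g C = f C\<close> for the relevant clopen sets \<open>C\<close> form an open
  set: the equality says that \<open>g\<close> maps \<open>C\<close> into \<open>f C\<close> and the complement of \<open>C\<close> into that of \<open>f C\<close>.
\<close>
lemma continuous_if_tame: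
  assumes t: "tame (topspace X)"
  shows "continuous_map (Homeo_topology X) S \<phi>"
  unfolding continuous_map_def topspace_Homeo_topology topspace_S
proof (intro conjI allI impI)
  show "\<phi> \<in> carrier (Homeo X) \<rightarrow> carrier H" using hom by (simp add: hom_def)
  fix U assume U: "openin S U"
  let ?P = "{f \<in> carrier (Homeo X). \<phi> f \<in> U}" and ?S = "topspace X"
  have "\<exists>N. openin (Homeo_topology X) N \<and> f \<in> N \<and> N \<subseteq> ?P" if f: "f \<in> ?P" for f
  proof -
    obtain p where p: "p \<in> homeos X" "f = restr X p" using f Homeo_carrier_restr by blast
    have c: "\<psi> p \<in> carrier H" and pU: "\<psi> p \<in> U" using p f \<psi>_carrier by (auto simp: \<psi>_def)
    have nN: "nbhd1 {h \<in> carrier H. \<psi> p \<otimes> h \<otimes> \<one> \<in> U}"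
      using openin_translate[OF U c, of \<one>] c pU by (simp add: nbhd1_def)
    obtain \<C> where C: "finite \<C>" "\<And>C. C \<in> \<C> \<Longrightarrow> clopenin X C"
      "\<And>q. \<lbrakk>q \<in> homeos_on X ?S; \<And>C. C \<in> \<C> \<Longrightarrow> q ` C = C\<rbrakk> \<Longrightarrow> \<psi> q \<in> {h \<in> carrier H. \<psi> p \<otimes> h \<otimes> \<one> \<in> U}"
      by (rule tameE[OF t nN]) blast
    define B where "B K = {g \<in> carrier (Homeo X). g ` K \<subseteq> p ` K}" for K
    define \<D> where "\<D> = insert ?S (\<C> \<union> (\<lambda>C. ?S - C) ` \<C>)"
    have D: "finite \<D>" "\<D> \<noteq> {}" "\<And>K. K \<in> \<D> \<Longrightarrow> clopenin X K"
      using C by (auto simp: \<D>_def openin_diff closedin_diff)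
    have B: "openin (Homeo_topology X) (B K)" if "K \<in> \<D>" for K
      unfolding B_def
      by (rule openin_Homeo_topology)
        (use D(3)[OF that] compact_X homeos_openin_image[OF p(1)] closedin_compact_space in blast)+
    have "openin (Homeo_topology X) (\<Inter>K\<in>\<D>. B K)" using D B by (intro openin_INT2) auto
    moreover have "f \<in> (\<Inter>K\<in>\<D>. B K)"
    proof -
      have "f ` K = p ` K" if "K \<in> \<D>" for K
        unfolding p(2) by (rule restr_image[OF openin_subset[OF conjunct1[OF D(3)[OF that]]]])
      thus ?thesis using f by (simp add: B_def)
    qed
    moreover have "(\<Inter>K\<in>\<D>. B K) \<subseteq> ?P"
    proof
      fix g assume g: "g \<in> (\<Inter>K\<in>\<D>. B K)"
      hence gc: "g \<in> carrier (Homeo X)" by (simp add: \<D>_def B_def)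
      obtain q where q: "q \<in> homeos X" "g = restr X q" using Homeo_carrier_restr[OF gc] .
      define r where "r = finv p \<circ> q"
      have r: "r \<in> homeos X" unfolding r_def using p q homeos_inv homeos_comp by blast
      hence rS: "r \<in> homeos_on X ?S" by (simp add: homeos_on_def homeos_def)
      have "r ` C = C" if "C \<in> \<C>" for C
      proof -
        have sub: "q ` K \<subseteq> p ` K" if "K \<in> \<D>" for K
        proof -
          have "g ` K = q ` K" 
            unfolding q(2) by (rule restr_image[OF openin_subset[OF conjunct1[OF D(3)[OF that]]]])
          moreover have "g ` K \<subseteq> p ` K" using g that unfolding B_def by blast
          ultimately show ?thesis by simp
        qed
        have CS: "C \<subseteq> ?S" using C(2) that openin_subset by blast
        have inj: "inj p" "inj q" using p q homeos_bij bij_is_inj by blast+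
        have "q ` C \<subseteq> p ` C" "q ` (?S - C) \<subseteq> p ` (?S - C)" using sub that by (auto simp: \<D>_def)
        moreover have "q ` (?S - C) = ?S - q ` C" "p ` (?S - C) = ?S - p ` C"
          unfolding image_set_diff[OF inj(1)] image_set_diff[OF inj(2)]
            homeos_image_topspace[OF p(1)] homeos_image_topspace[OF q(1)] by (rule refl)+
        ultimately have sub': "q ` C \<subseteq> p ` C" "?S - q ` C \<subseteq> ?S - p ` C" by simp_all
        have pS: "p ` C \<subseteq> ?S" using CS homeos_image_topspace[OF p(1)] by blast
        have "A = B" if "A \<subseteq> B" "T - A \<subseteq> T - B" "B \<subseteq> T" for A B T :: "'a set" using that by blast
        from this[OF sub' pS] have "q ` C = p ` C" .
        thus ?thesis unfolding r_def image_comp[symmetric] using image_inv_f_f[OF inj(1)] by simp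
      qed
      hence "\<psi> p \<otimes> \<psi> r \<otimes> \<one> \<in> U" using C(3)[OF rS] by simp
      moreover have "q = p \<circ> r" using homeos_finv_simps[OF p(1)] by (simp add: r_def fun_eq_iff)
      moreover have "\<psi> (p \<circ> r) = \<psi> p \<otimes> \<psi> r" using \<psi>_comp p r by blast
      ultimately have "\<psi> q \<in> U" using \<psi>_carrier p r by simp
      thus "g \<in> ?P" using gc q by (simp add: \<psi>_def)
    qed
    ultimately show ?thesis by blast
  qed
  thus "openin (Homeo_topology X) ?P" by (subst openin_subopen) blast
qed

end

text \<open>
  Scatteredness and self-similarity enter together: every nonempty closed set \<open>F\<close> has an isolated point that has
  a clopen base with a rich punctured neighbourhood.
\<close>
theorem automatic_continuity_if_locally_rich:
  fixes X :: "'a topology"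
  assumes "compact_space X" "Hausdorff_space X"
    and "\<And>F. \<lbrakk>closedin X F; F \<noteq> {}\<rbrakk> \<Longrightarrow> \<exists>y\<in>F. \<exists>V. clopen_base X y V \<and>
      clopen_base.rich X y V (clopen_base.E y V) \<and> V 0 \<inter> F = {y}"
  shows "automatic_continuity TYPE('h) (Homeo X) (Homeo_topology X)"
  unfolding automatic_continuity_def
proof (intro conjI allI impI)
  show "topological_group (Homeo X) (Homeo_topology X)" using assms topological_group_Homeo by blast
  fix H :: "'h monoid" and S \<phi>
  assume "topological_group H S \<and> separable_space S \<and> \<phi> \<in> hom (Homeo X) H"
  then interpret Homeo_hom X H S \<phi> using assms(1,2) by unfold_locales auto
  show "continuous_map (Homeo_topology X) S \<phi>"
    using continuous_if_tame tame_topspace assms(3) by blast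
qed

section \<open>Order topologies of well-orders\<close>

locale well_order_space =
  fixes r :: "'a rel"
  assumes wo: "Well_order r"
begin

definition lt :: "'a \<Rightarrow> 'a \<Rightarrow> bool" where "lt a b \<longleftrightarrow> (a, b) \<in> r - Id"

abbreviation T :: "'a topology" where "T \<equiv> order_topology_of r"

definition below :: "'a \<Rightarrow> 'a set" where "below b = {z \<in> Field r. z = b \<or> lt z b}"

definition Ioc :: "'a \<Rightarrow> 'a \<Rightarrow> 'a set" where "Ioc a b = {z \<in> below b. lt a z}"

lemma lt_Field: "lt a b \<Longrightarrow> a \<in> Field r" "lt a b \<Longrightarrow> b \<in> Field r"
  by (auto simp: lt_def Field_def)

lemma lt_irrefl: "\<not> lt a a" by (simp add: lt_def)

lemma lt_trans: assumes "lt a b" "lt b c" shows "lt a c"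
proof -
  have "trans r" "antisym r" using wo by (auto simp: order_on_defs)
  thus ?thesis using assms unfolding lt_def trans_def antisym_def by blast
qed

lemma lt_linear: assumes "a \<in> Field r" "b \<in> Field r" shows "a = b \<or> lt a b \<or> lt b a"
proof -
  have "total_on (Field r) r" using wo by (simp add: order_on_defs)
  thus ?thesis using assms unfolding lt_def total_on_def by auto
qed

lemma wf_lt: "wf {(a, b). lt a b}"
proof -
  have "{(a, b). lt a b} = r - Id" by (auto simp: lt_def)
  thus ?thesis using wo by (simp add: order_on_defs)
qed

lemma least_element:
  assumes "S \<subseteq> Field r" "S \<noteq> {}" shows "\<exists>m\<in>S. \<forall>x\<in>S. x = m \<or> lt m x"
proof -
  obtain m where m: "m \<in> S" "\<And>x. lt x m \<Longrightarrow> x \<notin> S"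
    using wfE_min[OF wf_lt, of _ S] assms(2) by (metis (no_types, lifting) case_prodI equals0I mem_Collect_eq)
  thus ?thesis using lt_linear assms(1) by (intro bexI[of _ m]) blast+
qed

lemma mem_Ioc: "z \<in> Ioc a b \<longleftrightarrow> lt a z \<and> (z = b \<or> lt z b)"
  by (auto simp: Ioc_def below_def lt_Field)

lemma topspace_T: "topspace T = Field r"
proof -
  have "\<Union> ({Field r} \<union> {{x. (x, a) \<in> r - Id} | a. a \<in> Field r} \<union> {{x. (a, x) \<in> r - Id} | a. a \<in> Field r}) = Field r"
    by (auto simp: Field_def)
  thus ?thesis unfolding order_topology_of_def topology_generated_by_topspace .
qed

lemma openin_below: "a \<in> Field r \<Longrightarrow> openin T {z. lt z a}"
  unfolding order_topology_of_def lt_def by (rule topology_generated_by_Basis) blast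

lemma openin_above: "a \<in> Field r \<Longrightarrow> openin T {z. lt a z}"
  unfolding order_topology_of_def lt_def by (rule topology_generated_by_Basis) blast

text \<open>
  If \<open>b\<close> is not the last element, \<open>below b\<close> consists of the points before the successor \<open>m\<close> of \<open>b\<close>.
\<close>
lemma clopenin_below: assumes b: "b \<in> Field r" shows "clopenin T (below b)"
proof
  show "openin T (below b)"
  proof (cases "{z. lt b z} = {}")
    case True
    hence "below b = topspace T" using lt_linear[OF b] topspace_T by (auto simp: below_def)
    thus ?thesis by simp
  next
    case False
    have "{z. lt b z} \<subseteq> Field r" using lt_Field by blast
    from least_element[OF this False] obtain m where m: "lt b m" "\<And>x. lt b x \<Longrightarrow> x = m \<or> lt m x" by blast
    have "below b = {z. lt z m}"
    proof (intro equalityI subsetI)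
      fix z assume "z \<in> below b" thus "z \<in> {z. lt z m}" using m(1) by (auto simp: below_def intro: lt_trans)
    next
      fix z assume "z \<in> {z. lt z m}"
      hence z: "lt z m" by simp
      hence "\<not> lt b z" using m(2) lt_trans lt_irrefl by blast
      thus "z \<in> below b" using z lt_linear[OF b] lt_Field(1)[OF z] by (auto simp: below_def)
    qed
    thus ?thesis using openin_below lt_Field m(1) by simp
  qed
  have "topspace T - below b = {z. lt b z}"
    using lt_linear[OF b] lt_Field lt_trans lt_irrefl unfolding topspace_T below_def by blast
  thus "closedin T (below b)"
    using openin_above[OF b] topspace_T unfolding closedin_def by (auto simp: below_def)
qed

lemma Ioc_eq_Diff: "a \<in> Field r \<Longrightarrow> Ioc a b = below b - below a"
  using lt_linear[of a] lt_trans lt_irrefl unfolding Ioc_def below_def by blast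

lemma clopenin_Ioc: "a \<in> Field r \<Longrightarrow> b \<in> Field r \<Longrightarrow> clopenin T (Ioc a b)"
  using clopenin_below by (simp add: Ioc_eq_Diff openin_diff closedin_diff)

text \<open>
  The first alternative takes care of the first point, below which there is no \<open>a\<close>.
\<close>
lemma local_base:
  assumes U: "openin T U" and x: "x \<in> U"
  shows "below x \<subseteq> U \<or> (\<exists>a. lt a x \<and> Ioc a x \<subseteq> U)"
proof -
  have "generate_topology_on ({Field r} \<union> {{x. (x, a) \<in> r - Id} | a. a \<in> Field r} \<union> {{x. (a, x) \<in> r - Id} | a. a \<in> Field r}) U"
    using U unfolding order_topology_of_def openin_topology_generated_by_iff .
  thus ?thesis using x
  proof (induction)
    case (Int A B)
    hence A: "below x \<subseteq> A \<or> (\<exists>a. lt a x \<and> Ioc a x \<subseteq> A)" and B: "below x \<subseteq> B \<or> (\<exists>a. lt a x \<and> Ioc a x \<subseteq> B)" by auto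
    have sub: "Ioc a x \<subseteq> below x" for a by (auto simp: Ioc_def)
    show ?case
    proof (cases "below x \<subseteq> A \<or> below x \<subseteq> B")
      case True thus ?thesis using A B sub by blast
    next
      case False
      then obtain a b where ab: "lt a x" "Ioc a x \<subseteq> A" "lt b x" "Ioc b x \<subseteq> B" using A B by blast
      have "a = b \<or> lt a b \<or> lt b a" using lt_linear lt_Field ab by blast
      thus ?thesis
      proof (elim disjE)
        assume "a = b" thus ?thesis using ab by blast
      next
        assume "lt a b"
        hence "Ioc b x \<subseteq> Ioc a x" by (auto simp: mem_Ioc intro: lt_trans)
        thus ?thesis using ab by blast
      next
        assume "lt b a"
        hence "Ioc a x \<subseteq> Ioc b x" by (auto simp: mem_Ioc intro: lt_trans)
        thus ?thesis using ab by blast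
      qed
    qed
  next
    case (UN K)
    then obtain k where "k \<in> K" "x \<in> k" by blast
    thus ?case using UN.IH by blast
  next
    case (Basis s)
    then consider "s = Field r" | a where "s = {x. lt x a}" | a where "s = {x. lt a x}" by (auto simp: lt_def)
    thus ?case
    proof cases
      case 1 thus ?thesis by (auto simp: below_def)
    next
      case 2 thus ?thesis using Basis.prems by (auto simp: below_def intro: lt_trans)
    next
      case 3 thus ?thesis using Basis.prems by (auto simp: mem_Ioc)
    qed
  qed simp
qed

lemma Hausdorff_T: "Hausdorff_space T"
proof -
  have sep: "\<exists>U V. openin T U \<and> openin T V \<and> a \<in> U \<and> b \<in> V \<and> disjnt U V" if "lt a b" for a b
  proof -
    have "disjnt (below a) {z. lt a z}" using lt_trans lt_irrefl unfolding disjnt_def below_def by blast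
    moreover have "a \<in> below a" using that lt_Field by (simp add: below_def)
    ultimately show ?thesis
      using clopenin_below[OF lt_Field(1)[OF that]] openin_above[OF lt_Field(1)[OF that]] that by blast
  qed
  show ?thesis
    unfolding Hausdorff_space_def topspace_T
  proof (intro allI impI)
    fix a b assume ab: "a \<in> Field r \<and> b \<in> Field r \<and> a \<noteq> b"
    hence "lt a b \<or> lt b a" using lt_linear by blast
    thus "\<exists>U V. openin T U \<and> openin T V \<and> a \<in> U \<and> b \<in> V \<and> disjnt U V"
      using sep[of a b] sep[of b a] disjnt_sym by blast
  qed
qed

text \<open>
  By well-founded induction every segment \<open>below x\<close> is covered by finitely many members: one member
  contains an interval \<open>Ioc a x\<close>, and \<open>below a\<close> is left.
\<close>
lemma compact_T:
  assumes t: "t \<in> Field r" "\<And>z. z \<in> Field r \<Longrightarrow> z = t \<or> lt z t"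
  shows "compact_space T"
  unfolding compact_space_def compactin_def
proof (intro conjI allI impI)
  fix \<U> assume \<U>: "(\<forall>U\<in>\<U>. openin T U) \<and> topspace T \<subseteq> \<Union>\<U>"
  have "x \<in> Field r \<Longrightarrow> \<exists>\<F>. finite \<F> \<and> \<F> \<subseteq> \<U> \<and> below x \<subseteq> \<Union>\<F>" for x
  proof (induction x rule: wf_induct_rule[OF wf_lt])
    case (1 x)
    then obtain U where U: "U \<in> \<U>" "x \<in> U" using \<U> topspace_T by blast
    hence "below x \<subseteq> U \<or> (\<exists>a. lt a x \<and> Ioc a x \<subseteq> U)" using \<U> local_base by blast
    thus ?case
    proof (elim disjE exE conjE)
      assume "below x \<subseteq> U"
      thus ?thesis using U by (intro exI[of _ "{U}"]) auto
    next
      fix a assume a: "lt a x" "Ioc a x \<subseteq> U"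
      have "\<exists>\<F>. finite \<F> \<and> \<F> \<subseteq> \<U> \<and> below a \<subseteq> \<Union>\<F>"
        by (rule "1.IH") (use a(1) lt_Field(1)[OF a(1)] in simp_all)
      then obtain \<F> where F: "finite \<F>" "\<F> \<subseteq> \<U>" "below a \<subseteq> \<Union>\<F>" by blast
      have "below x \<subseteq> below a \<union> Ioc a x" using Ioc_eq_Diff[OF lt_Field(1)[OF a(1)]] by blast
      thus ?thesis using F a U by (intro exI[of _ "insert U \<F>"]) auto
    qed
  qed
  from this[OF t(1)] obtain \<F> where F: "finite \<F>" "\<F> \<subseteq> \<U>" "below t \<subseteq> \<Union>\<F>" by blast
  have "topspace T \<subseteq> below t" using t topspace_T by (auto simp: below_def)
  thus "\<exists>\<F>. finite \<F> \<and> \<F> \<subseteq> \<U> \<and> topspace T \<subseteq> \<Union>\<F>" using F by blast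
qed simp

text \<open>
  Every initial piece \<open>Ioc \<eta> \<delta>\<close> of the interval from \<open>\<eta>\<close> to \<open>y\<close> is order isomorphic to an interval
  beyond a given \<open>\<epsilon>\<close> that still lies below \<open>y\<close>.  For \<open>y = \<eta> + \<omega>\<^sup>\<beta>\<close> this expresses that
  \<open>\<omega>\<^sup>\<beta>\<close> is additively indecomposable.
\<close>
definition self_similar :: "'a \<Rightarrow> 'a \<Rightarrow> bool" where
  "self_similar \<eta> y \<longleftrightarrow> lt \<eta> y \<and> (\<forall>\<delta> \<epsilon>. lt \<eta> \<delta> \<and> lt \<delta> y \<and> lt \<eta> \<epsilon> \<and> lt \<epsilon> y \<longrightarrow>
     (\<exists>h a b. bij_betw h (Ioc \<eta> \<delta>) (Ioc a b) \<and> (\<forall>u v. u \<in> Ioc \<eta> \<delta> \<longrightarrow> v \<in> Ioc \<eta> \<delta> \<longrightarrow> lt u v \<longrightarrow> lt (h u) (h v)) \<and>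
        lt \<epsilon> a \<and> a \<in> Field r \<and> lt b y))"

text \<open>
  Since the image of \<open>h\<close> is an interval, a lower bound \<open>c\<close> for a neighbourhood of \<open>h z\<close> is either itself
  a value of \<open>h\<close> or lies at or below the lower end \<open>a\<close> of the image.
\<close>
lemma interval_iso_continuous:
  assumes h: "bij_betw h (Ioc \<eta> \<delta>) (Ioc a b)" and mono: "\<And>u v. u \<in> Ioc \<eta> \<delta> \<Longrightarrow> v \<in> Ioc \<eta> \<delta> \<Longrightarrow> lt u v \<Longrightarrow> lt (h u) (h v)"
    and a: "a \<in> Field r" and \<eta>: "\<eta> \<in> Field r" and U: "openin T U"
  shows "openin T {z \<in> Ioc \<eta> \<delta>. h z \<in> U}"
proof -
  have "\<exists>A. openin T A \<and> z \<in> A \<and> A \<subseteq> {z \<in> Ioc \<eta> \<delta>. h z \<in> U}" if z: "z \<in> Ioc \<eta> \<delta>" "h z \<in> U" for z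
  proof -
    have zF: "lt \<eta> z" "z \<in> Field r" using z lt_Field by (auto simp: mem_Ioc)
    have hz: "h z \<in> Ioc a b" using h z bij_betwE by blast
    have down: "w \<in> Ioc \<eta> \<delta> \<and> h w \<in> Ioc a (h z)" if w: "lt \<eta> w" "w = z \<or> lt w z" for w
    proof -
      have 1: "w \<in> Ioc \<eta> \<delta>" using w z(1) by (auto simp: mem_Ioc intro: lt_trans)
      hence "h w \<in> Ioc a b" using h bij_betwE by blast
      moreover have "h w = h z \<or> lt (h w) (h z)" using w(2) mono[OF 1 z(1)] by blast
      ultimately show ?thesis using 1 by (auto simp: mem_Ioc)
    qed
    have down': "Ioc \<eta> z \<subseteq> {w \<in> Ioc \<eta> \<delta>. h w \<in> Ioc a (h z)}"
    proof
      fix w assume "w \<in> Ioc \<eta> z"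
      hence "lt \<eta> w" "w = z \<or> lt w z" unfolding mem_Ioc by auto
      from down[OF this] show "w \<in> {w \<in> Ioc \<eta> \<delta>. h w \<in> Ioc a (h z)}" by simp
    qed
    have open_Ioc: "openin T (Ioc c z) \<and> z \<in> Ioc c z" if "lt c z" for c
      using clopenin_Ioc[OF lt_Field(1)[OF that] zF(2)] that by (auto simp: mem_Ioc)
    from local_base[OF U z(2)] consider "below (h z) \<subseteq> U" | c where "lt c (h z)" "Ioc c (h z) \<subseteq> U" by blast
    thus ?thesis
    proof cases
      case 1
      have "Ioc a (h z) \<subseteq> below (h z)" by (auto simp: Ioc_def)
      hence "Ioc \<eta> z \<subseteq> {z \<in> Ioc \<eta> \<delta>. h z \<in> U}" using down' 1 by blast
      thus ?thesis using open_Ioc[OF zF(1)] by blast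
    next
      case (2 c)
      show ?thesis
      proof (cases "lt a c")
        case True
        hence "c \<in> Ioc a b" using 2(1) hz by (auto simp: mem_Ioc intro: lt_trans)
        then obtain c' where c': "c' \<in> Ioc \<eta> \<delta>" "c = h c'" using h by (auto simp: bij_betw_def)
        have n: "\<not> lt z c'" "z \<noteq> c'" using mono[OF z(1) c'(1)] c'(2) 2(1) lt_trans lt_irrefl by blast+
        have "c' \<in> Field r" using c'(1) lt_Field(2) unfolding mem_Ioc by blast
        hence c'z: "lt c' z" using lt_linear[OF zF(2)] n by blast
        have "Ioc c' z \<subseteq> {z \<in> Ioc \<eta> \<delta>. h z \<in> U}"
        proof
          fix w assume w: "w \<in> Ioc c' z"
          have "lt \<eta> w" using w c'(1) by (auto simp: mem_Ioc intro: lt_trans)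
          hence d: "w \<in> Ioc \<eta> \<delta> \<and> h w \<in> Ioc a (h z)" using down w unfolding mem_Ioc by blast
          have "lt c (h w)" using mono[OF c'(1)] d w c'(2) by (auto simp: mem_Ioc)
          hence "h w \<in> Ioc c (h z)" using d by (auto simp: mem_Ioc)
          thus "w \<in> {z \<in> Ioc \<eta> \<delta>. h z \<in> U}" using d 2(2) by blast
        qed
        thus ?thesis using open_Ioc[OF c'z] by blast
      next
        case False
        hence "Ioc a (h z) \<subseteq> Ioc c (h z)"
          using lt_linear[OF a lt_Field(1)[OF 2(1)]] by (auto simp: mem_Ioc intro: lt_trans)
        hence "Ioc \<eta> z \<subseteq> {z \<in> Ioc \<eta> \<delta>. h z \<in> U}" using down' 2(2) by blast
        thus ?thesis using open_Ioc[OF zF(1)] by blast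
      qed
    qed
  qed
  thus ?thesis by (subst openin_subopen) blast
qed

text \<open>
  With an enumeration \<open>p\<close> of the points between \<open>\<eta>\<close> and \<open>y\<close>, the sets \<open>V n\<close> of points of
  \<open>Ioc \<eta> y\<close> above the first \<open>n\<close> of them form a base at \<open>y\<close>, and each \<open>V 0 - V n\<close> is an initial piece
  \<open>Ioc \<eta> \<delta>\<close> or empty.  This is where countability is used.
\<close>
lemma self_similar_imp_rich:
  assumes comp: "compact_space T" and cnt: "countable (Field r)" and ss: "self_similar \<eta> y"
  obtains V where "clopen_base T y V" "clopen_base.rich T y V (clopen_base.E y V)" "V 0 = Ioc \<eta> y"
proof -
  define I where "I = {z. lt \<eta> z \<and> lt z y}"
  have \<eta>y: "lt \<eta> y" using ss by (simp add: self_similar_def)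
  have F: "\<eta> \<in> Field r" "y \<in> Field r" using \<eta>y lt_Field by auto
  have IF: "I \<subseteq> Field r" using lt_Field by (auto simp: I_def)
  have "countable I" using cnt IF countable_subset by blast
  then obtain p :: "nat \<Rightarrow> 'a" where p: "I \<subseteq> range p"
    by (metis countable_as_injective_image_subset empty_subsetI image_empty range_from_nat_into subset_refl)
  \<comment> \<open>values of \<open>p\<close> outside of \<open>I\<close> are skipped; if \<open>I\<close> is empty, all of them are\<close>
  define V where "V n = {z \<in> Ioc \<eta> y. \<forall>i<n. p i \<in> I \<longrightarrow> lt (p i) z}" for n
  have V0: "V 0 = Ioc \<eta> y" by (simp add: V_def)
  have yV: "y \<in> V n" for n using \<eta>y by (auto simp: V_def mem_Ioc I_def)
  have V_Suc: "V (Suc n) \<subseteq> V n" for n by (auto simp: V_def)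
  have gap_Suc: "V 0 - V (Suc n) = (V 0 - V n) \<union> (if p n \<in> I then Ioc \<eta> (p n) else {})" for n
  proof (cases "p n \<in> I")
    case True
    hence pn: "lt \<eta> (p n)" "lt (p n) y" by (auto simp: I_def)
    have "{z \<in> Ioc \<eta> y. \<not> lt (p n) z} = Ioc \<eta> (p n)"
    proof (intro equalityI subsetI)
      fix z assume z: "z \<in> {z \<in> Ioc \<eta> y. \<not> lt (p n) z}"
      hence "z \<in> Field r" using lt_Field(2) by (auto simp: mem_Ioc)
      thus "z \<in> Ioc \<eta> (p n)" using z lt_linear[OF lt_Field(2)[OF pn(1)]] by (auto simp: mem_Ioc)
    next
      fix z assume "z \<in> Ioc \<eta> (p n)"
      thus "z \<in> {z \<in> Ioc \<eta> y. \<not> lt (p n) z}" using pn lt_trans lt_irrefl unfolding mem_Ioc mem_Collect_eq by blast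
    qed
    moreover have "V (Suc n) = V n - {z \<in> Ioc \<eta> y. \<not> lt (p n) z}"
      using True by (auto simp: V_def less_Suc_eq)
    moreover have "Ioc \<eta> (p n) \<subseteq> V 0" using pn by (auto simp: V0 mem_Ioc intro: lt_trans)
    ultimately show ?thesis using True V_Suc[of n] by auto
  next
    case False
    hence "V (Suc n) = V n" by (auto simp: V_def less_Suc_eq)
    thus ?thesis using False by simp
  qed
  have gap: "V 0 - V n = {} \<or> (\<exists>\<delta>\<in>I. V 0 - V n = Ioc \<eta> \<delta>)" for n
  proof (induction n)
    case (Suc n)
    show ?case
    proof (cases "p n \<in> I")
      case False thus ?thesis using Suc gap_Suc by simp
    next
      case True
      from Suc show ?thesis
      proof
        assume "V 0 - V n = {}" thus ?thesis using True gap_Suc by auto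
      next
        assume "\<exists>\<delta>\<in>I. V 0 - V n = Ioc \<eta> \<delta>"
        then obtain \<delta> where d: "\<delta> \<in> I" "V 0 - V n = Ioc \<eta> \<delta>" by blast
        have "\<delta> = p n \<or> lt \<delta> (p n) \<or> lt (p n) \<delta>" using lt_linear IF d(1) True by blast
        hence "Ioc \<eta> \<delta> \<subseteq> Ioc \<eta> (p n) \<or> Ioc \<eta> (p n) \<subseteq> Ioc \<eta> \<delta>" by (auto simp: mem_Ioc intro: lt_trans)
        hence "V 0 - V (Suc n) = Ioc \<eta> (p n) \<or> V 0 - V (Suc n) = Ioc \<eta> \<delta>" using d(2) True gap_Suc by auto
        thus ?thesis using d(1) True by blast
      qed
    qed
  qed simp
  have V_sub: "V n \<subseteq> V 0" for n by (auto simp: V_def)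
  have clV: "clopenin T (V n)" for n
  proof -
    have "V n = V 0 - (V 0 - V n)" using V_sub by blast
    moreover have "clopenin T (V 0)" unfolding V0 using clopenin_Ioc F by blast
    moreover have "clopenin T (V 0 - V n)"
      using gap[of n]
    proof
      assume e: "V 0 - V n = {}" show ?thesis unfolding e by simp
    next
      assume "\<exists>\<delta>\<in>I. V 0 - V n = Ioc \<eta> \<delta>"
      then obtain \<delta> where "\<delta> \<in> I" "V 0 - V n = Ioc \<eta> \<delta>" by blast
      thus ?thesis using clopenin_Ioc[OF F(1)] IF by (metis subsetD)
    qed
    ultimately show ?thesis by (metis openin_diff closedin_diff)
  qed
  interpret clopen_base T y V
  proof
    show "compact_space T" "Hausdorff_space T" using comp Hausdorff_T by auto
    show "openin T (V n)" "closedin T (V n)" for n using clV by auto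
    fix U assume U: "openin T U" "y \<in> U"
    from local_base[OF U] show "\<exists>n. V n \<subseteq> U"
    proof (elim disjE exE conjE)
      assume "below y \<subseteq> U" thus ?thesis using V0 by (intro exI[of _ 0]) (auto simp: Ioc_def)
    next
      fix a assume a: "lt a y" "Ioc a y \<subseteq> U"
      show ?thesis
      proof (cases "lt \<eta> a")
        case True
        then obtain i where i: "a = p i" "p i \<in> I" using p a(1) by (auto simp: I_def)
        have "V (Suc i) \<subseteq> Ioc a y" using i by (auto simp: V_def mem_Ioc)
        thus ?thesis using a(2) by blast
      next
        case False
        hence "V 0 \<subseteq> Ioc a y" using V0 lt_linear[OF F(1) lt_Field(1)[OF a(1)]] by (auto simp: mem_Ioc intro: lt_trans)
        thus ?thesis using a(2) by blast
      qed
    qed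
  qed (use yV V_Suc in auto)
  have pcl: "pclopen K" if "clopenin T K" "K \<subseteq> V 0" "y \<notin> K" for K
  proof -
    have "E - K = E \<inter> (topspace T - K)" using openin_E openin_subset by blast
    thus ?thesis using that openin_E by (auto simp: pclopen_iff E_def openin_Int openin_diff)
  qed
  have "rich E"
    unfolding rich_def
  proof (intro conjI allI)
    show "pclopen E" by (rule pclopen_E)
    fix n m
    from gap[of n] show "\<exists>K h. pclopen K \<and> K \<subseteq> E \<inter> V m \<and> phomeo h (V 0 - V n) K"
    proof
      assume e: "V 0 - V n = {}"
      have "phomeo id {} {}" by (rule phomeo_id) simp
      thus ?thesis unfolding e using pclopen_empty by blast
    next
      assume "\<exists>\<delta>\<in>I. V 0 - V n = Ioc \<eta> \<delta>"
      then obtain \<delta> where d: "\<delta> \<in> I" "V 0 - V n = Ioc \<eta> \<delta>" by blast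
      obtain \<epsilon> where e: "\<epsilon> \<in> I" "Ioc \<epsilon> y \<subseteq> V m"
      proof -
        from gap[of m] show ?thesis
        proof
          assume "V 0 - V m = {}"
          hence "V 0 \<subseteq> V m" by blast
          moreover have "Ioc \<delta> y \<subseteq> V 0" using d(1) by (auto simp: V0 mem_Ioc I_def intro: lt_trans)
          ultimately show ?thesis using that d(1) by blast
        next
          assume "\<exists>\<delta>\<in>I. V 0 - V m = Ioc \<eta> \<delta>"
          then obtain \<epsilon> where e: "\<epsilon> \<in> I" "V 0 - V m = Ioc \<eta> \<epsilon>" by blast
          have "Ioc \<epsilon> y \<subseteq> V 0" using e(1) by (auto simp: V0 mem_Ioc I_def intro: lt_trans)
          moreover have "Ioc \<epsilon> y \<inter> Ioc \<eta> \<epsilon> = {}" using lt_trans lt_irrefl unfolding mem_Ioc set_eq_iff Int_iff empty_iff by blast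
          ultimately show ?thesis using that e by blast
        qed
      qed
      have "lt \<eta> \<delta> \<and> lt \<delta> y \<and> lt \<eta> \<epsilon> \<and> lt \<epsilon> y" using d(1) e(1) by (simp add: I_def)
      then obtain h a b where h: "bij_betw h (Ioc \<eta> \<delta>) (Ioc a b)"
        "\<forall>u v. u \<in> Ioc \<eta> \<delta> \<longrightarrow> v \<in> Ioc \<eta> \<delta> \<longrightarrow> lt u v \<longrightarrow> lt (h u) (h v)"
        "lt \<epsilon> a" "a \<in> Field r" "lt b y" using ss unfolding self_similar_def by metis
      have KV: "Ioc a b \<subseteq> Ioc \<epsilon> y" using h(3,5) by (auto simp: mem_Ioc intro: lt_trans)
      have yK: "y \<notin> Ioc a b" using h(5) lt_trans lt_irrefl unfolding mem_Ioc by blast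
      have "Ioc a b \<subseteq> V 0" using KV e(2) V_sub by blast
      hence "pclopen (Ioc a b)" using pcl clopenin_Ioc[OF h(4) lt_Field(1)[OF h(5)]] yK by blast
      moreover have "Ioc a b \<subseteq> E \<inter> V m" using \<open>Ioc a b \<subseteq> V 0\<close> yK KV e(2) by (auto simp: E_def)
      moreover have "phomeo h (V 0 - V n) (Ioc a b)"
        unfolding phomeo_def
      proof (intro conjI allI impI)
        show "bij_betw h (V 0 - V n) (Ioc a b)" using h(1) d(2) by simp
        show "openin T {z \<in> V 0 - V n. h z \<in> U}" if "openin T U" for U
          unfolding d(2) using interval_iso_continuous[OF h(1) _ h(4) F(1) that] h(2) by blast
        show "\<exists>m. h ` ((V 0 - V n) \<inter> V m) \<subseteq> V k" for k by (rule exI[of _ n]) auto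
      qed
      ultimately show ?thesis by blast
    qed
  qed
  thus ?thesis using that clopen_base_axioms V0 by blast
qed

lemma isolated_imp_rich:
  assumes comp: "compact_space T" and y: "openin T {y}"
  shows "clopen_base T y (\<lambda>_. {y})" "clopen_base.rich T y (\<lambda>_. {y}) (clopen_base.E y (\<lambda>_. {y}))"
proof -
  have "y \<in> topspace T" using y openin_subset by blast
  then interpret clopen_base T y "\<lambda>_. {y}"
    using comp Hausdorff_T y by unfold_locales (auto simp: closedin_Hausdorff_singleton)
  show "clopen_base T y (\<lambda>_. {y})" by (rule clopen_base_axioms)
  have "phomeo id {} {}" by (rule phomeo_id) simp
  thus "rich E" using pclopen_empty unfolding rich_def by (auto simp: E_def)
qed

text \<open>
  The least element \<open>y\<close> of a closed set is isolated in it, since the points up to \<open>y\<close> form an open set.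
\<close>
theorem automatic_continuity_Homeo:
  assumes cnt: "countable (Field r)"
    and top: "t \<in> Field r" "\<And>z. z \<in> Field r \<Longrightarrow> z = t \<or> lt z t"
    and ss: "\<And>x y. lt x y \<Longrightarrow> \<exists>\<eta>. self_similar \<eta> y"
  shows "automatic_continuity TYPE('h) (Homeo T) (Homeo_topology T)"
proof (rule automatic_continuity_if_locally_rich)
  show comp: "compact_space T" using compact_T top by blast
  show "Hausdorff_space T" by (rule Hausdorff_T)
  fix F assume F: "closedin T F" "F \<noteq> {}"
  hence "F \<subseteq> Field r" using closedin_subset topspace_T by metis
  from least_element[OF this F(2)] obtain y where y: "y \<in> F" "\<And>x. x \<in> F \<Longrightarrow> x = y \<or> lt y x" by blast
  have yF: "y \<in> Field r" using y(1) \<open>F \<subseteq> Field r\<close> by blast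
  have up: "below y \<inter> F = {y}"
    using y yF lt_trans lt_irrefl unfolding below_def by blast
  show "\<exists>y\<in>F. \<exists>V. clopen_base T y V \<and> clopen_base.rich T y V (clopen_base.E y V) \<and> V 0 \<inter> F = {y}"
  proof (cases "\<exists>x. lt x y")
    case True
    then obtain \<eta> where e: "self_similar \<eta> y" using ss by blast
    obtain V where V: "clopen_base T y V" "clopen_base.rich T y V (clopen_base.E y V)" "V 0 = Ioc \<eta> y"
      using self_similar_imp_rich[OF comp cnt e] by metis
    have "y \<in> Ioc \<eta> y" using e by (simp add: self_similar_def mem_Ioc)
    hence "V 0 \<inter> F = {y}" using up y(1) V(3) by (auto simp: Ioc_def)
    thus ?thesis using V y(1) by blast
  next
    case False
    hence "below y = {y}" using yF by (auto simp: below_def)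
    hence "openin T {y}" using clopenin_below[OF yF] by simp
    thus ?thesis using isolated_imp_rich[OF comp] y(1) by (intro bexI[of _ y] exI[of _ "\<lambda>_. {y}"]) auto
  qed
qed

end

section \<open>Sums, products and powers of well-orders\<close>

lemma Well_orderI:
  assumes refl: "\<And>a. a \<in> Field r \<Longrightarrow> (a, a) \<in> r"
    and trans: "\<And>a b c. (a, b) \<in> r \<Longrightarrow> (b, c) \<in> r \<Longrightarrow> (a, c) \<in> r"
    and total: "\<And>a b. a \<in> Field r \<Longrightarrow> b \<in> Field r \<Longrightarrow> a \<noteq> b \<Longrightarrow> (a, b) \<in> r \<or> (b, a) \<in> r"
    and wf: "wf (r - Id)"
  shows "Well_order r"
proof -
  have "antisym r"
  proof (rule antisymI, rule ccontr)
    fix a b assume "(a, b) \<in> r" "(b, a) \<in> r" "a \<noteq> b"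
    thus False using wf_not_sym[OF wf, of a b] by blast
  qed
  moreover have "trans r" using trans by (rule transI)
  moreover have "refl_on (Field r) r" using refl by (auto simp: refl_on_def)
  moreover have "total_on (Field r) r" using total by (auto simp: total_on_def)
  ultimately show ?thesis using wf by (auto simp: order_on_defs Field_def)
qed

lemma Well_order_refl: "Well_order r \<Longrightarrow> a \<in> Field r \<Longrightarrow> (a, a) \<in> r"
  by (auto simp: order_on_defs refl_on_def)

lemma Well_order_trans: "Well_order r \<Longrightarrow> (a, b) \<in> r \<Longrightarrow> (b, c) \<in> r \<Longrightarrow> (a, c) \<in> r"
  unfolding order_on_defs trans_def by blast

lemma Well_order_total: "Well_order r \<Longrightarrow> a \<in> Field r \<Longrightarrow> b \<in> Field r \<Longrightarrow> a \<noteq> b \<Longrightarrow> (a, b) \<in> r \<or> (b, a) \<in> r"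
  unfolding order_on_defs total_on_def by blast

lemma Well_order_strict_trans:
  assumes "Well_order r" "(a, b) \<in> r - Id" "(b, c) \<in> r - Id" shows "(a, c) \<in> r - Id"
  using well_order_space.lt_trans[of r a b c] assms by (simp add: well_order_space_def well_order_space.lt_def)

lemma ord_sum_iff:
  "(Inl x, Inl x') \<in> ord_sum r s \<longleftrightarrow> (x, x') \<in> r"
  "(Inr z, Inr z') \<in> ord_sum r s \<longleftrightarrow> (z, z') \<in> s"
  "(Inl x, Inr z) \<in> ord_sum r s \<longleftrightarrow> x \<in> Field r \<and> z \<in> Field s"
  "(Inr z, Inl x) \<notin> ord_sum r s"
  by (auto simp: ord_sum_def)

lemma ord_prod_iff:
  "((x, z), (x', z')) \<in> ord_prod r s \<longleftrightarrow> x \<in> Field r \<and> x' \<in> Field r \<and> z \<in> Field s \<and> z' \<in> Field s \<and>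
     ((z, z') \<in> s - Id \<or> z = z' \<and> (x, x') \<in> r)"
  by (simp add: ord_prod_def)

lemma Field_ord_sum:
  assumes "Well_order r" "Well_order s"
  shows "Field (ord_sum r s) = Inl ` Field r \<union> Inr ` Field s"
proof
  show "Field (ord_sum r s) \<subseteq> Inl ` Field r \<union> Inr ` Field s" unfolding ord_sum_def Field_def by auto
  have "(Inl x, Inl x) \<in> ord_sum r s" if "x \<in> Field r" for x
    using Well_order_refl[OF assms(1) that] by (simp add: ord_sum_def)
  moreover have "(Inr x, Inr x) \<in> ord_sum r s" if "x \<in> Field s" for x
    using Well_order_refl[OF assms(2) that] by (simp add: ord_sum_def)
  ultimately show "Inl ` Field r \<union> Inr ` Field s \<subseteq> Field (ord_sum r s)" by (auto intro: FieldI1)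
qed

lemma Well_order_ord_sum:
  assumes r: "Well_order r" and s: "Well_order s"
  shows "Well_order (ord_sum r s)"
proof (rule Well_orderI)
  show "(a, a) \<in> ord_sum r s" if "a \<in> Field (ord_sum r s)" for a
    using that Well_order_refl[OF r] Well_order_refl[OF s] unfolding Field_ord_sum[OF r s] by (auto simp: ord_sum_def)
  show "(a, c) \<in> ord_sum r s" if "(a, b) \<in> ord_sum r s" "(b, c) \<in> ord_sum r s" for a b c
  proof (cases a; cases b; cases c)
    fix x y z assume "a = Inl x" "b = Inl y" "c = Inl z"
    thus ?thesis using that Well_order_trans[OF r, of x y z] by (simp add: ord_sum_iff)
  next
    fix x y z assume "a = Inr x" "b = Inr y" "c = Inr z"
    thus ?thesis using that Well_order_trans[OF s, of x y z] by (simp add: ord_sum_iff)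
  qed (use that in \<open>auto simp: ord_sum_iff intro: FieldI1 FieldI2\<close>)
  show "(a, b) \<in> ord_sum r s \<or> (b, a) \<in> ord_sum r s"
    if "a \<in> Field (ord_sum r s)" "b \<in> Field (ord_sum r s)" "a \<noteq> b" for a b
  proof (cases a; cases b)
    fix x y assume "a = Inl x" "b = Inl y"
    thus ?thesis using that Well_order_total[OF r, of x y] unfolding Field_ord_sum[OF r s] by (auto simp: ord_sum_iff)
  next
    fix x y assume "a = Inr x" "b = Inr y"
    thus ?thesis using that Well_order_total[OF s, of x y] unfolding Field_ord_sum[OF r s] by (auto simp: ord_sum_iff)
  qed (use that in \<open>auto simp: ord_sum_iff Field_ord_sum[OF r s]\<close>)
  \<comment> \<open>the component that does not apply is filled with \<open>undefined\<close>; it is only compared with itself\<close>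
  define key where "key z = (case z of Inl x \<Rightarrow> (0::nat, x, undefined) | Inr y \<Rightarrow> (1, undefined, y))" for z :: "'a + 'b"
  have "wf (less_than <*lex*> (r - Id) <*lex*> (s - Id))"
    using r s by (intro wf_lex_prod wf_less_than) (simp_all add: well_order_on_def)
  hence "wf (inv_image (less_than <*lex*> (r - Id) <*lex*> (s - Id)) key)" by (rule wf_inv_image)
  moreover have "ord_sum r s - Id \<subseteq> inv_image (less_than <*lex*> (r - Id) <*lex*> (s - Id)) key"
    by (auto simp: ord_sum_def key_def)
  ultimately show "wf (ord_sum r s - Id)" using wf_subset by blast
qed

lemma Field_ord_prod:
  assumes "Well_order r" "Well_order s"
  shows "Field (ord_prod r s) = Field r \<times> Field s"
proof
  show "Field (ord_prod r s) \<subseteq> Field r \<times> Field s" unfolding ord_prod_def Field_def by auto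
  have "((x, y), (x, y)) \<in> ord_prod r s" if "x \<in> Field r" "y \<in> Field s" for x y
    using Well_order_refl[OF assms(1) that(1)] that by (simp add: ord_prod_def)
  thus "Field r \<times> Field s \<subseteq> Field (ord_prod r s)" by (auto intro: FieldI1)
qed

lemma Well_order_ord_prod:
  assumes r: "Well_order r" and s: "Well_order s"
  shows "Well_order (ord_prod r s)"
proof (rule Well_orderI)
  show "(a, a) \<in> ord_prod r s" if "a \<in> Field (ord_prod r s)" for a
    using that Well_order_refl[OF r] unfolding Field_ord_prod[OF r s] by (auto simp: ord_prod_def)
  show "(a, c) \<in> ord_prod r s" if "(a, b) \<in> ord_prod r s" "(b, c) \<in> ord_prod r s" for a b c
  proof -
    obtain a1 a2 b1 b2 c1 c2 where [simp]: "a = (a1, a2)" "b = (b1, b2)" "c = (c1, c2)" by (cases a, cases b, cases c)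
    have ab: "a1 \<in> Field r" "a2 \<in> Field s" "(a2, b2) \<in> s - Id \<or> a2 = b2 \<and> (a1, b1) \<in> r"
      and bc: "c1 \<in> Field r" "c2 \<in> Field s" "(b2, c2) \<in> s - Id \<or> b2 = c2 \<and> (b1, c1) \<in> r"
      using that by (simp_all add: ord_prod_iff)
    have "(a2, c2) \<in> s - Id \<or> a2 = c2 \<and> (a1, c1) \<in> r"
      using ab(3) bc(3) Well_order_trans[OF r] Well_order_strict_trans[OF s] by blast
    thus ?thesis using ab bc by (simp add: ord_prod_iff)
  qed
  show "(a, b) \<in> ord_prod r s \<or> (b, a) \<in> ord_prod r s"
    if "a \<in> Field (ord_prod r s)" "b \<in> Field (ord_prod r s)" "a \<noteq> b" for a b
  proof -
    obtain a1 a2 b1 b2 where [simp]: "a = (a1, a2)" "b = (b1, b2)" by (cases a, cases b)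
    have "a1 \<in> Field r" "a2 \<in> Field s" "b1 \<in> Field r" "b2 \<in> Field s" "a1 \<noteq> b1 \<or> a2 \<noteq> b2"
      using that by (auto simp: Field_ord_prod[OF r s])
    thus ?thesis using Well_order_total[OF r, of a1 b1] Well_order_total[OF s, of a2 b2]
      unfolding \<open>a = _\<close> \<open>b = _\<close> ord_prod_iff by blast
  qed
  have "wf ((s - Id) <*lex*> (r - Id))"
    using r s by (intro wf_lex_prod) (simp_all add: well_order_on_def)
  hence "wf (inv_image ((s - Id) <*lex*> (r - Id)) prod.swap)" by (rule wf_inv_image)
  moreover have "ord_prod r s - Id \<subseteq> inv_image ((s - Id) <*lex*> (r - Id)) prod.swap"
    by (auto simp: ord_prod_def)
  ultimately show "wf (ord_prod r s - Id)" using wf_subset by blast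
qed

locale exponent_order = well_order_space
begin

text \<open>
  The strict part of \<open>omega_power r\<close>, on all functions.
\<close>
definition less :: "('a \<Rightarrow> nat) \<Rightarrow> ('a \<Rightarrow> nat) \<Rightarrow> bool" where
  "less f g \<longleftrightarrow> (\<exists>x\<in>Field r. f x < g x \<and> (\<forall>z. lt x z \<longrightarrow> f z = g z))"

lemma omega_power_iff:
  "(f, g) \<in> omega_power r \<longleftrightarrow> f \<in> omega_power_carrier r \<and> g \<in> omega_power_carrier r \<and> (f = g \<or> less f g)"
  by (auto simp: omega_power_def less_def lt_def)

lemma greatest_element:
  assumes "finite S" "S \<noteq> {}" "S \<subseteq> Field r" shows "\<exists>m\<in>S. \<forall>x\<in>S. x = m \<or> lt x m"
  using assms
proof (induction S rule: finite_ne_induct)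
  case (insert a S)
  then obtain m where m: "m \<in> S" "\<forall>x\<in>S. x = m \<or> lt x m" by blast
  have "a = m \<or> lt a m \<or> lt m a" using lt_linear insert.prems m(1) by blast
  thus ?case
  proof (elim disjE)
    assume "lt m a"
    hence "x = a \<or> lt x a" if "x \<in> insert a S" for x using m(2) that by (auto intro: lt_trans)
    thus ?thesis by blast
  qed (use m in blast)+
qed simp

lemma carrier_Field: "f \<in> omega_power_carrier r \<Longrightarrow> f z \<noteq> 0 \<Longrightarrow> z \<in> Field r"
  by (auto simp: omega_power_carrier_def)

lemma carrier_finite: "f \<in> omega_power_carrier r \<Longrightarrow> finite {z. f z \<noteq> 0}"
  by (simp add: omega_power_carrier_def)

lemma greatest_difference:
  assumes f: "f \<in> omega_power_carrier r" and g: "g \<in> omega_power_carrier r" and ne: "f \<noteq> g"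
  obtains x where "x \<in> Field r" "f x \<noteq> g x" "\<And>z. lt x z \<Longrightarrow> f z = g z"
proof -
  let ?S = "{x. f x \<noteq> g x}"
  have sub: "?S \<subseteq> {z. f z \<noteq> 0} \<union> {z. g z \<noteq> 0}" by auto
  have fin: "finite ?S" using finite_subset[OF sub] carrier_finite f g by simp
  have ne': "?S \<noteq> {}" using ne by auto
  have F: "?S \<subseteq> Field r" using sub carrier_Field[OF f] carrier_Field[OF g] by blast
  obtain x where x: "f x \<noteq> g x" "\<And>z. f z \<noteq> g z \<Longrightarrow> z = x \<or> lt z x"
    using greatest_element[OF fin ne' F] by blast
  have "f z = g z" if "lt x z" for z using x(2)[of z] that lt_trans lt_irrefl by blast
  thus ?thesis using that x(1) F by blast
qed

lemma less_linear:
  assumes "f \<in> omega_power_carrier r" "g \<in> omega_power_carrier r" "f \<noteq> g" shows "less f g \<or> less g f"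
proof -
  obtain x where x: "x \<in> Field r" "f x \<noteq> g x" "\<And>z. lt x z \<Longrightarrow> f z = g z" using greatest_difference[OF assms] by blast
  have "f x < g x \<or> g x < f x" using x(2) by linarith
  thus ?thesis unfolding less_def using x by metis
qed

lemma less_irrefl: "\<not> less f f" by (simp add: less_def)

lemma less_trans:
  assumes "less f g" "less g h" shows "less f h"
proof -
  obtain x where x: "x \<in> Field r" "f x < g x" "\<And>z. lt x z \<Longrightarrow> f z = g z" using assms(1) unfolding less_def by blast
  obtain x' where x': "x' \<in> Field r" "g x' < h x'" "\<And>z. lt x' z \<Longrightarrow> g z = h z" using assms(2) unfolding less_def by blast
  consider "x = x'" | "lt x x'" | "lt x' x" using lt_linear x(1) x'(1) by blast
  thus ?thesis
  proof cases
    case 1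
    thus ?thesis unfolding less_def using x x' by (intro bexI[of _ x]) auto
  next
    case 2
    hence "f z = h z" if "lt x' z" for z using x(3) x'(3) that lt_trans by metis
    moreover have "f x' < h x'" using x(3)[OF 2] x'(2) by simp
    ultimately show ?thesis unfolding less_def using x'(1) by blast
  next
    case 3
    hence "f z = h z" if "lt x z" for z using x(3) x'(3) that lt_trans by metis
    moreover have "f x < h x" using x'(3)[OF 3] x(2) by simp
    ultimately show ?thesis unfolding less_def using x(1) by blast
  qed
qed

text \<open>
  A function of finite support is a multiset of exponents.  If \<open>f\<close> is less than \<open>g\<close> at the largest difference
  \<open>x\<close>, then \<open>f\<close> arises from \<open>g\<close> by removing copies of \<open>x\<close>, and possibly of smaller elements, and adding elements
  smaller than \<open>x\<close>; so \<open>f\<close> is below \<open>g\<close> in the multiset order.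
\<close>
lemma wf_less: "wf {(f, g). f \<in> omega_power_carrier r \<and> g \<in> omega_power_carrier r \<and> less f g}"
proof (rule wf_subset[OF wf_inv_image[OF wf_mult[OF wf_lt], of Abs_multiset]])
  show "{(f, g). f \<in> omega_power_carrier r \<and> g \<in> omega_power_carrier r \<and> less f g}
    \<subseteq> inv_image (Multiset.mult {(a, b). lt a b}) Abs_multiset"
  proof (clarify, unfold in_inv_image)
    fix f g assume f: "f \<in> omega_power_carrier r" and g: "g \<in> omega_power_carrier r" and l: "less f g"
    obtain x where x: "x \<in> Field r" "f x < g x" "\<And>z. lt x z \<Longrightarrow> f z = g z" using l unfolding less_def by blast
    define M where "M = Abs_multiset f"
    define N where "N = Abs_multiset g"
    have cM: "count M = f" unfolding M_def by (rule count_Abs_multiset) (use carrier_finite[OF f] in simp)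
    have cN: "count N = g" unfolding N_def by (rule count_Abs_multiset) (use carrier_finite[OF g] in simp)
    have "(N \<inter># M + (M - N), N \<inter># M + (N - M)) \<in> Multiset.mult {(a, b). lt a b}"
    proof (rule one_step_implies_mult)
      have xJ: "x \<in># N - M" using x(2) cM cN by (simp add: in_diff_count)
      thus "N - M \<noteq> {#}" by auto
      show "\<forall>k\<in>#M - N. \<exists>j\<in>#N - M. (k, j) \<in> {(a, b). lt a b}"
      proof
        fix k assume "k \<in># M - N"
        hence k: "g k < f k" using cM cN by (simp add: in_diff_count)
        hence "k \<in> Field r" using carrier_Field[OF f, of k] by simp
        moreover have "k \<noteq> x" "\<not> lt x k" using k x by fastforce+
        ultimately have "lt k x" using lt_linear x(1) by blast
        thus "\<exists>j\<in>#N - M. (k, j) \<in> {(a, b). lt a b}" using xJ by blast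
      qed
    qed
    moreover have "N \<inter># M + (M - N) = M" "N \<inter># M + (N - M) = N" by (auto simp: multiset_eq_iff)
    ultimately show "(Abs_multiset f, Abs_multiset g) \<in> Multiset.mult {(a, b). lt a b}" by (simp add: M_def N_def)
  qed
qed

lemma Field_omega_power: "Field (omega_power r) = omega_power_carrier r"
proof
  show "Field (omega_power r) \<subseteq> omega_power_carrier r" by (auto simp: Field_def omega_power_iff)
  show "omega_power_carrier r \<subseteq> Field (omega_power r)" by (auto simp: omega_power_iff intro: FieldI1)
qed

lemma Well_order_omega_power: "Well_order (omega_power r)"
proof (rule Well_orderI)
  show "(f, f) \<in> omega_power r" if "f \<in> Field (omega_power r)" for f
    using that by (simp add: Field_omega_power omega_power_iff)
  show "(f, h) \<in> omega_power r" if "(f, g) \<in> omega_power r" "(g, h) \<in> omega_power r" for f g h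
    using that less_trans unfolding omega_power_iff by blast
  show "(f, g) \<in> omega_power r \<or> (g, f) \<in> omega_power r"
    if "f \<in> Field (omega_power r)" "g \<in> Field (omega_power r)" "f \<noteq> g" for f g
    using that less_linear unfolding Field_omega_power omega_power_iff by blast
  have "omega_power r - Id \<subseteq> {(f, g). f \<in> omega_power_carrier r \<and> g \<in> omega_power_carrier r \<and> less f g}"
    by (auto simp: omega_power_iff)
  thus "wf (omega_power r - Id)" using wf_less wf_subset by blast
qed

lemma countable_omega_power_carrier:
  assumes "countable (Field r)" shows "countable (omega_power_carrier r)"
proof -
  let ?graph = "\<lambda>f. {(x, f x) | x. f x \<noteq> 0}" 
  let ?P = "{A. finite A \<and> A \<subseteq> Field r \<times> (UNIV :: nat set)}"
  have "countable ?P" using assms by (intro countable_Collect_finite_subset) simp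
  moreover have "?graph ` omega_power_carrier r \<subseteq> ?P"
  proof
    fix A assume "A \<in> ?graph ` omega_power_carrier r"
    then obtain f where f: "f \<in> omega_power_carrier r" "A = ?graph f" by blast
    have "A = (\<lambda>x. (x, f x)) ` {x. f x \<noteq> 0}" using f(2) by auto
    moreover have "A \<subseteq> Field r \<times> UNIV" using f carrier_Field by auto
    ultimately show "A \<in> ?P" using carrier_finite[OF f(1)] by simp
  qed
  ultimately have "countable (?graph ` omega_power_carrier r)" using countable_subset by blast
  moreover have "inj_on ?graph (omega_power_carrier r)"
  proof (rule inj_onI, rule ext)
    fix f g x assume eq: "?graph f = ?graph g"
    hence "(x, v) \<in> ?graph f \<longleftrightarrow> (x, v) \<in> ?graph g" for v by simp
    hence "f x = v \<and> v \<noteq> 0 \<longleftrightarrow> g x = v \<and> v \<noteq> 0" for v by auto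
    thus "f x = g x" by (metis neq0_conv)
  qed
  ultimately show ?thesis by (rule countable_image_inj_on)
qed

definition ordinal :: "nat \<Rightarrow> (('a \<Rightarrow> nat) \<times> nat + nat) rel" where
  "ordinal n = ord_sum (ord_prod (omega_power r) (natLeq_on n)) (natLeq_on 1)"

lemma Well_order_ordinal: "Well_order (ordinal n)"
  unfolding ordinal_def
  by (intro Well_order_ord_sum Well_order_ord_prod Well_order_omega_power natLeq_on_Well_order)

lemma Field_ordinal: "Field (ordinal n) = Inl ` (omega_power_carrier r \<times> {..<n}) \<union> {Inr 0}"
  unfolding ordinal_def Field_omega_power Field_natLeq_on
    Field_ord_sum[OF Well_order_ord_prod[OF Well_order_omega_power natLeq_on_Well_order] natLeq_on_Well_order]
    Field_ord_prod[OF Well_order_omega_power natLeq_on_Well_order]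
  by auto

end

section \<open>Self-similarity of the ordinal\<close>
locale ordinal_space = exponent: exponent_order \<alpha> for \<alpha> :: "'a rel" +
  fixes n :: nat
begin

abbreviation carr :: "('a \<Rightarrow> nat) set" where "carr \<equiv> omega_power_carrier \<alpha>"
abbreviation CNF_less (infix "\<lless>" 50) where "f \<lless> g \<equiv> exponent.less f g"
abbreviation exp_less (infix "\<triangleleft>" 50) where "x \<triangleleft> z \<equiv> exponent.lt x z"

sublocale well_order_space "exponent.ordinal n"
  using exponent.Well_order_ordinal by unfold_locales

lemma lt_Inl_Inl:
  "lt (Inl (f, k)) (Inl (g, l)) \<longleftrightarrow> f \<in> carr \<and> g \<in> carr \<and> k < n \<and> l < n \<and> (k < l \<or> k = l \<and> f \<lless> g)"
proof -
  have "(Inl (f, k), Inl (g, l)) \<in> exponent.ordinal n \<longleftrightarrow>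
      f \<in> carr \<and> g \<in> carr \<and> k < n \<and> l < n \<and> (k < l \<or> k = l \<and> (f, g) \<in> omega_power \<alpha>)"
    unfolding exponent.ordinal_def ord_sum_iff ord_prod_iff exponent.Field_omega_power Field_natLeq_on by auto
  thus ?thesis using exponent.less_irrefl by (auto simp: lt_def exponent.omega_power_iff)
qed

lemma lt_Inl_Inr: "lt (Inl (f, k)) (Inr j) \<longleftrightarrow> f \<in> carr \<and> k < n \<and> j = 0"
proof -
  have "(f, k) \<in> Field (ord_prod (omega_power \<alpha>) (natLeq_on n)) \<longleftrightarrow> f \<in> carr \<and> k < n"
    unfolding Field_ord_prod[OF exponent.Well_order_omega_power natLeq_on_Well_order]
      exponent.Field_omega_power Field_natLeq_on by simp
  moreover have "j \<in> Field (natLeq_on 1) \<longleftrightarrow> j = 0" unfolding Field_natLeq_on by simp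
  ultimately show ?thesis unfolding lt_def unfolding exponent.ordinal_def Diff_iff ord_sum_iff by blast
qed

lemma not_lt_Inr: "\<not> lt (Inr i) u"
  unfolding lt_def unfolding exponent.ordinal_def Diff_iff by (cases u) (simp_all only: ord_sum_iff, auto)

lemma zero_less: assumes "f \<in> carr" "f \<noteq> (\<lambda>_. 0)" shows "(\<lambda>_. 0) \<lless> f"
proof -
  have "(\<lambda>_. 0) \<in> carr" by (simp add: omega_power_carrier_def)
  from exponent.less_linear[OF this assms(1)] show ?thesis using assms(2) by (auto simp: exponent.less_def)
qed

lemma carr_upd: assumes "f \<in> carr" "z \<in> Field \<alpha>" shows "f(z := c) \<in> carr"
proof -
  have "{x. (f(z := c)) x \<noteq> 0} \<subseteq> insert z {x. f x \<noteq> 0}" by auto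
  thus ?thesis using assms finite_subset[of _ "insert z {x. f x \<noteq> 0}"] by (auto simp: omega_power_carrier_def)
qed

text \<open>
  The points strictly between \<open>\<eta>\<close> and \<open>y\<close> form a block: they have the coordinates of \<open>f0\<close> outside of
  \<open>L\<close>, where \<open>f0\<close> vanishes on \<open>L\<close>, and arbitrary coordinates, not all 0, in \<open>L\<close>.  Let \<open>\<gamma>\<close> be the
  largest exponent in \<open>L\<close> that occurs in \<open>\<delta>\<close> or \<open>\<epsilon>\<close>.  Increasing the coefficient at \<open>\<gamma>\<close> by a
  constant preserves and reflects the order, because it does not change the largest difference of two
  functions.  With a constant larger than the coefficient \<open>e \<gamma>\<close> of \<open>\<epsilon>\<close>, the image of \<open>\<eta>\<close>
  already lies above \<open>\<epsilon>\<close>.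
\<close>
lemma self_similar_if_block:
  assumes f0: "f0 \<in> carr" and k: "k < n" and L: "L \<subseteq> Field \<alpha>" and f0L: "\<And>z. z \<in> L \<Longrightarrow> f0 z = 0"
    and y: "lt (Inl (f0, k)) y"
    and block: "\<And>u. lt (Inl (f0, k)) u \<and> lt u y \<longleftrightarrow>
      (\<exists>f\<in>carr. u = Inl (f, k) \<and> f \<noteq> f0 \<and> (\<forall>z. z \<notin> L \<longrightarrow> f z = f0 z))"
  shows "self_similar (Inl (f0, k)) y"
  unfolding self_similar_def
proof (intro conjI allI impI)
  show "lt (Inl (f0, k)) y" by (rule y)
  fix \<delta> \<epsilon> assume de: "lt (Inl (f0, k)) \<delta> \<and> lt \<delta> y \<and> lt (Inl (f0, k)) \<epsilon> \<and> lt \<epsilon> y"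
  obtain d where d: "d \<in> carr" "\<delta> = Inl (d, k)" "d \<noteq> f0" "\<And>z. z \<notin> L \<Longrightarrow> d z = f0 z" using block[of \<delta>] de by blast
  obtain e where e: "e \<in> carr" "\<epsilon> = Inl (e, k)" "e \<noteq> f0" "\<And>z. z \<notin> L \<Longrightarrow> e z = f0 z" using block[of \<epsilon>] de by blast
  let ?S = "{z \<in> L. d z \<noteq> 0 \<or> e z \<noteq> 0}"
  have "?S \<subseteq> {z. d z \<noteq> 0} \<union> {z. e z \<noteq> 0}" by auto
  hence fin: "finite ?S" 
    using exponent.carrier_finite[OF d(1)] exponent.carrier_finite[OF e(1)] by (rule finite_subset[OF _ finite_UnI])
  obtain z where "d z \<noteq> f0 z" using d(3) by auto
  hence "z \<in> ?S" using d(4) f0L by fastforce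
  hence ne: "?S \<noteq> {}" by blast
  have "?S \<subseteq> Field \<alpha>" using L by blast
  from exponent.greatest_element[OF fin ne this]
  obtain \<gamma> where g: "\<gamma> \<in> L" "\<And>z. z \<in> L \<Longrightarrow> d z \<noteq> 0 \<or> e z \<noteq> 0 \<Longrightarrow> z = \<gamma> \<or> z \<triangleleft> \<gamma>" by blast
  have gF: "\<gamma> \<in> Field \<alpha>" using g(1) L by blast
  have above: "d z = 0 \<and> e z = 0" if "z \<in> L" "\<gamma> \<triangleleft> z" for z
    using g(2)[OF that(1)] that(2) exponent.lt_trans exponent.lt_irrefl by blast
  \<comment> \<open>one more than the coefficient of \<open>\<epsilon>\<close>, so that \<open>\<epsilon>\<close> lies strictly below the image of \<open>\<eta>\<close>\<close>
  define c where "c = e \<gamma> + 1"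
  define s where "s f = f(\<gamma> := f \<gamma> + c)" for f :: "'a \<Rightarrow> nat"
  have s_carr: "s f \<in> carr" if "f \<in> carr" for f unfolding s_def using carr_upd[OF that gF] .
  have s_less: "s f \<lless> s g \<longleftrightarrow> f \<lless> g" for f g
  proof -
    have "s f x < s g x \<longleftrightarrow> f x < g x" "s f x = s g x \<longleftrightarrow> f x = g x" for x by (auto simp: s_def)
    thus ?thesis by (simp add: exponent.less_def)
  qed
  have s_inj: "s f = s g \<longleftrightarrow> f = g" for f g
  proof
    assume eq: "s f = s g"
    show "f = g"
    proof
      fix x have "s f x = s g x" using eq by simp
      thus "f x = g x" by (auto simp: s_def split: if_splits)
    qed
  qed simp
  define h where "h u = (case u of Inl (f, j) \<Rightarrow> Inl (s f, j) | Inr j \<Rightarrow> Inr j)" for u :: "('a \<Rightarrow> nat) \<times> nat + nat"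
  have h_Inl: "h (Inl (f, j)) = Inl (s f, j)" for f j by (simp add: h_def)
  have h_lt: "lt (h (Inl (f, i))) (h (Inl (g, j))) \<longleftrightarrow> lt (Inl (f, i)) (Inl (g, j))" if "f \<in> carr" "g \<in> carr" for f g i j
    using that s_carr s_less by (simp add: h_Inl lt_Inl_Inl)
  have sd: "s d \<noteq> f0" "\<And>z. z \<notin> L \<Longrightarrow> s d z = f0 z" "\<And>z. z \<in> L \<Longrightarrow> \<gamma> \<triangleleft> z \<Longrightarrow> s d z = 0"
  proof -
    have "s d \<gamma> \<noteq> 0" by (simp add: s_def c_def)
    thus "s d \<noteq> f0" using f0L[OF g(1)] by metis
    show "s d z = f0 z" if "z \<notin> L" for z using d(4)[OF that] that g(1) by (auto simp: s_def)
    show "s d z = 0" if "z \<in> L" "\<gamma> \<triangleleft> z" for z using above[OF that] that exponent.lt_irrefl by (auto simp: s_def)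
  qed
  have sdy: "lt (Inl (f0, k)) (Inl (s d, k)) \<and> lt (Inl (s d, k)) y" using block[of "Inl (s d, k)"] s_carr[OF d(1)] sd by blast
  \<comment> \<open>below a point of the block whose coordinates vanish above \<gamma>, all points have this property\<close>
  have vanish: "\<exists>f\<in>carr. u = Inl (f, k) \<and> (\<forall>z. z \<notin> L \<longrightarrow> f z = f0 z) \<and> (\<forall>z\<in>L. \<gamma> \<triangleleft> z \<longrightarrow> f z = 0)"
    if u: "lt (Inl (f0, k)) u" "u = Inl (b, k) \<or> lt u (Inl (b, k))" and b: "lt (Inl (b, k)) y"
      "\<And>z. z \<notin> L \<Longrightarrow> b z = f0 z" "\<And>z. z \<in> L \<Longrightarrow> \<gamma> \<triangleleft> z \<Longrightarrow> b z = 0" for u b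
  proof -
    have "lt u y" using u(2) b(1) lt_trans by blast
    then obtain f where f: "f \<in> carr" "u = Inl (f, k)" "\<And>z. z \<notin> L \<Longrightarrow> f z = f0 z" using block[of u] u(1) by blast
    have "f z = 0" if z: "z \<in> L" "\<gamma> \<triangleleft> z" for z
    proof (rule ccontr)
      assume nz: "f z \<noteq> 0"
      have "f \<noteq> b" using nz b(3)[OF z] by auto
      hence "f \<lless> b" using u(2) f(2) by (auto simp: lt_Inl_Inl)
      then obtain x where x: "x \<in> Field \<alpha>" "f x < b x" "\<And>z. x \<triangleleft> z \<Longrightarrow> f z = b z" unfolding exponent.less_def by blast
      have xL: "x \<in> L" using x(2) f(3) b(2) by fastforce
      have "\<not> \<gamma> \<triangleleft> x" using b(3)[OF xL] x(2) by auto
      hence "x = \<gamma> \<or> x \<triangleleft> \<gamma>" using exponent.lt_linear[OF x(1) gF] by blast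
      hence "x \<triangleleft> z" using z(2) exponent.lt_trans by blast
      thus False using x(3) b(3)[OF z] nz by simp
    qed
    thus ?thesis using f by blast
  qed
  let ?\<eta> = "Inl (f0, k)" and ?a = "Inl (s f0, k)" and ?b = "Inl (s d, k)"
  have bij: "bij_betw h (Ioc ?\<eta> \<delta>) (Ioc ?a ?b)"
    unfolding bij_betw_def
  proof (intro conjI equalityI subsetI)
    have form: "\<exists>f\<in>carr. u = Inl (f, k)" if "u \<in> Ioc ?\<eta> \<delta>" for u
      using block[of u] that de lt_trans unfolding mem_Ioc by blast
    show "inj_on h (Ioc ?\<eta> \<delta>)"
    proof (rule inj_onI)
      fix u v assume uv: "u \<in> Ioc ?\<eta> \<delta>" "v \<in> Ioc ?\<eta> \<delta>" "h u = h v"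
      obtain f g where "u = Inl (f, k)" "v = Inl (g, k)" using form uv by blast
      thus "u = v" using uv(3) s_inj by (simp add: h_Inl)
    qed
    fix w assume "w \<in> h ` Ioc ?\<eta> \<delta>"
    then obtain u where u: "u \<in> Ioc ?\<eta> \<delta>" "w = h u" by blast
    obtain f where f: "f \<in> carr" "u = Inl (f, k)" using form u(1) by blast
    have "lt ?a w" using u f h_lt[OF f0 f(1), of k k] by (simp add: mem_Ioc h_Inl)
    moreover have "w = ?b \<or> lt w ?b" using u f h_lt[OF f(1) d(1), of k k] d(2) s_inj by (auto simp: mem_Ioc h_Inl)
    ultimately show "w \<in> Ioc ?a ?b" by (simp add: mem_Ioc)
  next
    fix w assume w: "w \<in> Ioc ?a ?b"
    have \<eta>a: "lt ?\<eta> ?a"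
    proof -
      have "f0 \<lless> s f0" unfolding exponent.less_def
        by (rule bexI[OF _ gF]) (auto simp: s_def c_def exponent.lt_irrefl)
      thus ?thesis using f0 k s_carr by (simp add: lt_Inl_Inl)
    qed
    hence \<eta>w: "lt ?\<eta> w" using w lt_trans by (auto simp: mem_Ioc)
    have "w = ?b \<or> lt w ?b" using w by (simp add: mem_Ioc)
    from vanish[OF \<eta>w this] sdy sd(2,3)
    obtain f where f: "f \<in> carr" "w = Inl (f, k)" "\<And>z. z \<notin> L \<Longrightarrow> f z = f0 z" "\<And>z. z \<in> L \<Longrightarrow> \<gamma> \<triangleleft> z \<Longrightarrow> f z = 0" by blast
    have "s f0 \<lless> f" using w f(2) by (simp add: mem_Ioc lt_Inl_Inl)
    then obtain x where x: "x \<in> Field \<alpha>" "s f0 x < f x" "\<And>z. x \<triangleleft> z \<Longrightarrow> s f0 z = f z" unfolding exponent.less_def by blast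
    have "c \<le> f \<gamma>"
    proof (rule ccontr)
      assume lt_c: "\<not> c \<le> f \<gamma>"
      have sg: "s f0 \<gamma> = c" using f0L[OF g(1)] by (simp add: s_def)
      have ne: "x \<noteq> \<gamma>" using x(2) sg lt_c by auto
      have nx: "\<not> x \<triangleleft> \<gamma>" using x(3) sg lt_c by fastforce
      hence gx: "\<gamma> \<triangleleft> x" using exponent.lt_linear[OF x(1) gF] ne by blast
      have "s f0 x = f0 x" using ne by (simp add: s_def)
      hence "x \<in> L" using x(2) f(3) by fastforce
      thus False using f(4)[OF _ gx] x(2) by simp
    qed
    define v where "v = f(\<gamma> := f \<gamma> - c)"
    have v: "v \<in> carr" unfolding v_def using carr_upd[OF f(1) gF] .
    have sv: "s v = f" using \<open>c \<le> f \<gamma>\<close> by (auto simp: s_def v_def fun_eq_iff)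
    have "lt ?\<eta> (Inl (v, k))" using h_lt[OF f0 v, of k k] w f(2) sv by (simp add: h_Inl mem_Ioc)
    moreover have "Inl (v, k) = \<delta> \<or> lt (Inl (v, k)) \<delta>"
      using h_lt[OF v d(1), of k k] w f(2) sv d(2) s_inj by (auto simp: h_Inl mem_Ioc)
    ultimately have "Inl (v, k) \<in> Ioc ?\<eta> \<delta>" by (simp add: mem_Ioc)
    moreover have "w = h (Inl (v, k))" using f(2) sv by (simp add: h_Inl)
    ultimately show "w \<in> h ` Ioc ?\<eta> \<delta>" by blast
  qed
  have mono: "lt (h u) (h v)" if uv: "u \<in> Ioc ?\<eta> \<delta>" "v \<in> Ioc ?\<eta> \<delta>" "lt u v" for u v
  proof -
    have "\<exists>f\<in>carr. w = Inl (f, k)" if "w \<in> Ioc ?\<eta> \<delta>" for w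
      using block[of w] that de lt_trans unfolding mem_Ioc by blast
    then obtain f g where "f \<in> carr" "g \<in> carr" "u = Inl (f, k)" "v = Inl (g, k)" using uv by blast
    thus ?thesis using h_lt uv(3) by simp
  qed
  have "e \<lless> s f0" unfolding exponent.less_def
  proof (rule bexI[OF _ gF], intro conjI allI impI)
    show "e \<gamma> < s f0 \<gamma>" by (simp add: s_def c_def)
    fix z assume z: "\<gamma> \<triangleleft> z"
    hence "s f0 z = f0 z" using exponent.lt_irrefl by (auto simp: s_def)
    moreover have "e z = f0 z" using above[OF _ z] e(4) f0L by (cases "z \<in> L") auto
    ultimately show "e z = s f0 z" by simp
  qed
  hence "lt \<epsilon> ?a" using e k s_carr[OF f0] by (simp add: lt_Inl_Inl)
  moreover have "?a \<in> Field (exponent.ordinal n)" using s_carr[OF f0] k by (auto simp: exponent.Field_ordinal)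
  ultimately show "\<exists>h a b. bij_betw h (Ioc ?\<eta> \<delta>) (Ioc a b) \<and>
      (\<forall>u v. u \<in> Ioc ?\<eta> \<delta> \<longrightarrow> v \<in> Ioc ?\<eta> \<delta> \<longrightarrow> lt u v \<longrightarrow> lt (h u) (h v)) \<and>
      lt \<epsilon> a \<and> a \<in> Field (exponent.ordinal n) \<and> lt b y"
    using bij mono sdy by (intro exI[of _ h] exI[of _ ?a] exI[of _ ?b]) blast
qed

text \<open>
  If \<open>\<beta>\<close> is the smallest exponent of \<open>f\<close>, then \<open>f = f0 + \<omega>\<^sup>\<beta>\<close>, and the ordinals strictly between
  \<open>f0\<close> and \<open>f\<close> are the \<open>f0 + \<xi>\<close> with \<open>0 < \<xi> < \<omega>\<^sup>\<beta>\<close>.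
\<close>
lemma block_below_power:
  assumes f: "f \<in> carr" and b: "\<beta> \<in> Field \<alpha>" "f \<beta> \<noteq> 0" "\<And>z. z \<triangleleft> \<beta> \<Longrightarrow> f z = 0"
    and f0: "f0 = f(\<beta> := f \<beta> - 1)" and g: "g \<in> carr"
  shows "f0 \<lless> g \<and> g \<lless> f \<longleftrightarrow> g \<noteq> f0 \<and> (\<forall>z. \<not> z \<triangleleft> \<beta> \<longrightarrow> g z = f0 z)"
proof
  assume A: "f0 \<lless> g \<and> g \<lless> f"
  obtain x where x: "x \<in> Field \<alpha>" "f0 x < g x" "\<And>z. x \<triangleleft> z \<Longrightarrow> f0 z = g z" using A unfolding exponent.less_def by blast
  obtain x' where x': "x' \<in> Field \<alpha>" "g x' < f x'" "\<And>z. x' \<triangleleft> z \<Longrightarrow> g z = f z" using A unfolding exponent.less_def by blast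
  have xb: "x \<triangleleft> \<beta>"
  proof (rule ccontr)
    assume "\<not> x \<triangleleft> \<beta>"
    hence cases: "x = \<beta> \<or> \<beta> \<triangleleft> x" using exponent.lt_linear[OF x(1) b(1)] by blast
    have fx: "f x \<le> g x" using x(2) f0 by (cases "x = \<beta>") auto
    have above: "f z = g z" if "x \<triangleleft> z" for z
    proof -
      have "z \<noteq> \<beta>" using cases that exponent.lt_trans exponent.lt_irrefl by blast
      thus ?thesis using x(3)[OF that] f0 by simp
    qed
    have "x' \<noteq> x" "\<not> x \<triangleleft> x'" using x'(2) fx above by fastforce+
    hence x'x: "x' \<triangleleft> x" using exponent.lt_linear[OF x(1) x'(1)] by blast
    hence gx: "g x = f x" by (rule x'(3))
    have xb: "x = \<beta>"
    proof (rule ccontr)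
      assume "x \<noteq> \<beta>"
      hence "f0 x = f x" using f0 by simp
      thus False using x(2) gx by simp
    qed
    hence "f x' = 0" using b(3) x'x by blast
    thus False using x'(2) by simp
  qed
  have "g z = f0 z" if z: "\<not> z \<triangleleft> \<beta>" for z
  proof (cases "z \<in> Field \<alpha>")
    case True
    hence "x \<triangleleft> z" using z xb exponent.lt_linear[OF True b(1)] exponent.lt_trans by blast
    thus ?thesis using x(3) by simp
  next
    case False
    hence "g z = 0" "f z = 0" "z \<noteq> \<beta>" using exponent.carrier_Field g f b(1) by blast+
    thus ?thesis using f0 by simp
  qed
  moreover have "g \<noteq> f0" using A exponent.less_irrefl by blast
  ultimately show "g \<noteq> f0 \<and> (\<forall>z. \<not> z \<triangleleft> \<beta> \<longrightarrow> g z = f0 z)" by blast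
next
  assume A: "g \<noteq> f0 \<and> (\<forall>z. \<not> z \<triangleleft> \<beta> \<longrightarrow> g z = f0 z)"
  have f0c: "f0 \<in> carr" unfolding f0 using carr_upd[OF f b(1)] .
  obtain x where x: "x \<in> Field \<alpha>" "f0 x \<noteq> g x" "\<And>z. x \<triangleleft> z \<Longrightarrow> f0 z = g z"
    using exponent.greatest_difference[OF f0c g] A by metis
  have xb: "x \<triangleleft> \<beta>" using x(2) A by metis
  hence "f0 x = 0" using b(3) f0 exponent.lt_irrefl by (metis fun_upd_other)
  hence "f0 \<lless> g" using x unfolding exponent.less_def by (metis gr0I)
  moreover have "g \<lless> f" unfolding exponent.less_def
  proof (rule bexI[OF _ b(1)], intro conjI allI impI)
    have "g \<beta> = f0 \<beta>" using A exponent.lt_irrefl by blast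
    thus "g \<beta> < f \<beta>" using f0 b(2) by simp
    fix z assume z: "\<beta> \<triangleleft> z"
    hence "\<not> z \<triangleleft> \<beta>" "z \<noteq> \<beta>" using exponent.lt_trans exponent.lt_irrefl by blast+
    thus "g z = f z" using A f0 by simp
  qed
  ultimately show "f0 \<lless> g \<and> g \<lless> f" by blast
qed

text \<open>
  The points other than the first one are of three kinds: \<open>y = f0 + \<omega>\<^sup>\<beta>\<close> inside one of the \<open>n\<close> copies of
  \<open>\<omega>\<^sup>\<alpha>\<close>, the first point of a copy other than the first, and the last point of the space.  In the
  last two cases the block is the whole preceding copy, and \<open>\<eta>\<close> is its first point.
\<close>
lemma self_similar_exists:
  assumes "lt x y" shows "\<exists>\<eta>. self_similar \<eta> y"
proof -
  let ?Z = "\<lambda>_::'a. 0 :: nat"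
  have zero: "?Z \<in> carr" by (simp add: omega_power_carrier_def)
  have not_less_zero: "\<not> f \<lless> ?Z" for f by (simp add: exponent.less_def)
  have off: "f z = 0" if "f \<in> carr" "z \<notin> Field \<alpha>" for f z using that exponent.carrier_Field by blast
  have "y \<in> Field (exponent.ordinal n)" using assms lt_Field by blast
  then consider f k where "y = Inl (f, k)" "f \<in> carr" "k < n" | "y = Inr 0" by (auto simp: exponent.Field_ordinal)
  thus ?thesis
  proof cases
    case (1 f k)
    show ?thesis
    proof (cases "f = ?Z")
      case False
      have "{z. f z \<noteq> 0} \<subseteq> Field \<alpha>" "{z. f z \<noteq> 0} \<noteq> {}" using exponent.carrier_Field[OF 1(2)] False by auto
      from exponent.least_element[OF this]
      obtain \<beta> where b: "f \<beta> \<noteq> 0" "\<And>z. f z \<noteq> 0 \<Longrightarrow> z = \<beta> \<or> \<beta> \<triangleleft> z" by blast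
      have bF: "\<beta> \<in> Field \<alpha>" using b(1) exponent.carrier_Field[OF 1(2)] by blast
      have below: "f z = 0" if "z \<triangleleft> \<beta>" for z using b(2)[of z] that exponent.lt_trans exponent.lt_irrefl by blast
      define f0 where "f0 = f(\<beta> := f \<beta> - 1)"
      have f0c: "f0 \<in> carr" unfolding f0_def using carr_upd[OF 1(2) bF] .
      note blk = block_below_power[OF 1(2) bF b(1) below f0_def]
      have "f0 \<lless> f" unfolding exponent.less_def
        by (rule bexI[OF _ bF]) (use b(1) in \<open>auto simp: f0_def exponent.lt_irrefl\<close>)
      hence f0y: "lt (Inl (f0, k)) y" using 1 f0c by (simp add: lt_Inl_Inl)
      have "self_similar (Inl (f0, k)) y"
      proof (rule self_similar_if_block[OF f0c 1(3) _ _ f0y, of "{z. z \<triangleleft> \<beta>}"])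
        show "{z. z \<triangleleft> \<beta>} \<subseteq> Field \<alpha>" using exponent.lt_Field by blast
        show "f0 z = 0" if "z \<in> {z. z \<triangleleft> \<beta>}" for z using below that exponent.lt_irrefl by (auto simp: f0_def)
        fix u
        show "lt (Inl (f0, k)) u \<and> lt u y \<longleftrightarrow>
          (\<exists>g\<in>carr. u = Inl (g, k) \<and> g \<noteq> f0 \<and> (\<forall>z. z \<notin> {z. z \<triangleleft> \<beta>} \<longrightarrow> g z = f0 z))"
        proof (cases u)
          case (Inl p)
          obtain g j where p: "p = (g, j)" by (cases p)
          have "lt (Inl (f0, k)) u \<and> lt u y \<longleftrightarrow> j = k \<and> g \<in> carr \<and> f0 \<lless> g \<and> g \<lless> f"
            unfolding Inl p 1(1) lt_Inl_Inl using f0c 1(2,3) by auto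
          also have "\<dots> \<longleftrightarrow> j = k \<and> g \<in> carr \<and> g \<noteq> f0 \<and> (\<forall>z. \<not> z \<triangleleft> \<beta> \<longrightarrow> g z = f0 z)"
            using blk by blast
          finally show ?thesis unfolding Inl p by auto
        next
          case (Inr i)
          thus ?thesis using not_lt_Inr by auto
        qed
      qed
      thus ?thesis by blast
    next
      case True
      have "k \<noteq> 0"
      proof
        assume "k = 0"
        have "x \<in> Field (exponent.ordinal n)" using assms lt_Field by blast
        thus False using assms \<open>k = 0\<close> True 1(1) not_less_zero not_lt_Inr by (auto simp: exponent.Field_ordinal lt_Inl_Inl)
      qed
      hence k: "k - 1 < n" "k - 1 < k" using 1(3) by auto
      have zy: "lt (Inl (?Z, k - 1)) y" using 1 k zero by (simp add: lt_Inl_Inl)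
      have "self_similar (Inl (?Z, k - 1)) y"
      proof (rule self_similar_if_block[OF zero k(1) subset_refl _ zy])
        fix u
        show "lt (Inl (?Z, k - 1)) u \<and> lt u y \<longleftrightarrow>
          (\<exists>g\<in>carr. u = Inl (g, k - 1) \<and> g \<noteq> ?Z \<and> (\<forall>z. z \<notin> Field \<alpha> \<longrightarrow> g z = 0))"
        proof (cases u)
          case (Inl p)
          obtain g j where p: "p = (g, j)" by (cases p)
          have "lt (Inl (?Z, k - 1)) u \<and> lt u y \<longleftrightarrow> j = k - 1 \<and> g \<in> carr \<and> ?Z \<lless> g"
            unfolding Inl p 1(1) True lt_Inl_Inl using zero 1(3) k not_less_zero by auto
          also have "\<dots> \<longleftrightarrow> j = k - 1 \<and> g \<in> carr \<and> g \<noteq> ?Z"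
            using zero_less exponent.less_irrefl by blast
          finally show ?thesis unfolding Inl p using off by auto
        next
          case (Inr i)
          thus ?thesis using not_lt_Inr by auto
        qed
      qed simp
      thus ?thesis by blast
    qed
  next
    case 2
    have "x \<in> Field (exponent.ordinal n)" using assms lt_Field by blast
    hence "n \<noteq> 0" using assms 2 not_lt_Inr by (auto simp: exponent.Field_ordinal)
    hence k: "n - 1 < n" by simp
    have zy: "lt (Inl (?Z, n - 1)) y" using 2 k zero by (simp add: lt_Inl_Inr)
    have "self_similar (Inl (?Z, n - 1)) y"
    proof (rule self_similar_if_block[OF zero k subset_refl _ zy])
      fix u
      show "lt (Inl (?Z, n - 1)) u \<and> lt u y \<longleftrightarrow>
        (\<exists>g\<in>carr. u = Inl (g, n - 1) \<and> g \<noteq> ?Z \<and> (\<forall>z. z \<notin> Field \<alpha> \<longrightarrow> g z = 0))"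
      proof (cases u)
        case (Inl p)
        obtain g j where p: "p = (g, j)" by (cases p)
        have "lt (Inl (?Z, n - 1)) u \<and> lt u y \<longleftrightarrow> j = n - 1 \<and> g \<in> carr \<and> ?Z \<lless> g"
          unfolding Inl p 2 lt_Inl_Inl lt_Inl_Inr using zero k by auto
        also have "\<dots> \<longleftrightarrow> j = n - 1 \<and> g \<in> carr \<and> g \<noteq> ?Z"
          using zero_less exponent.less_irrefl by blast
        finally show ?thesis unfolding Inl p using off by auto
      next
        case (Inr i)
        thus ?thesis using not_lt_Inr by auto
      qed
    qed simp
    thus ?thesis by blast
  qed
qed

lemma automatic_continuity_ordinal:
  assumes "countable (Field \<alpha>)"
  shows "automatic_continuity TYPE('h) (Homeo T) (Homeo_topology T)"
proof (rule automatic_continuity_Homeo)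
  show "countable (Field (exponent.ordinal n))"
    using exponent.countable_omega_power_carrier[OF assms] by (simp add: exponent.Field_ordinal)
  show "Inr 0 \<in> Field (exponent.ordinal n)" by (simp add: exponent.Field_ordinal)
  show "z = Inr 0 \<or> lt z (Inr 0)" if "z \<in> Field (exponent.ordinal n)" for z
    using that by (auto simp: exponent.Field_ordinal lt_Inl_Inr)
qed (rule self_similar_exists)

end

theorem corollary1p4:
  fixes \<alpha> :: "'a rel" and n :: nat
  defines "X \<equiv> order_topology_of
     (ord_sum (ord_prod (omega_power \<alpha>) (natLeq_on n)) (natLeq_on 1))"
  assumes "Well_order \<alpha>" and "countable (Field \<alpha>)"
  shows "automatic_continuity TYPE('h) (Homeo X) (Homeo_topology X)"
proof -
  interpret ordinal_space \<alpha> n using assms(2) by unfold_locales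
  show ?thesis unfolding X_def using automatic_continuity_ordinal[OF assms(3)] by (simp only: exponent.ordinal_def)
qed

end
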